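(* Suppose $X$ is a quasi-Banach space such that $X^*$ is isomorphic to a subspace of an $L_1$-space, and $Y$ is a quasi-Banach space of cotype $q<\infty$. Then there is a constant $C$ (depending only on $X$ and $Y$) such that if $u:X\to Y$ is a strongly approximable operator then $\delta(u)\le C\|u\|$.
   Context: A quasi-Banach space is a complete quasi-normed space; it need not be locally convex. By the Aoki–Rolewicz theorem every quasi-norm is equivalent to an $r$-norm for some $0<r\le 1$, i.e. a quasi-norm satisfying $\|x+y\|^r\le\|x\|^r+\|y\|^r$. The dual $X^*$ is the Banach space of all bounded linear functionals on $X$. An $L_1$-space is a space $L_1(\mu)$ for some measure $\mu$. $\mathcal L(X,Y)$ is the space of bounded linear operators $X\to Y$. An operator $u:X\to Y$ is strongly approximable if it belongs to $\mathcal A(X,Y)$, the smallest linear subspace of $\mathcal L(X,Y)$ which contains the finite-rank operators and is closed under pointwise convergence of bounded nets. $\delta(u)$ is the infimum of $\|v\|\|w\|$ over all factorizations $u=vw$ with $w:X\to B$, $v:B\to Y$ bounded linear and $B$ a Banach space ($\delta(u)=\infty$ if there is no such factorization). Let $D_N=\{-1,+1\}^N$ with normalized counting measure $\lambda$ and let $\epsilon_i(t)=t_i$. For $q\ge2$, a quasi-Banach space $Y$ has cotype $q$ if there is a constant $C'$ such that for all $N$ and all $y_1,\dots,y_N\in Y$, $\left(\sum_{i=1}^N\|y_i\|^q\right)^{1/q}\le C'\left(\int_{D_N}\|\sum_{i=1}^N\epsilon_i y_i\|^q\,d\lambda\right)^{1/q}$. *)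

theory Defs
  imports "HOL-Probability.Probability_Measure" "HOL-Library.Function_Algebras"
begin

text \<open>
  The scalar field is a type \<open>'k\<close> of sort \<open>{real_normed_field, euclidean_space}\<close>; up to
  isometric isomorphism such a field is the real or the complex numbers.

  A space is a linear subspace \<open>carrier\<close> of an ambient \<open>'k\<close>-vector space, with a quasi-norm that
  matters only on \<open>carrier\<close>.
\<close>

record ('k, 'a) qspace =
  carrier :: "'a set"
  smul :: "'k \<Rightarrow> 'a \<Rightarrow> 'a"
  qnorm :: "'a \<Rightarrow> real"

definition quasi_normed ::
    "('k::{real_normed_field,euclidean_space}, 'a::ab_group_add) qspace \<Rightarrow> bool" where
  "quasi_normed V \<longleftrightarrow>
     vector_space (smul V) \<and> module.subspace (smul V) (carrier V) \<and>
     (\<forall>x\<in>carrier V. 0 \<le> qnorm V x) \<and>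
     (\<forall>x\<in>carrier V. qnorm V x = 0 \<longleftrightarrow> x = 0) \<and>
     (\<forall>c. \<forall>x\<in>carrier V. qnorm V (smul V c x) = norm c * qnorm V x) \<and>
     (\<exists>K. \<forall>x\<in>carrier V. \<forall>y\<in>carrier V. qnorm V (x + y) \<le> K * (qnorm V x + qnorm V y))"

definition complete_qspace :: "('k, 'a::ab_group_add) qspace \<Rightarrow> bool" where
  "complete_qspace V \<longleftrightarrow>
     (\<forall>s::nat \<Rightarrow> 'a. (\<forall>n. s n \<in> carrier V) \<longrightarrow>
        (\<forall>e>0. \<exists>N. \<forall>m\<ge>N. \<forall>n\<ge>N. qnorm V (s m - s n) < e) \<longrightarrow>
        (\<exists>l\<in>carrier V. (\<lambda>n. qnorm V (s n - l)) \<longlonglongrightarrow> 0))"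

definition quasi_banach ::
    "('k::{real_normed_field,euclidean_space}, 'a::ab_group_add) qspace \<Rightarrow> bool" where
  "quasi_banach V \<longleftrightarrow> quasi_normed V \<and> complete_qspace V"

definition banach_space ::
    "('k::{real_normed_field,euclidean_space}, 'a::ab_group_add) qspace \<Rightarrow> bool" where
  "banach_space V \<longleftrightarrow> quasi_banach V \<and>
     (\<forall>x\<in>carrier V. \<forall>y\<in>carrier V. qnorm V (x + y) \<le> qnorm V x + qnorm V y)"

text \<open>
  Operators are normalised to vanish outside the carrier of the domain, so that equality of
  operators is equality of functions and the operators form a linear space under the
  pointwise operations.
\<close>

definition bounded_ops ::
    "('k, 'a::ab_group_add) qspace \<Rightarrow> ('k, 'b::ab_group_add) qspace \<Rightarrow> ('a \<Rightarrow> 'b) set" where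
  "bounded_ops V W = {u.
     (\<forall>x. x \<notin> carrier V \<longrightarrow> u x = 0) \<and>
     (\<forall>x\<in>carrier V. u x \<in> carrier W) \<and>
     (\<forall>x\<in>carrier V. \<forall>y\<in>carrier V. u (x + y) = u x + u y) \<and>
     (\<forall>c. \<forall>x\<in>carrier V. u (smul V c x) = smul W c (u x)) \<and>
     (\<exists>K. \<forall>x\<in>carrier V. qnorm W (u x) \<le> K * qnorm V x)}"

definition opnorm :: "('k, 'a) qspace \<Rightarrow> ('k, 'b) qspace \<Rightarrow> ('a \<Rightarrow> 'b) \<Rightarrow> real" where
  "opnorm V W u = (SUP x\<in>{x \<in> carrier V. qnorm V x \<le> 1}. qnorm W (u x))"

definition scalars :: "('k::{real_normed_field,euclidean_space}, 'k) qspace" where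
  "scalars = \<lparr>carrier = UNIV, smul = (*), qnorm = norm\<rparr>"

definition dual ::
    "('k::{real_normed_field,euclidean_space}, 'a::ab_group_add) qspace \<Rightarrow> ('k, 'a \<Rightarrow> 'k) qspace" where
  "dual V = \<lparr>carrier = bounded_ops V scalars, smul = (\<lambda>c f x. c * f x), qnorm = opnorm V scalars\<rparr>"

text \<open>
  An isomorphism of \<open>V\<close> onto a subspace of \<open>L\<^sub>1(M)\<close>. Elements of \<open>L\<^sub>1(M)\<close> are given by
  representatives, hence linearity holds almost everywhere; the lower bound makes the map injective.
\<close>

definition embeds_in_L1 ::
    "('k::{real_normed_field,euclidean_space}, 'a::ab_group_add) qspace \<Rightarrow> 'm measure \<Rightarrow> bool" where
  "embeds_in_L1 V M \<longleftrightarrow>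
     (\<exists>J :: 'a \<Rightarrow> 'm \<Rightarrow> 'k.
        (\<forall>f\<in>carrier V. integrable M (J f)) \<and>
        (\<forall>f\<in>carrier V. \<forall>g\<in>carrier V. AE t in M. J (f + g) t = J f t + J g t) \<and>
        (\<forall>c. \<forall>f\<in>carrier V. AE t in M. J (smul V c f) t = c * J f t) \<and>
        (\<exists>a b. 0 < a \<and> (\<forall>f\<in>carrier V.
           a * qnorm V f \<le> (\<integral>t. norm (J f t) \<partial>M) \<and> (\<integral>t. norm (J f t) \<partial>M) \<le> b * qnorm V f)))"

definition finite_rank_ops ::
    "('k::{real_normed_field,euclidean_space}, 'a::ab_group_add) qspace \<Rightarrow>
     ('k, 'b::ab_group_add) qspace \<Rightarrow> ('a \<Rightarrow> 'b) set" where
  "finite_rank_ops V W =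
     {u \<in> bounded_ops V W. \<exists>F. finite F \<and> u ` carrier V \<subseteq> module.span (smul W) F}"

text \<open>
  Nets are rendered by proper filters on the set of operators; a net can be replaced by its filter
  of tails, and a bounded net by a filter that eventually lives on a bounded set.
  Convergence \<open>v x \<rightarrow> u x\<close> in the topology of \<open>W\<close> means \<open>qnorm W (v x - u x) \<rightarrow> 0\<close>, as the
  quasi-norm itself need not be continuous.
\<close>

definition bounded_pointwise_closed ::
    "('k, 'a::ab_group_add) qspace \<Rightarrow> ('k, 'b::ab_group_add) qspace \<Rightarrow> ('a \<Rightarrow> 'b) set \<Rightarrow> bool" where
  "bounded_pointwise_closed V W S \<longleftrightarrow>
     (\<forall>(F :: ('a \<Rightarrow> 'b) filter) u K.
        F \<noteq> bot \<longrightarrow> u \<in> bounded_ops V W \<longrightarrow>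
        (\<forall>\<^sub>F v in F. v \<in> S \<and> opnorm V W v \<le> K) \<longrightarrow>
        (\<forall>x\<in>carrier V. ((\<lambda>v. qnorm W (v x - u x)) \<longlongrightarrow> 0) F) \<longrightarrow>
        u \<in> S)"

definition strongly_approximable ::
    "('k::{real_normed_field,euclidean_space}, 'a::ab_group_add) qspace \<Rightarrow>
     ('k, 'b::ab_group_add) qspace \<Rightarrow> ('a \<Rightarrow> 'b) set" where
  "strongly_approximable V W =
     \<Inter> {S. S \<subseteq> bounded_ops V W \<and>
          module.subspace (\<lambda>c u x. smul W c (u x)) S \<and>
          finite_rank_ops V W \<subseteq> S \<and>
          bounded_pointwise_closed V W S}"

definition sign_cube :: "nat \<Rightarrow> (nat \<Rightarrow> real) set" where
  "sign_cube N = {1..N} \<rightarrow>\<^sub>E {-1, 1}"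

definition cotype ::
    "real \<Rightarrow> ('k::{real_normed_field,euclidean_space}, 'a::ab_group_add) qspace \<Rightarrow> bool" where
  "cotype q V \<longleftrightarrow>
     (\<exists>C. \<forall>N. \<forall>y :: nat \<Rightarrow> 'a. (\<forall>i\<in>{1..N}. y i \<in> carrier V) \<longrightarrow>
        (\<Sum>i=1..N. qnorm V (y i) powr q) powr (1 / q)
        \<le> C * (\<integral>t. qnorm V (\<Sum>i=1..N. smul V (of_real (t i)) (y i)) powr q
                  \<partial>uniform_count_measure (sign_cube N)) powr (1 / q))"

text \<open>
  The infimum has to range over Banach spaces in a fixed type. Replacing \<open>B\<close> by the closure of the
  range of \<open>w\<close>, every element of \<open>B\<close> becomes the limit of the image of a sequence in \<open>V\<close>, so up to
  isometry \<open>B\<close> lives in \<open>nat \<Rightarrow> 'a\<close>. Lemma \<open>delta_le\<close> below shows that no factorization through a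
  Banach space in any other type is lost. The infimum of the empty set is \<open>\<infinity>\<close>.
\<close>

definition delta ::
    "('k::{real_normed_field,euclidean_space}, 'a::ab_group_add) qspace \<Rightarrow>
     ('k, 'b::ab_group_add) qspace \<Rightarrow> ('a \<Rightarrow> 'b) \<Rightarrow> ennreal" where
  "delta V W u =
     Inf {ennreal (opnorm B W v * opnorm V B w) | (B :: ('k, nat \<Rightarrow> 'a) qspace) v w.
        banach_space B \<and> w \<in> bounded_ops V B \<and> v \<in> bounded_ops B W \<and> u = v \<circ> w}"

lemma delta_le:
  fixes V :: "('k::{real_normed_field,euclidean_space}, 'a::ab_group_add) qspace"
    and W :: "('k, 'b::ab_group_add) qspace"
    and B :: "('k, 'c::ab_group_add) qspace"
  assumes V: "quasi_normed V" and W: "quasi_normed W" and B: "banach_space B"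
    and w: "w \<in> bounded_ops V B" and v: "v \<in> bounded_ops B W"
  shows "delta V W (v \<circ> w) \<le> ennreal (opnorm B W v * opnorm V B w)"
proof -
  have qB: "quasi_normed B" and cB: "complete_qspace B"
    and tri: "\<And>x y. x \<in> carrier B \<Longrightarrow> y \<in> carrier B \<Longrightarrow> qnorm B (x + y) \<le> qnorm B x + qnorm B y"
    using B by (auto simp: banach_space_def quasi_banach_def)
  define S :: "'k \<Rightarrow> (nat \<Rightarrow> 'a) \<Rightarrow> nat \<Rightarrow> 'a" where "S c f = (\<lambda>n. smul V c (f n))" for c f
  interpret V: vector_space "smul V" using V by (simp add: quasi_normed_def)
  interpret W: vector_space "smul W" using W by (simp add: quasi_normed_def)
  interpret B: vector_space "smul B" using qB by (simp add: quasi_normed_def)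
  interpret S: vector_space S
    by unfold_locales
      (auto simp: S_def fun_eq_iff V.scale_right_distrib V.scale_left_distrib)
  interpret BS: vector_space_pair "smul B" S ..
  have subV: "V.subspace (carrier V)" and subB: "B.subspace (carrier B)"
    and subW: "W.subspace (carrier W)"
    using V qB W by (auto simp: quasi_normed_def)
  have n0: "0 \<le> qnorm B x" and nz: "qnorm B x = 0 \<longleftrightarrow> x = 0"
    and ns: "qnorm B (smul B c x) = norm c * qnorm B x" if "x \<in> carrier B" for x c
    using qB that by (auto simp: quasi_normed_def)
  have nneg: "qnorm B (- x) = qnorm B x" if "x \<in> carrier B" for x
    using ns[OF that, of "-1"] by (simp add: B.scale_minus_left)
  have nd: "qnorm B (x - y) = qnorm B (y - x)" if "x \<in> carrier B" "y \<in> carrier B" for x y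
    using nneg[OF B.subspace_diff[OF subB that]] by simp
  have w0: "\<And>x. x \<notin> carrier V \<Longrightarrow> w x = 0" and wc: "\<And>x. x \<in> carrier V \<Longrightarrow> w x \<in> carrier B"
    and wadd: "\<And>x y. x \<in> carrier V \<Longrightarrow> y \<in> carrier V \<Longrightarrow> w (x + y) = w x + w y"
    and ws: "\<And>c x. x \<in> carrier V \<Longrightarrow> w (smul V c x) = smul B c (w x)"
    and wb: "\<exists>K. \<forall>x\<in>carrier V. qnorm B (w x) \<le> K * qnorm V x"
    using w by (auto simp: bounded_ops_def)
  have vc: "\<And>x. x \<in> carrier B \<Longrightarrow> v x \<in> carrier W"
    and vadd: "\<And>x y. x \<in> carrier B \<Longrightarrow> y \<in> carrier B \<Longrightarrow> v (x + y) = v x + v y"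
    and vs: "\<And>c x. x \<in> carrier B \<Longrightarrow> v (smul B c x) = smul W c (v x)"
    using v by (auto simp: bounded_ops_def)
  obtain K where vb: "\<And>x. x \<in> carrier B \<Longrightarrow> qnorm W (v x) \<le> K * qnorm B x"
    using v unfolding bounded_ops_def by blast

  define R where "R f l \<longleftrightarrow> l \<in> carrier B \<and> (\<forall>n. f n \<in> carrier V) \<and>
      (\<lambda>n. qnorm B (w (f n) - l)) \<longlonglongrightarrow> 0" for f :: "nat \<Rightarrow> 'a" and l
  have Rc: "l \<in> carrier B" if "R f l" for f l using that by (simp add: R_def)
  have Radd: "R (f + g) (l + m)" if "R f l" "R g m" for f g l m
  proof -
    have c: "\<And>n. w (f n) - l \<in> carrier B" "\<And>n. w (g n) - m \<in> carrier B"
      using that wc B.subspace_diff[OF subB] by (auto simp: R_def)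
    have "(\<lambda>n. qnorm B (w (f n) - l + (w (g n) - m))) \<longlonglongrightarrow> 0"
    proof (rule tendsto_sandwich)
      show "\<forall>\<^sub>F n in sequentially. 0 \<le> qnorm B (w (f n) - l + (w (g n) - m))"
        using n0 B.subspace_add[OF subB c] by auto
      show "\<forall>\<^sub>F n in sequentially. qnorm B (w (f n) - l + (w (g n) - m))
          \<le> qnorm B (w (f n) - l) + qnorm B (w (g n) - m)"
        using tri c by auto
      show "(\<lambda>n. qnorm B (w (f n) - l) + qnorm B (w (g n) - m)) \<longlonglongrightarrow> 0"
        using that tendsto_add[of "\<lambda>n. qnorm B (w (f n) - l)" 0 sequentially
          "\<lambda>n. qnorm B (w (g n) - m)" 0] by (auto simp: R_def)
    qed auto
    moreover have "w (f n) - l + (w (g n) - m) = w ((f + g) n) - (l + m)" for n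
      using that wadd by (simp add: R_def)
    ultimately show ?thesis
      using that V.subspace_add[OF subV] B.subspace_add[OF subB] by (simp add: R_def)
  qed
  have Rs: "R (S c f) (smul B c l)" if "R f l" for f c l
  proof -
    have c: "\<And>n. w (f n) - l \<in> carrier B"
      using that wc B.subspace_diff[OF subB] by (auto simp: R_def)
    have eq: "w (S c f n) - smul B c l = smul B c (w (f n) - l)" for n
      using that ws by (simp add: R_def S_def B.scale_right_diff_distrib)
    have "(\<lambda>n. norm c * qnorm B (w (f n) - l)) \<longlonglongrightarrow> 0"
      using that tendsto_mult_right_zero by (auto simp: R_def)
    then show ?thesis
      using that V.subspace_scale[OF subV] B.subspace_scale[OF subB]
      by (simp add: R_def eq ns[OF c]) (simp add: S_def V.subspace_scale[OF subV])
  qed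
  have R0: "R 0 0"
    using V.subspace_0[OF subV] B.subspace_0[OF subB] ws[of 0 0] nz[of 0] by (simp add: R_def)
  have Runique: "l = m" if "R f l" "R f m" for f l m
  proof -
    have c: "\<And>n. w (f n) - m \<in> carrier B" "\<And>n. l - w (f n) \<in> carrier B"
        "\<And>n. w (f n) \<in> carrier B" "l \<in> carrier B"
      using that wc B.subspace_diff[OF subB] by (auto simp: R_def)
    have "qnorm B (l - m) \<le> 0"
    proof (rule tendsto_lowerbound)
      show "(\<lambda>n. qnorm B (w (f n) - l) + qnorm B (w (f n) - m)) \<longlonglongrightarrow> 0"
        using that tendsto_add[of "\<lambda>n. qnorm B (w (f n) - l)" 0 sequentially
          "\<lambda>n. qnorm B (w (f n) - m)" 0] by (auto simp: R_def)
      show "\<forall>\<^sub>F n in sequentially.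
          qnorm B (l - m) \<le> qnorm B (w (f n) - l) + qnorm B (w (f n) - m)"
      proof (intro always_eventually allI)
        fix n
        have "l - w (f n) + (w (f n) - m) = l - m" by simp
        then show "qnorm B (l - m) \<le> qnorm B (w (f n) - l) + qnorm B (w (f n) - m)"
          using tri[OF c(2)[of n] c(1)[of n]] nd[OF c(4) c(3)[of n]] by simp
      qed
    qed simp
    then show "l = m"
      using n0 nz B.subspace_diff[OF subB Rc[OF that(1)] Rc[OF that(2)]]
      by (metis antisym right_minus_eq)
  qed
  define L where "L f = (THE l. R f l)" for f
  have L: "L f = l" if "R f l" for f l
    unfolding L_def using that Runique by blast

  define B0 where "B0 = {l. \<exists>f. R f l}"
  have B0c: "B0 \<subseteq> carrier B" by (auto simp: B0_def Rc)
  have subB0: "B.subspace B0"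
    unfolding B0_def by (rule B.subspaceI) (use R0 Radd Rs in blast)+
  have wB0: "w x \<in> B0" if "x \<in> carrier V" for x
  proof -
    have "R (\<lambda>_. x) (w x)"
      using that wc B.subspace_0[OF subB] nz[of 0] by (simp add: R_def)
    then show ?thesis by (auto simp: B0_def)
  qed
  obtain E where E: "E \<subseteq> B0" "B.independent E" "B0 \<subseteq> B.span E"
    by (rule B.basis_exists)
  have spanE: "B.span E = B0" using B.span_subspace[OF E(1,3) subB0] .
  define r where "r = BS.construct E (\<lambda>l. SOME f. R f l)"
  interpret r: Vector_Spaces.linear "smul B" S r
    unfolding r_def by (rule BS.linear_construct[OF E(2)])
  have Rr: "R (r l) l" if "l \<in> B0" for l
  proof -
    have "l \<in> B.span E" using that spanE by simp
    then show ?thesis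
    proof (induction rule: B.span_induct_alt)
      case base
      show ?case unfolding r.zero by (rule R0)
    next
      case (step c x y)
      have "R (r x) x"
        using step(1) E(1) someI_ex[of "\<lambda>f. R f x"]
        by (auto simp: r_def BS.construct_basis[OF E(2)] B0_def)
      then show ?case unfolding r.add r.scale by (intro Radd Rs step)
    qed
  qed
  have Lr: "L (r l) = l" if "l \<in> B0" for l using Rr[OF that] by (rule L)

  define B' :: "('k, nat \<Rightarrow> 'a) qspace"
    where "B' = \<lparr>carrier = r ` B0, smul = S, qnorm = (\<lambda>f. qnorm B (L f))\<rparr>"
  have B'[simp]: "carrier B' = r ` B0" "smul B' = S" "qnorm B' f = qnorm B (L f)" for f
    by (auto simp: B'_def)
  note add0 = B.subspace_add[OF subB0] and diff0 = B.subspace_diff[OF subB0]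
    and scale0 = B.subspace_scale[OF subB0]
  have zero0: "0 \<in> B0" using B.subspace_0[OF subB0] .
  have radd: "r x + r y = r (x + y)" and rdiff: "r x - r y = r (x - y)"
    and rscale: "S c (r x) = r (smul B c x)" for x y c
    by (simp_all add: r.add r.diff r.scale)
  have r_eq_0: "r x = 0 \<longleftrightarrow> x = 0" if "x \<in> B0" for x
    using Lr[OF that] Lr[OF zero0] r.zero by metis
  have qB': "quasi_normed B'"
    unfolding quasi_normed_def
  proof (intro conjI)
    show "vector_space (smul B')" using S.vector_space_axioms by simp
    show "module.subspace (smul B') (carrier B')"
      using r.subspace_image[OF subB0] by simp
    show "\<forall>x\<in>carrier B'. 0 \<le> qnorm B' x" using Lr n0 B0c by auto
    show "\<forall>x\<in>carrier B'. (qnorm B' x = 0) = (x = 0)"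
      using Lr nz B0c r_eq_0 by auto
    show "\<forall>c. \<forall>x\<in>carrier B'. qnorm B' (smul B' c x) = norm c * qnorm B' x"
      using Lr ns B0c scale0 by (auto simp: rscale)
    show "\<exists>K. \<forall>x\<in>carrier B'. \<forall>y\<in>carrier B'. qnorm B' (x + y) \<le> K * (qnorm B' x + qnorm B' y)"
      using Lr tri B0c add0 by (intro exI[of _ 1]) (auto simp: radd subset_iff)
  qed
  have cB': "complete_qspace B'"
    unfolding complete_qspace_def
  proof (intro allI impI)
    fix s :: "nat \<Rightarrow> nat \<Rightarrow> 'a"
    assume s: "\<forall>n. s n \<in> carrier B'"
      and cau: "\<forall>e>0. \<exists>N. \<forall>m\<ge>N. \<forall>n\<ge>N. qnorm B' (s m - s n) < e"
    from s have "\<forall>n. \<exists>b. b \<in> B0 \<and> s n = r b" by auto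
    then obtain b where b: "\<And>n. b n \<in> B0" "\<And>n. s n = r (b n)" by metis
    have "\<forall>e>0. \<exists>N. \<forall>m\<ge>N. \<forall>n\<ge>N. qnorm B (b m - b n) < e"
      using cau b Lr diff0 by (simp add: rdiff)
    moreover have "\<forall>n. b n \<in> carrier B" using b B0c by auto
    ultimately obtain l where l: "l \<in> carrier B" "(\<lambda>n. qnorm B (b n - l)) \<longlonglongrightarrow> 0"
      using cB unfolding complete_qspace_def by blast
    have "\<exists>x. x \<in> carrier V \<and> qnorm B (w x - b n) < inverse (Suc n)" for n
    proof -
      have R: "R (r (b n)) (b n)" using b Rr by blast
      then have "\<forall>\<^sub>F k in sequentially. qnorm B (w (r (b n) k) - b n) < inverse (Suc n)"
        by (intro order_tendstoD(2)[of _ 0]) (auto simp: R_def)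
      then obtain k where "qnorm B (w (r (b n) k) - b n) < inverse (Suc n)"
        by (auto simp: eventually_sequentially)
      then show ?thesis using R by (auto simp: R_def)
    qed
    then obtain x where x: "\<And>n. x n \<in> carrier V"
        "\<And>n. qnorm B (w (x n) - b n) < inverse (Suc n)" by metis
    have "R x l"
    proof -
      have c: "\<And>n. w (x n) - b n \<in> carrier B" "\<And>n. b n - l \<in> carrier B"
          "\<And>n. w (x n) - l \<in> carrier B"
        using x(1) wc b(1) B0c l(1) B.subspace_diff[OF subB] by (meson subsetD)+
      have "(\<lambda>n. qnorm B (w (x n) - l)) \<longlonglongrightarrow> 0"
      proof (rule tendsto_sandwich)
        show "\<forall>\<^sub>F n in sequentially. 0 \<le> qnorm B (w (x n) - l)" using n0 c by auto
        show "\<forall>\<^sub>F n in sequentially. qnorm B (w (x n) - l)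
            \<le> inverse (Suc n) + qnorm B (b n - l)"
        proof (intro always_eventually allI)
          fix n
          have "w (x n) - b n + (b n - l) = w (x n) - l" by simp
          then show "qnorm B (w (x n) - l) \<le> inverse (Suc n) + qnorm B (b n - l)"
            using tri[OF c(1)[of n] c(2)[of n]] x(2)[of n] by simp
        qed
        show "(\<lambda>n. inverse (Suc n) + qnorm B (b n - l)) \<longlonglongrightarrow> 0"
          using tendsto_add[OF LIMSEQ_inverse_real_of_nat l(2)] by simp
      qed auto
      then show ?thesis using x l by (simp add: R_def)
    qed
    then have l0: "l \<in> B0" by (auto simp: B0_def)
    show "\<exists>l\<in>carrier B'. (\<lambda>n. qnorm B' (s n - l)) \<longlonglongrightarrow> 0"
      using l l0 b Lr diff0 by (intro bexI[of _ "r l"]) (auto simp: rdiff)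
  qed
  have B'ban: "banach_space B'"
    unfolding banach_space_def quasi_banach_def
    using qB' cB' Lr tri B0c add0 by (auto simp: radd subset_iff)

  define w' where "w' = r \<circ> w"
  define v' where "v' f = (if f \<in> r ` B0 then v (L f) else 0)" for f
  have w': "w' \<in> bounded_ops V B'"
    using w0 wB0 wadd ws wb Lr by (auto simp: bounded_ops_def w'_def r.zero r.add r.scale)
  have v': "v' \<in> bounded_ops B' W"
    unfolding bounded_ops_def
    using vc vadd vs vb B0c Lr add0 scale0
    by (auto simp: v'_def radd rscale subset_iff intro!: exI[of _ K])
  have eq: "v \<circ> w = v' \<circ> w'"
  proof
    fix x
    have "w x \<in> B0" using w0 wB0 zero0 by (cases "x \<in> carrier V") auto
    then show "(v \<circ> w) x = (v' \<circ> w') x" by (simp add: v'_def w'_def Lr)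
  qed
  have opw: "opnorm V B' w' = opnorm V B w"
    unfolding opnorm_def by (intro SUP_cong) (auto simp: w'_def Lr wB0)
  have opv: "opnorm B' W v' \<le> opnorm B W v"
    unfolding opnorm_def
  proof (rule cSUP_mono)
    show "{x \<in> carrier B'. qnorm B' x \<le> 1} \<noteq> {}"
      using zero0 Lr[OF zero0] nz[of 0] B.subspace_0[OF subB] by (auto intro!: exI[of _ 0] bexI[of _ 0] image_eqI[of _ _ 0] simp: r.zero)
    show "bdd_above ((\<lambda>x. qnorm W (v x)) ` {x \<in> carrier B. qnorm B x \<le> 1})"
    proof (rule bdd_aboveI2)
      fix x assume "x \<in> {x \<in> carrier B. qnorm B x \<le> 1}"
      then have x: "x \<in> carrier B" "qnorm B x \<le> 1" by auto
      have "K * qnorm B x \<le> \<bar>K\<bar> * qnorm B x"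
        using n0[OF x(1)] by (intro mult_right_mono) auto
      also have "\<dots> \<le> \<bar>K\<bar> * 1" using x by (intro mult_left_mono) auto
      finally show "qnorm W (v x) \<le> \<bar>K\<bar>" using vb[OF x(1)] by simp
    qed
    fix f assume "f \<in> {x \<in> carrier B'. qnorm B' x \<le> 1}"
    then show "\<exists>m\<in>{x \<in> carrier B. qnorm B x \<le> 1}. qnorm W (v' f) \<le> qnorm W (v m)"
      using B0c Lr by (auto simp: v'_def)
  qed
  have opw0: "0 \<le> opnorm V B w"
    unfolding opnorm_def
  proof (rule cSUP_upper2[of _ _ 0])
    have V0: "0 \<le> qnorm V x" "qnorm V 0 = 0" if "x \<in> carrier V" for x
      using V that V.subspace_0[OF subV] by (auto simp: quasi_normed_def)
    show "0 \<in> {x \<in> carrier V. qnorm V x \<le> 1}" using V0 V.subspace_0[OF subV] by auto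
    show "0 \<le> qnorm B (w 0)" using n0 wc V.subspace_0[OF subV] by auto
    obtain K where K: "\<And>x. x \<in> carrier V \<Longrightarrow> qnorm B (w x) \<le> K * qnorm V x" using wb by blast
    show "bdd_above ((\<lambda>x. qnorm B (w x)) ` {x \<in> carrier V. qnorm V x \<le> 1})"
    proof (rule bdd_aboveI2)
      fix x assume "x \<in> {x \<in> carrier V. qnorm V x \<le> 1}"
      then have x: "x \<in> carrier V" "qnorm V x \<le> 1" by auto
      have "K * qnorm V x \<le> \<bar>K\<bar> * qnorm V x"
        using V0[OF x(1)] by (intro mult_right_mono) auto
      also have "\<dots> \<le> \<bar>K\<bar> * 1" using x by (intro mult_left_mono) auto
      finally show "qnorm B (w x) \<le> \<bar>K\<bar>" using K[OF x(1)] by simp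
    qed
  qed
  have "delta V W (v \<circ> w) \<le> ennreal (opnorm B' W v' * opnorm V B' w')"
    unfolding delta_def using B'ban w' v' eq by (intro Inf_lower) blast
  also have "\<dots> \<le> ennreal (opnorm B W v * opnorm V B w)"
    using opv opw0 by (intro ennreal_leI) (simp add: opw mult_right_mono)
  finally show ?thesis .
qed

end

theory Submission
  imports Defs
begin

text \<open>
  Write \<open>p\<close> for the convex gauge of the quasi-norm of \<open>X\<close>, the largest seminorm below it
  (\<open>conv_norm\<close>). The completion of \<open>(X, p)\<close> is a Banach space, and an operator \<open>u\<close> with
  \<open>\<parallel>u x\<parallel> \<le> D * p x\<close> extends to it; so \<open>\<delta>(u)\<close> is at most a constant times the least such \<open>D\<close>
  (\<open>delta_le_conv_bound\<close>), and the claim is that \<open>D \<le> C * \<parallel>u\<parallel>\<close>.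

  The heart of the proof is an a priori estimate (\<open>convex_bound\<close>): as soon as \<^emph>\<open>some\<close> finite \<open>D\<close>
  works for \<open>u\<close>, a multiple \<open>C * \<parallel>u\<parallel>\<close> works, where \<open>C\<close> depends on \<open>X\<close> and \<open>Y\<close> only. Thus the
  operators that have a finite \<open>D\<close> form a linear space, and the uniform estimate makes this
  space closed under bounded pointwise limits. It contains the operators of finite rank, because
  a finite-dimensional quasi-norm has bounded coordinates. Hence it contains all strongly
  approximable operators.

  The a priori estimate is a derandomised sampling argument. A point with \<open>p x < 1\<close> is twice an
  average of \<open>2 ^ n\<close> elements \<open>h k\<close> of the unit ball, with \<open>n\<close> large. Take a Hadamard matrix \<open>H\<close>
  with first row constant and form the signed averages \<open>f j = 2 ^ - n * (\<Sum>k. H j k * h k)\<close>. If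
  \<open>\<parallel>u (f j)\<parallel>\<close> is small for some \<open>j \<ge> 1\<close>, then \<open>u\<close> hardly sees the difference between the average
  of all \<open>h k\<close> and the average over the half with \<open>H j k = -1\<close>, since this difference is exactly
  \<open>f j\<close>. The estimate \<open>\<parallel>u (f j)\<parallel> \<le> A * \<rho> ^ n * D\<close> with \<open>\<rho> < 1\<close> (\<open>signed_average_small\<close>) permits
  repeated halving down to \<open>2 ^ m\<close> elements at the price of a geometric series, that is, of at
  most \<open>D / 2\<close> when \<open>m\<close> is a suitable constant. The image of an average of \<open>2 ^ m\<close> elements of
  the unit ball is at most a constant times \<open>\<parallel>u\<parallel>\<close>. So \<open>D\<close> improves to \<open>B * \<parallel>u\<parallel> + D / 2\<close>, and the
  least \<open>D\<close> is at most \<open>2 * B * \<parallel>u\<parallel>\<close>.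

  That some \<open>f j\<close> is small uses both hypotheses. For functions \<open>h k\<close> bounded by 1, Parseval's
  identity gives \<open>(\<Sum>j. (f j)\<^sup>2) \<le> 1\<close> pointwise. Cutting \<open>f j\<close> off below the height \<open>d\<close> leaves
  functions \<open>b j\<close> with \<open>\<bar>f j - b j\<bar> \<le> d\<close> and \<open>(\<Sum>j. \<bar>b j\<bar>) \<le> 1 / d\<close>. Then
  \<open>\<parallel>u (f j - b j)\<parallel> \<le> D * d\<close>, and cotype \<open>q\<close> applied to the vectors \<open>u (b j)\<close> shows that one of
  them is at most \<open>C * D / d * 2 ^ (- n / q)\<close>, up to a constant; now choose
  \<open>d = 2 ^ (- n / (2 * q))\<close>. The points of \<open>X\<close> are not functions, but the existence of such
  \<open>b j\<close> follows, by the Hahn-Banach theorem, from an inequality between functionals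
  (\<open>signed_averages_split\<close>), and in an L1-space this inequality follows by integrating a
  pointwise one (\<open>L1_Hadamard_inequality\<close>).
\<close>

section \<open>Quasi-seminorms and the Hahn-Banach theorem\<close>

text \<open>
  The analysis is carried out for quasi-seminorms on whole types; a space with a carrier is
  brought into this form by a linear projection onto the carrier, whose kernel accounts for the
  missing definiteness.
\<close>

locale quasi_seminorm = vector_space sc
  for sc :: "'k::{real_normed_field,euclidean_space} \<Rightarrow> 'v::ab_group_add \<Rightarrow> 'v" +
  fixes N :: "'v \<Rightarrow> real" and K :: real
  assumes K_ge_1: "1 \<le> K"
    and scaled: "N (sc c x) = norm c * N x"
    and quasi_triangle: "N (x + y) \<le> K * (N x + N y)"
begin

lemma zero [simp]: "N 0 = 0"
  using scaled[of 0 0] by simp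

lemma minus [simp]: "N (- x) = N x"
  using scaled[of "-1" x] by simp

lemma nonneg [simp]: "0 \<le> N x"
proof -
  have "0 \<le> K * (N x + N x)"
    using quasi_triangle[of x "- x"] by simp
  then show ?thesis
    using K_ge_1 by (simp add: zero_le_mult_iff)
qed

lemma diff_triangle: "N (x - y) \<le> K * (N x + N y)"
  using quasi_triangle[of x "- y"] by simp

lemma sum_le:
  assumes "finite I"
  shows "N (\<Sum>i\<in>I. x i) \<le> K ^ card I * (\<Sum>i\<in>I. N (x i))"
  using assms
proof (induction rule: finite_induct)
  case (insert i I)
  have "N (\<Sum>i\<in>insert i I. x i) \<le> K * (N (x i) + N (\<Sum>i\<in>I. x i))"
    using insert quasi_triangle by simp
  also have "\<dots> \<le> K * (K ^ card I * N (x i) + K ^ card I * (\<Sum>i\<in>I. N (x i)))"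
  proof (intro mult_left_mono add_mono insert.IH)
    have "1 * N (x i) \<le> K ^ card I * N (x i)"
      using K_ge_1 by (intro mult_right_mono) auto
    then show "N (x i) \<le> K ^ card I * N (x i)" by simp
  qed (use K_ge_1 in auto)
  also have "\<dots> = K ^ card (insert i I) * (\<Sum>i\<in>insert i I. N (x i))"
    using insert by (simp add: algebra_simps)
  finally show ?case .
qed simp

end

locale seminorm = quasi_seminorm sc N 1
  for sc :: "'k::{real_normed_field,euclidean_space} \<Rightarrow> 'v::ab_group_add \<Rightarrow> 'v" and N
begin

lemma triangle: "N (x + y) \<le> N x + N y"
  using quasi_triangle[of x y] by simp

end

definition linear_form :: "('k::field \<Rightarrow> 'v::ab_group_add \<Rightarrow> 'v) \<Rightarrow> ('v \<Rightarrow> 'k) \<Rightarrow> bool" where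
  "linear_form sc f \<longleftrightarrow> (\<forall>x y. f (x + y) = f x + f y) \<and> (\<forall>c x. f (sc c x) = c * f x)"

lemma linear_form_sum:
  assumes "linear_form sc f"
  shows "f (\<Sum>i\<in>I. x i) = (\<Sum>i\<in>I. f (x i))"
proof -
  have "f 0 + f 0 = f 0"
    using assms unfolding linear_form_def by (metis add_0_right)
  then have "f 0 = 0" by (metis add_cancel_right_right)
  then show ?thesis
    using assms by (induction I rule: infinite_finite_induct) (auto simp: linear_form_def)
qed

context vector_space
begin

lemma linear_form_diff:
  assumes "linear_form scale f"
  shows "f (x - y) = f x - f y"
  using assms unfolding linear_form_def by (metis add_diff_cancel diff_add_cancel)

lemma linear_form_0: "linear_form scale f \<Longrightarrow> f 0 = 0"
  using linear_form_diff[of f 0 0] by simp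

end

definition sublinear :: "(real \<Rightarrow> 'v::ab_group_add \<Rightarrow> 'v) \<Rightarrow> ('v \<Rightarrow> real) \<Rightarrow> bool" where
  "sublinear s q \<longleftrightarrow> (\<forall>x y. q (x + y) \<le> q x + q y) \<and> (\<forall>t\<ge>0. \<forall>x. q (s t x) = t * q x)"

lemma sublinear_0:
  assumes "sublinear s q" shows "q (s 0 x) = 0"
  using assms by (auto simp: sublinear_def)

lemma sublinear_lower:
  assumes "vector_space s" "sublinear s q"
  shows "- q (- x) \<le> q x"
proof -
  interpret vector_space s by fact
  have "q 0 = 0" using sublinear_0[OF assms(2), of 0] by simp
  moreover have "q (x + - x) \<le> q x + q (- x)"
    using assms(2) unfolding sublinear_def by blast
  ultimately show ?thesis by simp
qed

text \<open>
  The functional \<open>r x = inf {q (x + t * y) - t * q y | t \<ge> 0}\<close> is the step of the Hahn-Banach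
  theorem: it is sublinear, lies below \<open>q\<close>, and is forced to be additive on the line through
  \<open>y\<close>.
\<close>

lemma sublinear_tilt:
  assumes s: "vector_space s" and q: "sublinear s q"
  obtains r where "sublinear s r" "\<And>x. r x \<le> q x" "r (- y) \<le> - q y"
proof -
  interpret vector_space s by fact
  have qadd: "q (x + z) \<le> q x + q z" and qs: "t \<ge> 0 \<Longrightarrow> q (s t x) = t * q x" for x z t
    using q by (auto simp: sublinear_def)
  have q0: "q 0 = 0" using qs[of 0 0] by simp
  define g where "g x t = q (x + s t y) - t * q y" for x t
  define r where "r x = (INF t\<in>{0..}. g x t)" for x
  have glow: "- q (- x) \<le> g x t" if "t \<ge> 0" for x t
  proof -
    have "t * q y = q (x + s t y + (- x))" using qs[OF that] by simp
    also have "\<dots> \<le> q (x + s t y) + q (- x)" by (rule qadd)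
    finally show ?thesis by (simp add: g_def)
  qed
  have bdd: "bdd_below (g x ` {0..})" for x
    by (rule bdd_belowI2[of _ "- q (- x)"]) (use glow in auto)
  have rle: "r x \<le> g x t" if "t \<ge> 0" for x t
    unfolding r_def by (rule cINF_lower[OF bdd]) (use that in auto)
  have rge: "m \<le> r x" if "\<And>t. t \<ge> 0 \<Longrightarrow> m \<le> g x t" for m x
    unfolding r_def by (rule cINF_greatest) (use that in auto)
  have add: "r (x + z) \<le> r x + r z" for x z
  proof -
    have *: "r (x + z) \<le> g x t + g z t'" if "t \<ge> 0" "t' \<ge> 0" for t t'
    proof -
      have "r (x + z) \<le> g (x + z) (t + t')" using that by (intro rle) auto
      also have "\<dots> \<le> g x t + g z t'"
        using qadd[of "x + s t y" "z + s t' y"]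
        by (simp add: g_def scale_left_distrib algebra_simps)
      finally show ?thesis .
    qed
    have "r (x + z) - g x t \<le> r z" if "t \<ge> 0" for t
      by (rule rge) (use *[OF that] in \<open>simp add: algebra_simps\<close>)
    then have "r (x + z) - r z \<le> r x"
      by (intro rge) (simp add: algebra_simps)
    then show ?thesis by simp
  qed
  have scale_le: "r (s a x) \<le> a * r x" if "a > 0" for a x
  proof -
    have "r (s a x) / a \<le> r x"
    proof (rule rge)
      fix t :: real assume t: "t \<ge> 0"
      have "r (s a x) \<le> g (s a x) (a * t)" using that t by (intro rle) auto
      also have "\<dots> = a * g x t"
        using qs[of a "x + s t y"] that
        by (simp add: g_def scale_right_distrib algebra_simps)
      finally show "r (s a x) / a \<le> g x t" using that by (simp add: field_simps)
    qed
    then show ?thesis using that by (simp add: field_simps)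
  qed
  have r0: "r 0 = 0"
  proof (rule antisym)
    show "r 0 \<le> 0" using rle[of 0 0] q0 by (simp add: g_def)
    show "0 \<le> r 0" by (rule rge) (use glow[of _ 0] q0 in auto)
  qed
  have scale: "r (s a x) = a * r x" if "a \<ge> 0" for a x
  proof (cases "a = 0")
    case True then show ?thesis using r0 by simp
  next
    case False
    then have a: "a > 0" using that by simp
    have "r (s (inverse a) (s a x)) \<le> inverse a * r (s a x)" using a by (intro scale_le) simp
    then have "a * r x \<le> r (s a x)" using a by (simp add: field_simps)
    then show ?thesis using scale_le[OF a, of x] by simp
  qed
  show ?thesis
  proof
    show "sublinear s r" using add scale by (auto simp: sublinear_def)
    show "r x \<le> q x" for x using rle[of 0 x] by (simp add: g_def)
    show "r (- y) \<le> - q y" using rle[of 1 "- y"] q0 by (simp add: g_def)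
  qed
qed

text \<open>
  Zorn's lemma for the pointwise order. The infimum over a chain is subadditive because any two
  members of the chain lie above the smaller of them, and it is finite because \<open>- p (- x)\<close> is a
  common lower bound.
\<close>

lemma minimal_sublinear_below:
  assumes s: "vector_space s" and p: "sublinear s p"
  obtains q where "sublinear s q" "\<And>x. q x \<le> p x"
    "\<And>r. sublinear s r \<Longrightarrow> (\<And>x. r x \<le> q x) \<Longrightarrow> r = q"
proof -
  interpret vector_space s by fact
  define A where "A = {q. sublinear s q \<and> q \<le> p}"
  define P where "P q r \<longleftrightarrow> r \<le> q" for q r :: "'a \<Rightarrow> real"
  have po: "partial_order_on A (relation_of P A)"
    unfolding partial_order_on_def preorder_on_def
    by (auto simp: relation_of_def P_def refl_on_def trans_on_def trans_def antisym_def)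
  have "\<exists>u\<in>A. \<forall>a\<in>C. P a u" if "C \<in> Chains (relation_of P A)" for C
  proof (cases "C = {}")
    case True
    then show ?thesis using p by (auto simp: A_def)
  next
    case False
    have CA: "C \<subseteq> A" and tot: "\<And>q r. q \<in> C \<Longrightarrow> r \<in> C \<Longrightarrow> q \<le> r \<or> r \<le> q"
      using that by (auto simp: Chains_def relation_of_def P_def)
    have sub: "q (x + y) \<le> q x + q y" "t \<ge> 0 \<Longrightarrow> q (s t x) = t * q x" "q x \<le> p x"
      if "q \<in> C" for q x y t
      using that CA by (auto simp: A_def sublinear_def le_fun_def)
    define u where "u x = (INF q\<in>C. q x)" for x
    have low: "- p (- x) \<le> q x" if "q \<in> C" for q x
      using sublinear_lower[OF s, of q x] that CA sub(3)[OF that, of "- x"] by (auto simp: A_def)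
    have bdd: "bdd_below ((\<lambda>q. q x) ` C)" for x
      by (rule bdd_belowI2[of _ "- p (- x)"]) (use low in auto)
    have ule: "u x \<le> q x" if "q \<in> C" for q x
      unfolding u_def by (rule cINF_lower[OF bdd that])
    have uge: "m \<le> u x" if "\<And>q. q \<in> C \<Longrightarrow> m \<le> q x" for m x
      unfolding u_def by (rule cINF_greatest[OF False]) (use that in auto)
    have add: "u (x + y) \<le> u x + u y" for x y
    proof -
      have *: "u (x + y) \<le> q x + r y" if qr: "q \<in> C" "r \<in> C" for q r
      proof -
        obtain m where "m \<in> C" "m \<le> q" "m \<le> r" using tot[OF qr] qr by blast
        then show ?thesis
          using ule[of m "x + y"] sub(1)[of m x y] by (fastforce simp: le_fun_def dest: spec[of _ x] spec[of _ y])
      qed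
      have "u (x + y) - q x \<le> u y" if "q \<in> C" for q
        by (rule uge) (use *[OF that] in \<open>simp add: algebra_simps\<close>)
      then have "u (x + y) - u y \<le> u x"
        by (intro uge) (simp add: algebra_simps)
      then show ?thesis by simp
    qed
    have scl: "u (s t x) = t * u x" if "t \<ge> 0" for t x
    proof (cases "t = 0")
      case True
      obtain q where "q \<in> C" using False by blast
      have "(INF q\<in>C. q (s t x)) = (INF q\<in>C. 0)"
        by (rule INF_cong) (use sub(2)[OF _ that] True in auto)
      then show ?thesis using True False by (simp add: u_def)
    next
      case False
      then have t: "t > 0" using that by simp
      show ?thesis
      proof (rule antisym)
        have "u (s t x) / t \<le> u x"
          by (rule uge) (use ule[of _ "s t x"] sub(2) t in \<open>fastforce simp: field_simps\<close>)
        then show "u (s t x) \<le> t * u x" using t by (simp add: field_simps)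
        show "t * u x \<le> u (s t x)"
          by (rule uge) (simp add: sub(2)[OF _ that] ule that mult_left_mono)
      qed
    qed
    have "u \<in> A"
      using add scl False ule sub(3) by (fastforce simp: A_def sublinear_def le_fun_def intro: order_trans)
    then show ?thesis using ule by (auto simp: P_def le_fun_def)
  qed
  from predicate_Zorn[OF po this]
  obtain q where q: "q \<in> A" "\<And>r. r \<in> A \<Longrightarrow> P q r \<Longrightarrow> r = q" by blast
  show ?thesis
  proof
    show "sublinear s q" "q x \<le> p x" for x using q(1) by (auto simp: A_def le_fun_def)
    show "r = q" if "sublinear s r" "\<And>x. r x \<le> q x" for r
    proof (rule q(2))
      have "r x \<le> p x" for x using that(2) q(1) by (auto simp: A_def le_fun_def intro: order_trans)
      then show "r \<in> A" using that(1) by (auto simp: A_def le_fun_def)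
      show "P q r" using that(2) by (auto simp: P_def le_fun_def)
    qed
  qed
qed

text \<open>
  A minimal sublinear functional is linear, for otherwise it could be tilted further down.
  Tilting once along \<open>w\<close> before minimising makes the linear functional attain the value of \<open>p\<close>
  at \<open>w\<close>.
\<close>

theorem real_Hahn_Banach:
  assumes s: "vector_space s" and p: "sublinear s p"
  obtains f where "linear_form s f" "\<And>x. f x \<le> p x" "f w = p w"
proof -
  interpret vector_space s by fact
  obtain p' where p': "sublinear s p'" "\<And>x. p' x \<le> p x" "p' (- w) \<le> - p w"
    using sublinear_tilt[OF s p] by blast
  obtain f where f: "sublinear s f" "\<And>x. f x \<le> p' x"
    and min: "\<And>r. sublinear s r \<Longrightarrow> (\<And>x. r x \<le> f x) \<Longrightarrow> r = f"
    using minimal_sublinear_below[OF s p'(1)] by metis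
  have neg: "f (- y) = - f y" for y
  proof -
    obtain r where r: "sublinear s r" "\<And>x. r x \<le> f x" "r (- y) \<le> - f y"
      using sublinear_tilt[OF s f(1)] by blast
    have "r = f" using min r by blast
    then show ?thesis using r(3) sublinear_lower[OF s f(1), of y] by simp
  qed
  have fadd: "f (x + y) \<le> f x + f y" and fs: "t \<ge> 0 \<Longrightarrow> f (s t x) = t * f x" for x y t
    using f(1) by (auto simp: sublinear_def)
  have add: "f (x + y) = f x + f y" for x y
    using fadd[of x y] fadd[of "- x" "- y"] neg[of x] neg[of y] neg[of "x + y"] by simp
  have scl: "f (s t x) = t * f x" for t x
  proof (cases "t \<ge> 0")
    case False
    then show ?thesis using fs[of "- t" x] neg[of "s t x"] by simp
  qed (use fs in auto)
  show ?thesis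
  proof
    show "linear_form s f" using add scl by (simp add: linear_form_def)
    show "f x \<le> p x" for x using f(2) p'(2) order_trans by blast
    have "f (- w) \<le> - p w" using f(2) p'(3) order_trans by blast
    then show "f w = p w" using neg[of w] f(2)[of w] p'(2)[of w] by simp
  qed
qed

text \<open>
  The norm is multiplicative, so multiplication by \<open>z\<close> is a similarity and multiplies inner
  products by \<open>(norm z)\<^sup>2\<close>. This replaces complex conjugation in the abstract scalar field.
\<close>

lemma inner_mult_right:
  fixes x y z :: "'k::{real_normed_field,euclidean_space}"
  shows "inner (x * z) (y * z) = (norm z)\<^sup>2 * inner x y"
proof -
  have "(norm (x * z + y * z))\<^sup>2 = (norm z)\<^sup>2 * (norm (x + y))\<^sup>2"
    by (simp add: distrib_right[symmetric] norm_mult power_mult_distrib)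
  then show ?thesis
    by (simp add: dot_norm norm_mult power_mult_distrib field_simps)
qed

context seminorm
begin

text \<open>
  A real functional \<open>g\<close> is the real part of exactly one form \<open>f\<close> over the scalar field, the real
  part of a scalar \<open>c\<close> being \<open>inner c 1\<close>. The equation \<open>inner (c * f x) 1 = g (sc c x)\<close> for all
  \<open>c\<close> determines \<open>f x\<close>; if \<open>\<rho> x\<close> represents the functional \<open>c \<mapsto> g (sc c x)\<close>, then \<open>f x\<close> is the
  conjugate \<open>(norm (\<rho> x))\<^sup>2 / \<rho> x\<close> of \<open>\<rho> x\<close>.
\<close>

theorem Hahn_Banach:
  obtains f where "linear_form sc f" "\<And>x. norm (f x) \<le> N x" "norm (f w) = N w"
proof -
  define s where "s t x = sc (of_real t) x" for t x
  have s: "vector_space s"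
    by unfold_locales (auto simp: s_def scale_right_distrib scale_left_distrib)
  have "sublinear s N"
    using triangle scaled by (auto simp: sublinear_def s_def)
  then obtain g where g: "linear_form s g" "\<And>x. g x \<le> N x" "g w = N w"
    using real_Hahn_Banach[OF s] by metis
  have gadd: "g (x + y) = g x + g y" and gs: "g (sc (of_real t) x) = t * g x" for x y t
    using g(1) by (auto simp: linear_form_def s_def)
  have gs': "g (sc (of_real t * c) x) = t * g (sc c x)" for t c x
    using gs[of t "sc c x"] by simp
  define \<rho> where "\<rho> x = (\<Sum>b\<in>Basis. g (sc b x) *\<^sub>R b)" for x
  have \<rho>: "inner c (\<rho> x) = g (sc c x)" for c x
  proof -
    have "g (sc c x) = g (\<Sum>b\<in>Basis. sc (of_real (inner c b)) (sc b x))"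
      using euclidean_representation[of c] by (simp add: scale_sum_left[symmetric] scaleR_conv_of_real)
    also have "\<dots> = (\<Sum>b\<in>Basis. inner c b * g (sc b x))"
      by (simp add: linear_form_sum[OF g(1)] gs')
    finally show ?thesis by (simp add: \<rho>_def inner_sum_right mult.commute)
  qed
  define f where "f x = of_real ((norm (\<rho> x))\<^sup>2) * inverse (\<rho> x)" for x
  have f: "inner (c * f x) 1 = g (sc c x)" for c x
  proof (cases "\<rho> x = 0")
    case True then show ?thesis using \<rho>[of c x] by (simp add: f_def)
  next
    case False
    have "inner (c * f x) 1 = inner (c * of_real ((norm (\<rho> x))\<^sup>2) * inverse (\<rho> x)) (\<rho> x * inverse (\<rho> x))"
      using False by (simp add: f_def mult.assoc)
    also have "\<dots> = inner c (\<rho> x)"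
      using False unfolding inner_mult_right
      by (simp add: of_real_def norm_inverse power_inverse)
    finally show ?thesis using \<rho> by simp
  qed
  have unique: "a = b" if "\<And>c. inner (c * a) 1 = inner (c * b) 1" for a b :: 'k
  proof (rule ccontr)
    assume "a \<noteq> b"
    then have "inner (inverse (a - b) * (a - b)) 1 = inner 1 (1::'k)" by simp
    then show False
      using that[of "inverse (a - b)"]
      by (simp add: right_diff_distrib inner_diff_left)
  qed
  show ?thesis
  proof
    show "linear_form sc f"
      unfolding linear_form_def
    proof (intro conjI allI)
      show "f (x + y) = f x + f y" for x y
        by (rule unique) (simp add: f distrib_left inner_add_left gadd scale_right_distrib)
      show "f (sc c x) = c * f x" for c x
        by (rule unique) (simp add: f mult.assoc[symmetric])
    qed
    show le: "norm (f x) \<le> N x" for x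
    proof (cases "f x = 0")
      case False
      define c where "c = of_real (norm (f x)) * inverse (f x)"
      have nc: "norm c = 1" using False by (simp add: c_def norm_mult norm_inverse)
      have "inner (c * f x) 1 = norm (f x)"
        using False by (simp add: c_def of_real_def dot_square_norm)
      then have "norm (f x) = g (sc c x)" using f by simp
      also have "\<dots> \<le> N x" using g(2)[of "sc c x"] nc by (simp add: scaled)
      finally show ?thesis .
    qed simp
    have "N w = inner (1 * f w) 1" using f[of 1 w] g(3) by simp
    also have "\<dots> \<le> norm (f w)" using norm_cauchy_schwarz[of "f w" 1] by simp
    finally show "norm (f w) = N w" using le[of w] by simp
  qed
qed

end

section \<open>The convex gauge of a quasi-seminorm\<close>

text \<open>
  The gauge of the convex hull of the unit ball, hence the norm of the Banach envelope.
\<close>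

definition conv_norm :: "('v::ab_group_add \<Rightarrow> real) \<Rightarrow> 'v \<Rightarrow> real" where
  "conv_norm N x = Inf {sum_list (map N xs) | xs. sum_list xs = x}"

definition dyadic_averages ::
    "('k::field \<Rightarrow> 'v::ab_group_add \<Rightarrow> 'v) \<Rightarrow> ('v \<Rightarrow> real) \<Rightarrow> nat \<Rightarrow> 'v set" where
  "dyadic_averages sc N n = {sc (1 / 2 ^ n) (\<Sum>k<2^n. h k) | h :: nat \<Rightarrow> 'v. \<forall>k. N (h k) \<le> 1}"

context quasi_seminorm
begin

lemma conv_norm_le_sum_list:
  assumes "sum_list xs = x" shows "conv_norm N x \<le> sum_list (map N xs)"
  unfolding conv_norm_def
proof (rule cInf_lower)
  show "bdd_below {sum_list (map N xs) |xs. sum_list xs = x}"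
    by (rule bdd_belowI[of _ 0]) (auto intro!: sum_list_nonneg)
qed (use assms in auto)

lemma conv_norm_le: "conv_norm N x \<le> N x"
  using conv_norm_le_sum_list[of "[x]" x] by simp

lemma conv_norm_greatest:
  assumes "\<And>xs. sum_list xs = x \<Longrightarrow> m \<le> sum_list (map N xs)"
  shows "m \<le> conv_norm N x"
  unfolding conv_norm_def
proof (rule cInf_greatest)
  have "sum_list [x] = x" by simp
  then show "{sum_list (map N xs) |xs. sum_list xs = x} \<noteq> {}" by blast
qed (use assms in auto)

lemma conv_norm_nonneg: "0 \<le> conv_norm N x"
  by (rule conv_norm_greatest) (auto intro!: sum_list_nonneg)

text \<open>
  Maximality of the gauge among the subadditive functionals below a multiple of \<open>N\<close>.
\<close>

lemma subadditive_le_conv_norm: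
  fixes q :: "'v \<Rightarrow> real"
  assumes "0 \<le> c" and q: "\<And>x. q x \<le> c * N x" and add: "\<And>x y. q (x + y) \<le> q x + q y"
  shows "q x \<le> c * conv_norm N x"
proof (cases "c = 0")
  case False
  then have c: "c > 0" using assms by simp
  have list: "q (sum_list xs) \<le> c * sum_list (map N xs)" for xs
  proof (induction xs)
    case Nil
    show ?case using q[of 0] by simp
  next
    case (Cons a xs)
    show ?case using add[of a "sum_list xs"] q[of a] Cons by (simp add: algebra_simps)
  qed
  have "q x / c \<le> conv_norm N x"
    by (rule conv_norm_greatest) (use list c in \<open>auto simp: field_simps\<close>)
  then show ?thesis using c by (simp add: field_simps)
qed (use q[of x] in simp)

lemma scale_sum_list: "sc c (sum_list xs) = sum_list (map (sc c) xs)"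
  by (induction xs) (auto simp: scale_right_distrib)

lemma seminorm_conv_norm: "seminorm sc (conv_norm N)"
proof unfold_locales
  show "conv_norm N (x + y) \<le> 1 * (conv_norm N x + conv_norm N y)" for x y
  proof -
    have *: "conv_norm N (x + y) \<le> sum_list (map N xs) + sum_list (map N ys)"
      if "sum_list xs = x" "sum_list ys = y" for xs ys
      using conv_norm_le_sum_list[of "xs @ ys" "x + y"] that by simp
    have "conv_norm N (x + y) - sum_list (map N xs) \<le> conv_norm N y" if "sum_list xs = x" for xs
      by (rule conv_norm_greatest) (use *[OF that] in \<open>simp add: algebra_simps\<close>)
    then have "conv_norm N (x + y) - conv_norm N y \<le> conv_norm N x"
      by (intro conv_norm_greatest) (simp add: algebra_simps)
    then show ?thesis by simp
  qed
  have le: "conv_norm N (sc c x) \<le> norm c * conv_norm N x" for c x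
  proof (cases "c = 0")
    case True
    then show ?thesis using conv_norm_le[of 0] conv_norm_nonneg[of 0] by simp
  next
    case False
    have "conv_norm N (sc c x) / norm c \<le> conv_norm N x"
    proof (rule conv_norm_greatest)
      fix xs assume "sum_list xs = x"
      then have "conv_norm N (sc c x) \<le> sum_list (map N (map (sc c) xs))"
        by (intro conv_norm_le_sum_list) (auto simp: scale_sum_list)
      also have "\<dots> = norm c * sum_list (map N xs)"
        by (simp add: o_def scaled sum_list_const_mult)
      finally show "conv_norm N (sc c x) / norm c \<le> sum_list (map N xs)"
        using False by (simp add: field_simps)
    qed
    then show ?thesis using False by (simp add: field_simps)
  qed
  show "conv_norm N (sc c x) = norm c * conv_norm N x" for c x
  proof (cases "c = 0")
    case True
    then show ?thesis using conv_norm_le[of 0] conv_norm_nonneg[of 0] by simp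
  next
    case False
    have "norm c * conv_norm N (sc (inverse c) (sc c x)) \<le> norm c * (norm (inverse c) * conv_norm N (sc c x))"
      by (intro mult_left_mono le) simp
    also have "\<dots> = (norm c * norm (inverse c)) * conv_norm N (sc c x)" by simp
    also have "norm c * norm (inverse c) = 1"
      using False by (simp add: norm_inverse)
    finally have "norm c * conv_norm N x \<le> conv_norm N (sc c x)"
      using False by simp
    then show ?thesis using le[of c x] by (rule antisym[rotated])
  qed
qed simp

text \<open>
  Splitting the summands of a decomposition into equal pieces and padding with zeros turns a
  convex combination into an average of a power of two many elements. Rounding the number of
  pieces costs the factor 2.
\<close>

lemma exists_dyadic_average:
  assumes x: "conv_norm N x < 1"
  obtains n z where "n \<ge> m" "z \<in> dyadic_averages sc N n" "x = sc 2 z"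
proof -
  have "\<exists>xs. sum_list xs = x \<and> sum_list (map N xs) < 1"
    using conv_norm_greatest[of x 1] x by (meson leI not_le)
  then obtain xs where xs: "sum_list xs = x" "sum_list (map N xs) < 1" by blast
  define l where "l = length xs + m"
  have "length xs \<le> l" by (simp add: l_def)
  then have "length xs \<le> 2 ^ l"
    using less_exp[of l] by linarith
  then have l: "real (length xs) \<le> 2 ^ l"
    by (metis of_nat_le_iff of_nat_numeral of_nat_power)
  \<comment> \<open>Each entry \<open>z\<close> is split into \<open>r z\<close> equal pieces, each of them at most \<open>1 / 2 ^ l\<close>.\<close>
  define r where "r z = nat \<lfloor>2 ^ l * N z\<rfloor> + 1" for z
  have r: "2 ^ l * N z \<le> r z" "r z \<le> 2 ^ l * N z + 1" "r z > 0" for z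
  proof -
    have "0 \<le> 2 ^ l * N z" by simp
    then have "real (r z) = of_int \<lfloor>2 ^ l * N z\<rfloor> + 1"
      by (simp add: r_def)
    then show "2 ^ l * N z \<le> r z" "r z \<le> 2 ^ l * N z + 1" by linarith+
  qed (simp add: r_def)
  define g where "g z = replicate (r z) (sc (2 ^ l / of_nat (r z)) z)" for z
  define ys where "ys = concat (map g xs)"
  have rep: "sum_list (replicate i z) = sc (of_nat i) z" for i z
    by (induction i) (auto simp: scale_left_distrib)
  have "sum_list (g z) = sc (2 ^ l) z" for z
    using r(3)[of z] by (simp add: g_def rep)
  then have ys_sum: "sum_list ys = sc (2 ^ l) x"
    unfolding ys_def xs(1)[symmetric] by (induction xs) (auto simp: scale_right_distrib)
  have "real (length ys) = sum_list (map (\<lambda>z. real (r z)) xs)"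
    unfolding ys_def by (induction xs) (auto simp: g_def)
  also have "\<dots> \<le> sum_list (map (\<lambda>z. 2 ^ l * N z + 1) xs)"
    using r(2) by (intro sum_list_mono) auto
  also have "\<dots> = 2 ^ l * sum_list (map N xs) + length xs"
    by (induction xs) (auto simp: algebra_simps)
  also have "\<dots> \<le> 2 ^ l * 1 + 2 ^ l"
    using xs(2) l by (intro add_mono mult_left_mono) auto
  finally have "real (length ys) \<le> real (2 ^ Suc l)" by simp
  then have len: "length ys \<le> 2 ^ Suc l" by (simp only: of_nat_le_iff)
  define h where "h k = (if k < length ys then ys ! k else 0)" for k
  have hN: "N (h k) \<le> 1" for k
  proof (cases "k < length ys")
    case True
    then have "ys ! k \<in> set ys" by simp
    then obtain z where z: "ys ! k = sc (2 ^ l / of_nat (r z)) z"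
      by (auto simp: ys_def g_def split: if_splits)
    have "N (ys ! k) = 2 ^ l * N z / r z"
      by (simp add: z scaled norm_divide norm_power)
    also have "\<dots> \<le> 1" using r(1,3)[of z] by (simp add: divide_le_eq)
    finally show ?thesis using True by (simp add: h_def)
  qed (simp add: h_def)
  have "(\<Sum>k<2^Suc l. h k) = (\<Sum>k<length ys. h k)"
    using len by (intro sum.mono_neutral_right) (auto simp: h_def)
  also have "\<dots> = sum_list ys"
    by (simp add: sum_list_sum_nth h_def atLeast0LessThan)
  finally have sum: "(\<Sum>k<2^Suc l. h k) = sc (2 ^ l) x" using ys_sum by simp
  show ?thesis
  proof
    show "m \<le> Suc l" by (simp add: l_def)
    show "sc (1 / 2 ^ Suc l) (\<Sum>k<2^Suc l. h k) \<in> dyadic_averages sc N (Suc l)"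
      unfolding dyadic_averages_def using hN by blast
    show "x = sc 2 (sc (1 / 2 ^ Suc l) (\<Sum>k<2^Suc l. h k))"
      unfolding sum by simp
  qed
qed

end

section \<open>Hadamard matrices\<close>

definition Hadamard :: "nat \<Rightarrow> (nat \<Rightarrow> nat \<Rightarrow> real) \<Rightarrow> bool" where
  "Hadamard n H \<longleftrightarrow> (\<forall>j k. H j k \<in> {-1, 1}) \<and> (\<forall>k. H 0 k = 1) \<and>
     (\<forall>i<2^n. \<forall>j<2^n. (\<Sum>k<2^n. H i k * H j k) = (if i = j then 2 ^ n else 0))"

lemma sum_lessThan_double:
  fixes f :: "nat \<Rightarrow> 'a::comm_monoid_add"
  shows "(\<Sum>k<2 * m. f k) = (\<Sum>k<m. f k) + (\<Sum>k<m. f (m + k))"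
proof -
  have "(\<Sum>k<2 * m. f k) = sum f {0..<m} + sum f {m..<m + m}"
    by (simp add: lessThan_atLeast0 sum.atLeastLessThan_concat mult_2)
  also have "sum f {m..<m + m} = (\<Sum>k=0..<m. f (m + k))"
    using sum.shift_bounds_nat_ivl[of f 0 m m] by (simp add: add.commute)
  finally show ?thesis by (simp add: lessThan_atLeast0)
qed

text \<open>
  Sylvester's construction: the matrix of order \<open>2 * m\<close> consists of four blocks of order \<open>m\<close>,
  the last of them with the opposite sign.
\<close>

lemma exists_Hadamard: "\<exists>H. Hadamard n H"
proof (induction n)
  case 0
  show ?case by (rule exI[of _ "\<lambda>_ _. 1"]) (simp add: Hadamard_def)
next
  case (Suc n)
  then obtain H where H: "\<And>j k. H j k \<in> {-1, 1}" "\<And>k. H 0 k = 1"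
    and orth: "\<And>i j :: nat. i < 2^n \<Longrightarrow> j < 2^n \<Longrightarrow>
      (\<Sum>k<(2::nat)^n. H i k * H j k) = (if i = j then 2 ^ n else 0 :: real)"
    unfolding Hadamard_def by blast
  define m :: nat where "m = 2 ^ n"
  have m: "m > 0" by (simp add: m_def)
  have mod_m: "i mod m = (if m \<le> i then i - m else i)" if "i < 2 * m" for i
  proof (cases "m \<le> i")
    case True
    then have "i mod m = (m + (i - m)) mod m" by simp
    also have "\<dots> = (i - m) mod m" by (rule mod_add_self1)
    also have "\<dots> = i - m" using that True by (intro mod_less) linarith
    finally show ?thesis using True by simp
  qed simp
  define s where "s j = (if m \<le> j then -1 else 1 :: real)" for j
  define G where "G j k = H (j mod m) (k mod m) * (if m \<le> k then s j else 1)" for j k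
  have "(\<Sum>k<2 * m. G i k * G j k) = (if i = j then 2 * m else 0)" if ij: "i < 2 * m" "j < 2 * m" for i j
  proof -
    let ?S = "\<Sum>k<m. H (i mod m) k * H (j mod m) k"
    have S: "?S = (if i mod m = j mod m then real m else 0)"
      using orth[of "i mod m" "j mod m"] m by (simp add: m_def)
    have "(\<Sum>k<m. G i k * G j k) = ?S"
      by (rule sum.cong) (auto simp: G_def)
    moreover have "(\<Sum>k<m. G i (m + k) * G j (m + k)) = s i * s j * ?S"
      unfolding sum_distrib_left by (rule sum.cong) (auto simp: G_def)
    ultimately have split: "(\<Sum>k<2 * m. G i k * G j k) = (1 + s i * s j) * ?S"
      by (simp add: sum_lessThan_double distrib_right)
    show ?thesis
    proof (cases "i mod m = j mod m")
      case True
      then have "s i = s j \<longleftrightarrow> i = j"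
        unfolding mod_m[OF ij(1)] mod_m[OF ij(2)] s_def
        using ij by (cases "m \<le> i"; cases "m \<le> j") auto
      moreover have "s i * s j = (if s i = s j then 1 else -1)"
        by (simp add: s_def)
      ultimately show ?thesis using split S True by simp
    next
      case False
      then show ?thesis using split S by auto
    qed
  qed
  then have "Hadamard (Suc n) G"
    using H m by (auto simp: Hadamard_def G_def s_def m_def)
  then show ?case by blast
qed

lemma Hadamard_Parseval:
  fixes a :: "nat \<Rightarrow> 'a::real_inner"
  assumes H: "Hadamard n H" and J: "J \<subseteq> {..<2^n}"
  shows "(\<Sum>k<2^n. (norm (\<Sum>j\<in>J. H j k *\<^sub>R a j))\<^sup>2) = 2 ^ n * (\<Sum>j\<in>J. (norm (a j))\<^sup>2)"
proof -
  have fin: "finite J" using J finite_subset by blast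
  have "(\<Sum>k<2^n. (norm (\<Sum>j\<in>J. H j k *\<^sub>R a j))\<^sup>2)
      = (\<Sum>k<2^n. \<Sum>i\<in>J. \<Sum>j\<in>J. H i k * H j k * inner (a i) (a j))"
    by (simp add: power2_norm_eq_inner inner_sum_left inner_sum_right sum_distrib_left mult_ac)
      (auto intro!: sum.cong simp: inner_commute)
  also have "\<dots> = (\<Sum>i\<in>J. \<Sum>j\<in>J. (\<Sum>k<2^n. H i k * H j k) * inner (a i) (a j))"
    unfolding sum_distrib_right
    by (subst sum.swap) (intro sum.cong refl sum.swap)
  also have "\<dots> = (\<Sum>i\<in>J. \<Sum>j\<in>J. if i = j then 2 ^ n * inner (a i) (a j) else 0)"
    using H J by (intro sum.cong refl) (auto simp: Hadamard_def subset_iff)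
  also have "\<dots> = (\<Sum>i\<in>J. 2 ^ n * inner (a i) (a i))"
    using fin by (intro sum.cong refl) (simp add: sum.delta)
  finally show ?thesis
    by (simp add: power2_norm_eq_inner sum_distrib_left)
qed

text \<open>
  By Parseval, the mean of the moduli is at most \<open>sqrt (\<Sum>j. (norm (a j))\<^sup>2)\<close>. This is at most
  \<open>sqrt ((\<Sum>j. norm (a j)) * P)\<close>, and the two factors are separated by the inequality between
  arithmetic and geometric mean with weight \<open>d\<close>.
\<close>

lemma Hadamard_mean_le:
  fixes a :: "nat \<Rightarrow> 'a::real_inner"
  assumes H: "Hadamard n H" and J: "J \<subseteq> {..<2^n}" and d: "d > 0"
    and P: "\<And>j. j \<in> J \<Longrightarrow> norm (a j) \<le> P" "0 \<le> P"
  shows "(\<Sum>k<2^n. norm (\<Sum>j\<in>J. H j k *\<^sub>R a j)) / 2 ^ n \<le> (d * (\<Sum>j\<in>J. norm (a j)) + P / d) / 2"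
proof -
  let ?S = "\<Sum>k<2^n. norm (\<Sum>j\<in>J. H j k *\<^sub>R a j)" and ?A = "\<Sum>j\<in>J. norm (a j)"
  have A: "0 \<le> ?A" by (simp add: sum_nonneg)
  have "?S\<^sup>2 \<le> (\<Sum>k<2^n. (norm (\<Sum>j\<in>J. H j k *\<^sub>R a j))\<^sup>2) * (\<Sum>k<(2::nat)^n. 1\<^sup>2)"
    using Cauchy_Schwarz_ineq_sum[of "\<lambda>k. norm (\<Sum>j\<in>J. H j k *\<^sub>R a j)" "\<lambda>_. 1" "{..<2^n}"] by simp
  also have "\<dots> = (2 ^ n)\<^sup>2 * (\<Sum>j\<in>J. (norm (a j))\<^sup>2)"
    by (subst Hadamard_Parseval[OF H J]) (simp add: power2_eq_square)
  also have "\<dots> \<le> (2 ^ n)\<^sup>2 * (?A * P)"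
    unfolding sum_distrib_right power2_eq_square
    by (intro mult_left_mono sum_mono) (use P in auto)
  finally have "(?S / 2 ^ n)\<^sup>2 \<le> (d * ?A) * (P / d)"
    using d by (simp add: power_divide field_simps)
  also have "\<dots> \<le> ((d * ?A + P / d) / 2)\<^sup>2"
  proof -
    have "x * y \<le> ((x + y) / 2)\<^sup>2" for x y :: real
      using zero_le_power2[of "x - y"] by (simp add: power2_eq_square field_simps)
    then show ?thesis .
  qed
  finally show ?thesis
    by (rule power2_le_imp_le) (use A P d in auto)
qed

section \<open>The inequality for subspaces of L1\<close>

lemma AE_embedding_sum:
  fixes V :: "('k::{real_normed_field,euclidean_space}, 'a::ab_group_add) qspace"
  assumes vs: "vector_space (smul V)" and sub: "module.subspace (smul V) (carrier V)"
    and add: "\<And>f g. f \<in> carrier V \<Longrightarrow> g \<in> carrier V \<Longrightarrow> AE t in M. T (f + g) t = T f t + T g t"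
    and scl: "\<And>c f. f \<in> carrier V \<Longrightarrow> AE t in M. T (smul V c f) t = c * T f t"
    and I: "finite I" and f: "\<And>i. i \<in> I \<Longrightarrow> f i \<in> carrier V"
  shows "AE t in M. T (\<Sum>i\<in>I. smul V (c i) (f i)) t = (\<Sum>i\<in>I. c i * T (f i) t)"
  using I f
proof (induction rule: finite_induct)
  case empty
  interpret vector_space "smul V" by fact
  show ?case using scl[of 0 0] subspace_0[OF sub] by simp
next
  case (insert i I)
  interpret vector_space "smul V" by fact
  have c: "smul V (c i) (f i) \<in> carrier V" "(\<Sum>i\<in>I. smul V (c i) (f i)) \<in> carrier V"
    using insert.prems by (auto intro!: subspace_scale[OF sub] subspace_sum[OF sub])
  have "AE t in M. T (\<Sum>i\<in>I. smul V (c i) (f i)) t = (\<Sum>i\<in>I. c i * T (f i) t)"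
    using insert by simp
  moreover have "AE t in M. T (smul V (c i) (f i)) t = c i * T (f i) t"
    using scl insert.prems by blast
  ultimately show ?case
    using add[OF c] by eventually_elim (simp add: insert.hyps)
qed

text \<open>
  The dual form of truncating functions at the height \<open>d\<close>. The forms \<open>\<phi> j\<close> are combinations of
  the \<open>\<psi> \<eta>\<close> with the coefficients \<open>\<eta> j\<close>, so that in an L1-space the sum of the \<open>\<bar>\<psi> \<eta>\<bar>\<close> dominates
  the maximum of the \<open>\<bar>\<phi> j\<bar>\<close>.
\<close>

definition Hadamard_inequality ::
    "('k::{real_normed_field,euclidean_space}, 'a::ab_group_add) qspace \<Rightarrow> real \<Rightarrow> bool" where
  "Hadamard_inequality V c \<longleftrightarrow>
     (\<forall>n H R d E \<psi> \<phi>.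
        Hadamard n H \<longrightarrow> R \<subseteq> {..<2^n} \<longrightarrow> 0 < d \<longrightarrow> finite E \<longrightarrow>
        (\<forall>\<eta>\<in>E. \<forall>j\<in>R. \<bar>\<eta> j\<bar> \<le> 1) \<longrightarrow> (\<forall>\<eta>\<in>E. \<psi> \<eta> \<in> carrier V) \<longrightarrow>
        (\<forall>j\<in>R. \<phi> j = (\<Sum>\<eta>\<in>E. smul V (of_real (\<eta> j)) (\<psi> \<eta>))) \<longrightarrow>
        (\<Sum>k<2^n. qnorm V (\<Sum>j\<in>R. smul V (of_real (H j k)) (\<phi> j))) / 2 ^ n
          \<le> c * (d * (\<Sum>j\<in>R. qnorm V (\<phi> j)) + (\<Sum>\<eta>\<in>E. qnorm V (\<psi> \<eta>)) / d))"

text \<open>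
  In an L1-space the inequality holds pointwise, by \<open>Hadamard_mean_le\<close> with the bound
  \<open>P = (\<Sum>\<eta>. \<bar>\<psi> \<eta>\<bar>)\<close>, and one only has to integrate. The embedding is linear almost everywhere,
  which is enough for finitely many functions; it is used on both sides, whence the constant
  \<open>b / (2 * a)\<close>.
\<close>

lemma L1_Hadamard_inequality:
  fixes V :: "('k::{real_normed_field,euclidean_space}, 'a::ab_group_add) qspace"
    and M :: "'m measure"
  assumes vs: "vector_space (smul V)" and sub: "module.subspace (smul V) (carrier V)"
    and emb: "embeds_in_L1 V M"
  shows "\<exists>c. Hadamard_inequality V c"
proof -
  interpret V: vector_space "smul V" by fact
  obtain T :: "'a \<Rightarrow> 'm \<Rightarrow> 'k" where
    T: "\<forall>f\<in>carrier V. integrable M (T f)"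
      "\<forall>f\<in>carrier V. \<forall>g\<in>carrier V. AE t in M. T (f + g) t = T f t + T g t"
      "\<forall>c. \<forall>f\<in>carrier V. AE t in M. T (smul V c f) t = c * T f t"
      "\<exists>a b. 0 < a \<and> (\<forall>f\<in>carrier V. a * qnorm V f \<le> (\<integral>t. norm (T f t) \<partial>M) \<and>
         (\<integral>t. norm (T f t) \<partial>M) \<le> b * qnorm V f)"
    using emb unfolding embeds_in_L1_def by (elim exE conjE) (rule that; (assumption | (intro exI conjI; assumption)))
  note int = T(1)[rule_format] and add = T(2)[rule_format] and scl = T(3)[rule_format]
  obtain a b where a: "0 < a"
    and low: "\<And>f. f \<in> carrier V \<Longrightarrow> a * qnorm V f \<le> (\<integral>t. norm (T f t) \<partial>M)"
    and up: "\<And>f. f \<in> carrier V \<Longrightarrow> (\<integral>t. norm (T f t) \<partial>M) \<le> b * qnorm V f"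
    using T(4) by auto
  have "Hadamard_inequality V (b / (2 * a))"
    unfolding Hadamard_inequality_def
  proof (intro allI impI)
    fix n :: nat and H and R :: "nat set" and d :: real and E and \<psi> :: "(nat \<Rightarrow> real) \<Rightarrow> 'a" and \<phi>
    assume H: "Hadamard n H" and R: "R \<subseteq> {..<2^n}" and d: "0 < d" and E: "finite E"
      and s': "\<forall>\<eta>\<in>E. \<forall>j\<in>R. \<bar>\<eta> j\<bar> \<le> 1" and \<psi>': "\<forall>\<eta>\<in>E. \<psi> \<eta> \<in> carrier V"
      and \<phi>': "\<forall>j\<in>R. \<phi> j = (\<Sum>\<eta>\<in>E. smul V (of_real (\<eta> j)) (\<psi> \<eta>))"
    note s = s'[rule_format] and \<psi> = \<psi>'[rule_format] and \<phi> = \<phi>'[rule_format]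
    have finR: "finite R" using R finite_subset by blast
    have \<phi>c: "\<phi> j \<in> carrier V" if "j \<in> R" for j
      using \<psi> \<phi>[OF that] by (auto intro!: V.subspace_scale[OF sub] V.subspace_sum[OF sub])
    define F where "F k = (\<Sum>j\<in>R. smul V (of_real (H j k)) (\<phi> j))" for k
    have Fc: "F k \<in> carrier V" for k
      unfolding F_def using \<phi>c by (auto intro!: V.subspace_scale[OF sub] V.subspace_sum[OF sub])
    have AE_F: "AE t in M. \<forall>k. T (F k) t = (\<Sum>j\<in>R. of_real (H j k) * T (\<phi> j) t)"
      unfolding F_def AE_all_countable
      by (intro allI AE_embedding_sum[OF vs sub add scl finR \<phi>c])
    have AE_\<phi>: "AE t in M. \<forall>j\<in>R. T (\<phi> j) t = (\<Sum>\<eta>\<in>E. of_real (\<eta> j) * T (\<psi> \<eta>) t)"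
    proof (intro AE_finite_allI finR)
      show "AE t in M. T (\<phi> j) t = (\<Sum>\<eta>\<in>E. of_real (\<eta> j) * T (\<psi> \<eta>) t)" if "j \<in> R" for j
        unfolding \<phi>[OF that] by (rule AE_embedding_sum[OF vs sub add scl E \<psi>])
    qed
    define g where "g t = (d * (\<Sum>j\<in>R. norm (T (\<phi> j) t)) + (\<Sum>\<eta>\<in>E. norm (T (\<psi> \<eta>) t)) / d) / 2" for t
    have pointwise: "AE t in M. (\<Sum>k<2^n. norm (T (F k) t)) / 2 ^ n \<le> g t"
      using AE_F AE_\<phi>
    proof eventually_elim
      case (elim t)
      have "(\<Sum>k<2^n. norm (\<Sum>j\<in>R. H j k *\<^sub>R T (\<phi> j) t)) / 2 ^ n \<le> g t"
        unfolding g_def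
      proof (rule Hadamard_mean_le[OF H R d])
        fix j assume j: "j \<in> R"
        have "norm (T (\<phi> j) t) \<le> (\<Sum>\<eta>\<in>E. norm (of_real (\<eta> j) * T (\<psi> \<eta>) t))"
          using elim(2) j norm_sum by simp
        also have "\<dots> \<le> (\<Sum>\<eta>\<in>E. norm (T (\<psi> \<eta>) t))"
          using s j by (intro sum_mono) (simp add: norm_mult mult_left_le_one_le)
        finally show "norm (T (\<phi> j) t) \<le> (\<Sum>\<eta>\<in>E. norm (T (\<psi> \<eta>) t))" .
      qed (simp add: sum_nonneg)
      then show ?case using elim(1) by (simp add: scaleR_conv_of_real)
    qed
    have int_g: "integrable M g"
      unfolding g_def using int \<phi>c \<psi> by (auto intro!: integrable_sum integrable_norm)
    have int_F: "integrable M (\<lambda>t. (\<Sum>k<2^n. norm (T (F k) t)) / 2 ^ n)"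
      using int Fc by (auto intro!: integrable_sum integrable_norm)
    have "a * ((\<Sum>k<2^n. qnorm V (F k)) / 2 ^ n) = (\<Sum>k<2^n. a * qnorm V (F k)) / 2 ^ n"
      by (simp add: sum_distrib_left)
    also have "\<dots> \<le> (\<Sum>k<2^n. \<integral>t. norm (T (F k) t) \<partial>M) / 2 ^ n"
      using low Fc by (intro divide_right_mono sum_mono) auto
    also have "\<dots> = (\<integral>t. (\<Sum>k<2^n. norm (T (F k) t)) / 2 ^ n \<partial>M)"
      using int Fc by (simp add: Bochner_Integration.integral_sum integrable_norm)
    also have "\<dots> \<le> (\<integral>t. g t \<partial>M)"
      using pointwise by (rule integral_mono_AE[OF int_F int_g])
    also have "\<dots> = (d * (\<Sum>j\<in>R. \<integral>t. norm (T (\<phi> j) t) \<partial>M) + (\<Sum>\<eta>\<in>E. \<integral>t. norm (T (\<psi> \<eta>) t) \<partial>M) / d) / 2"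
      unfolding g_def using int \<phi>c \<psi>
      by (simp add: Bochner_Integration.integral_sum Bochner_Integration.integral_add integrable_norm integrable_sum)
    also have "\<dots> \<le> (d * (\<Sum>j\<in>R. b * qnorm V (\<phi> j)) + (\<Sum>\<eta>\<in>E. b * qnorm V (\<psi> \<eta>)) / d) / 2"
      using up \<phi>c \<psi> d by (intro divide_right_mono add_mono mult_left_mono sum_mono) auto
    also have "\<dots> = b / 2 * (d * (\<Sum>j\<in>R. qnorm V (\<phi> j)) + (\<Sum>\<eta>\<in>E. qnorm V (\<psi> \<eta>)) / d)"
      unfolding sum_distrib_left[symmetric] by (simp add: distrib_left)
    finally have *: "a * ((\<Sum>k<2^n. qnorm V (F k)) / 2 ^ n)
        \<le> b / 2 * (d * (\<Sum>j\<in>R. qnorm V (\<phi> j)) + (\<Sum>\<eta>\<in>E. qnorm V (\<psi> \<eta>)) / d)" .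
    have "(\<Sum>k<2^n. qnorm V (F k)) / 2 ^ n
        \<le> b / (2 * a) * (d * (\<Sum>j\<in>R. qnorm V (\<phi> j)) + (\<Sum>\<eta>\<in>E. qnorm V (\<psi> \<eta>)) / d)"
    proof -
      have "x \<le> b / (2 * a) * y" if "a * x \<le> b / 2 * y" for x y
        using that a by (simp add: field_simps)
      then show ?thesis using * by blast
    qed
    then show "(\<Sum>k<2^n. qnorm V (\<Sum>j\<in>R. smul V (of_real (H j k)) (\<phi> j))) / 2 ^ n
        \<le> b / (2 * a) * (d * (\<Sum>j\<in>R. qnorm V (\<phi> j)) + (\<Sum>\<eta>\<in>E. qnorm V (\<psi> \<eta>)) / d)"
      by (simp add: F_def)
  qed
  then show ?thesis by blast
qed

section \<open>Splitting signed averages by duality\<close>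

text \<open>
  The entries of \<open>z\<close> vary independently of each other, so the suprema may be taken one after the
  other.
\<close>

lemma sum_SUP_le:
  fixes a :: "'i \<Rightarrow> 'z \<Rightarrow> real"
  assumes "finite I" and "\<And>i. i \<in> I \<Longrightarrow> A i \<noteq> {}"
    and "\<And>z. (\<And>i. i \<in> I \<Longrightarrow> z i \<in> A i) \<Longrightarrow> (\<Sum>i\<in>I. a i (z i)) \<le> B"
  shows "(\<Sum>i\<in>I. SUP z\<in>A i. a i z) \<le> B"
  using assms
proof (induction I arbitrary: B rule: finite_induct)
  case (insert i I)
  have "(\<Sum>i\<in>I. SUP z\<in>A i. a i z) \<le> B - a i z" if z: "z \<in> A i" for z
  proof (rule insert.IH)
    fix y assume y: "\<And>j. j \<in> I \<Longrightarrow> y j \<in> A j"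
    have "(\<Sum>j\<in>insert i I. a j ((y(i := z)) j)) \<le> B"
      by (rule insert.prems(2)) (use y z in auto)
    moreover have "(\<Sum>j\<in>I. a j ((y(i := z)) j)) = (\<Sum>j\<in>I. a j (y j))"
      using insert.hyps by (intro sum.cong) auto
    ultimately show "(\<Sum>j\<in>I. a j (y j)) \<le> B - a i z"
      using insert.hyps by simp
  qed (use insert.prems(1) in auto)
  then have "(SUP z\<in>A i. a i z) \<le> B - (\<Sum>i\<in>I. SUP z\<in>A i. a i z)"
    using insert.prems(1)[of i] by (intro cSUP_least) (auto simp: algebra_simps)
  then show ?case using insert.hyps by simp
qed simp

lemma (in seminorm) seminorm_quotient:
  assumes G: "subspace G"
  shows "seminorm sc (\<lambda>x. INF g\<in>G. N (x - g))"
proof -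
  define q where "q x = (INF g\<in>G. N (x - g))" for x
  have ne: "G \<noteq> {}" using subspace_0[OF G] by blast
  have qle: "q x \<le> N (x - g)" if "g \<in> G" for x g
    unfolding q_def by (rule cINF_lower[OF bdd_belowI2[of _ 0]]) (use that in auto)
  have qge: "m \<le> q x" if "\<And>g. g \<in> G \<Longrightarrow> m \<le> N (x - g)" for m x
    unfolding q_def by (rule cINF_greatest[OF ne]) (use that in auto)
  have q0: "q 0 = 0"
    using qle[OF subspace_0[OF G], of 0] qge[of 0 0] by simp
  have "q (x + y) \<le> q x + q y" for x y
  proof -
    have *: "q (x + y) \<le> N (x - g) + N (y - h)" if "g \<in> G" "h \<in> G" for g h
    proof -
      have "q (x + y) \<le> N (x + y - (g + h))"
        using that by (intro qle subspace_add[OF G])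
      also have "x + y - (g + h) = (x - g) + (y - h)" by simp
      finally show ?thesis using triangle order_trans by blast
    qed
    have "q (x + y) - N (x - g) \<le> q y" if "g \<in> G" for g
      by (rule qge) (use *[OF that] in \<open>simp add: algebra_simps\<close>)
    then have "q (x + y) - q y \<le> q x"
      by (intro qge) (simp add: algebra_simps)
    then show ?thesis by simp
  qed
  moreover have "q (sc c x) = norm c * q x" for c x
  proof (cases "c = 0")
    case False
    have le: "q (sc c x) \<le> norm c * q x" if c: "c \<noteq> 0" for c x
    proof -
      have "q (sc c x) / norm c \<le> q x"
      proof (rule qge)
        fix g assume "g \<in> G"
        then have "q (sc c x) \<le> N (sc c x - sc c g)"
          by (intro qle subspace_scale[OF G])
        then show "q (sc c x) / norm c \<le> N (x - g)"
          using c by (simp add: scale_right_diff_distrib[symmetric] scaled divide_le_eq mult.commute)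
      qed
      then show ?thesis using c by (simp add: divide_le_eq mult.commute)
    qed
    have "norm c * q (sc (inverse c) (sc c x)) \<le> norm c * (norm (inverse c) * q (sc c x))"
      using False by (intro mult_left_mono le) auto
    also have "\<dots> = (norm c * norm (inverse c)) * q (sc c x)" by simp
    also have "norm c * norm (inverse c) = 1"
      using False by (simp add: norm_inverse)
    finally have "norm c * q x \<le> q (sc c x)"
      using False by simp
    then show ?thesis using le[OF False, of x] by (rule antisym[rotated])
  qed (simp add: q0)
  ultimately have "seminorm sc q"
    by unfold_locales auto
  then show ?thesis by (simp add: q_def[abs_def])
qed

definition weighted_max :: "('i \<Rightarrow> real) \<Rightarrow> 'i set \<Rightarrow> ('v \<Rightarrow> real) \<Rightarrow> ('i \<Rightarrow> 'v) \<Rightarrow> real" where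
  "weighted_max \<alpha> I N w = Max (insert 0 ((\<lambda>i. \<alpha> i * N (w i)) ` I))"

lemma weighted_max_le_iff:
  "finite I \<Longrightarrow> weighted_max \<alpha> I N w \<le> m \<longleftrightarrow> 0 \<le> m \<and> (\<forall>i\<in>I. \<alpha> i * N (w i) \<le> m)"
  by (auto simp: weighted_max_def)

lemma weighted_max_ge:
  "finite I \<Longrightarrow> i \<in> I \<Longrightarrow> \<alpha> i * N (w i) \<le> weighted_max \<alpha> I N w"
  by (simp add: weighted_max_def)

lemma weighted_max_nonneg: "finite I \<Longrightarrow> 0 \<le> weighted_max \<alpha> I N w"
  by (simp add: weighted_max_def)

lemma (in vector_space) vector_space_fun: "vector_space (\<lambda>c w (i :: 'i). scale c (w i))"
  by unfold_locales (auto simp: fun_eq_iff scale_right_distrib scale_left_distrib)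

lemma (in seminorm) seminorm_weighted_max:
  assumes I: "finite I" and \<alpha>: "\<And>i. i \<in> I \<Longrightarrow> 0 \<le> \<alpha> i"
  shows "seminorm (\<lambda>c w i. sc c (w i)) (weighted_max \<alpha> I N)"
proof -
  interpret F: vector_space "\<lambda>c w (i :: 'a). sc c (w i)" by (rule vector_space_fun)
  show ?thesis
  proof unfold_locales
    show "weighted_max \<alpha> I N (x + y) \<le> 1 * (weighted_max \<alpha> I N x + weighted_max \<alpha> I N y)" for x y
      unfolding weighted_max_le_iff[OF I]
    proof (intro conjI ballI)
      fix i assume i: "i \<in> I"
      have "\<alpha> i * N ((x + y) i) \<le> \<alpha> i * N (x i) + \<alpha> i * N (y i)"
        using mult_left_mono[OF triangle \<alpha>[OF i]] by (simp add: distrib_left)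
      then show "\<alpha> i * N ((x + y) i) \<le> 1 * (weighted_max \<alpha> I N x + weighted_max \<alpha> I N y)"
        using weighted_max_ge[OF I i, of \<alpha> N x] weighted_max_ge[OF I i, of \<alpha> N y] by simp
    qed (simp add: weighted_max_nonneg[OF I])
    show "weighted_max \<alpha> I N (\<lambda>i. sc c (x i)) = norm c * weighted_max \<alpha> I N x" for c x
    proof -
      have "mono (\<lambda>r. norm c * r)" by (intro monoI mult_left_mono) auto
      then have "norm c * weighted_max \<alpha> I N x = Max ((\<lambda>r. norm c * r) ` insert 0 ((\<lambda>i. \<alpha> i * N (x i)) ` I))"
        unfolding weighted_max_def using I by (intro mono_Max_commute) auto
      also have "\<dots> = weighted_max \<alpha> I N (\<lambda>i. sc c (x i))"
        unfolding weighted_max_def by (simp add: image_image scaled mult_ac)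
      finally show ?thesis by simp
    qed
  qed simp
qed

text \<open>
  The supremum is taken over the quasi-norm ball; for bounded linear forms it has the same value
  on the ball of the convex gauge.
\<close>

definition dual_norm :: "('v \<Rightarrow> real) \<Rightarrow> ('v \<Rightarrow> 'k::real_normed_vector) \<Rightarrow> real" where
  "dual_norm N f = (SUP x\<in>{x. N x \<le> 1}. norm (f x))"

lemma dual_norm_upper:
  assumes f: "\<And>x. norm (f x) \<le> c * N x" and N: "\<And>x. 0 \<le> N x" and x: "N x \<le> 1"
  shows "norm (f x) \<le> dual_norm N f"
  unfolding dual_norm_def
proof (rule cSUP_upper)
  show "bdd_above ((\<lambda>x. norm (f x)) ` {x. N x \<le> 1})"
  proof (rule bdd_aboveI2)
    fix y assume "y \<in> {x. N x \<le> 1}"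
    then have "N y \<le> 1" by simp
    have "norm (f y) \<le> \<bar>c\<bar> * N y"
      using f[of y] N[of y] by (meson abs_ge_self mult_right_mono order_trans)
    also have "\<dots> \<le> \<bar>c\<bar> * 1" using \<open>N y \<le> 1\<close> by (intro mult_left_mono) auto
    finally show "norm (f y) \<le> \<bar>c\<bar>" by simp
  qed
qed (use x in simp)

definition bounded_form ::
    "('k::real_normed_field \<Rightarrow> 'v::ab_group_add \<Rightarrow> 'v) \<Rightarrow> ('v \<Rightarrow> real) \<Rightarrow> ('v \<Rightarrow> 'k) \<Rightarrow> bool" where
  "bounded_form sc N f \<longleftrightarrow> linear_form sc f \<and> (\<exists>c. \<forall>x. norm (f x) \<le> c * N x)"

text \<open>
  The inequality \<open>Hadamard_inequality\<close> for the dual of a quasi-seminorm on a whole type, where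
  functionals are linear forms and no carrier restricts their domain.
\<close>

definition dual_Hadamard_inequality ::
    "('k::real_normed_field \<Rightarrow> 'v::ab_group_add \<Rightarrow> 'v) \<Rightarrow> ('v \<Rightarrow> real) \<Rightarrow> real \<Rightarrow> bool" where
  "dual_Hadamard_inequality sc N c \<longleftrightarrow>
     (\<forall>n H R d E (\<psi> :: (nat \<Rightarrow> real) \<Rightarrow> 'v \<Rightarrow> 'k) \<phi>.
        Hadamard n H \<longrightarrow> R \<subseteq> {..<2^n} \<longrightarrow> 0 < d \<longrightarrow> finite E \<longrightarrow>
        (\<forall>\<eta>\<in>E. \<forall>j\<in>R. \<bar>\<eta> j\<bar> \<le> 1) \<longrightarrow> (\<forall>\<eta>\<in>E. bounded_form sc N (\<psi> \<eta>)) \<longrightarrow>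
        (\<forall>j\<in>R. \<phi> j = (\<lambda>x. \<Sum>\<eta>\<in>E. of_real (\<eta> j) * \<psi> \<eta> x)) \<longrightarrow>
        (\<Sum>k<2^n. dual_norm N (\<lambda>x. \<Sum>j\<in>R. of_real (H j k) * \<phi> j x)) / 2 ^ n
          \<le> c * (d * (\<Sum>j\<in>R. dual_norm N (\<phi> j)) + (\<Sum>\<eta>\<in>E. dual_norm N (\<psi> \<eta>)) / d))"

lemma sum_apply: "(\<Sum>i\<in>I. f i) x = (\<Sum>i\<in>I. f i x)"
  by (induction I rule: infinite_finite_induct) auto

text \<open>
  The dual of a weighted maximum norm is a weighted sum norm. The quasi-norm \<open>N'\<close> above \<open>N\<close> (in
  the application, \<open>N\<close> is its convex gauge) may be used to measure the coordinate forms.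
\<close>

lemma (in seminorm) coordinate_forms:
  fixes I :: "'i set" and \<Lambda> :: "('i \<Rightarrow> 'v) \<Rightarrow> 'k"
  assumes I: "finite I" and \<alpha>: "\<And>i. i \<in> I \<Longrightarrow> 0 < \<alpha> i"
    and lin: "linear_form (\<lambda>c w i. sc c (w i)) \<Lambda>"
    and bnd: "\<And>w. norm (\<Lambda> w) \<le> weighted_max \<alpha> I N w"
    and N': "\<And>x. 0 \<le> N' x" "\<And>x. N x \<le> N' x" "N' 0 = 0"
  obtains f where "\<And>w. \<Lambda> w = (\<Sum>i\<in>I. f i (w i))"
    "\<And>i. i \<in> I \<Longrightarrow> bounded_form sc N' (f i)"
    "(\<Sum>i\<in>I. dual_norm N' (f i) / \<alpha> i) \<le> 1"
proof -
  interpret W: vector_space "\<lambda>c w (i :: 'i). sc c (w i)" by (rule vector_space_fun)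
  define f where "f i x = \<Lambda> (\<lambda>i'. if i' = i then x else 0)" for i x
  have repr: "\<Lambda> w = (\<Sum>i\<in>I. f i (w i))" for w
  proof -
    let ?v = "\<Sum>i\<in>I. (\<lambda>i'. if i' = i then w i else 0)"
    have "(w - ?v) i = 0" if "i \<in> I" for i
      using that I by (simp add: sum.delta sum_apply)
    then have "weighted_max \<alpha> I N (w - ?v) \<le> 0"
      by (simp add: weighted_max_le_iff[OF I])
    then have "\<Lambda> (w - ?v) = 0"
      using bnd[of "w - ?v"] by (meson norm_le_zero_iff order_trans)
    then have "\<Lambda> w = \<Lambda> ?v"
      using W.linear_form_diff[OF lin] by simp
    then show ?thesis
      using linear_form_sum[OF lin] by (simp add: f_def)
  qed
  have lin_f: "linear_form sc (f i)" for i
    unfolding linear_form_def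
  proof (intro conjI allI)
    fix x y c
    have "f i (x + y) = \<Lambda> ((\<lambda>i'. if i' = i then x else 0) + (\<lambda>i'. if i' = i then y else 0))"
      unfolding f_def by (rule arg_cong[of _ _ \<Lambda>]) auto
    then show "f i (x + y) = f i x + f i y"
      using lin by (simp add: linear_form_def f_def)
    have "f i (sc c x) = \<Lambda> (\<lambda>i''. sc c (if i'' = i then x else 0))"
      unfolding f_def by (rule arg_cong[of _ _ \<Lambda>]) auto
    then show "f i (sc c x) = c * f i x"
      using lin by (simp add: linear_form_def f_def)
  qed
  have bf: "norm (f i x) \<le> \<alpha> i * N' x" if i: "i \<in> I" for i x
  proof -
    have "norm (f i x) \<le> weighted_max \<alpha> I N (\<lambda>i'. if i' = i then x else 0)"
      unfolding f_def by (rule bnd)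
    also have "\<dots> \<le> \<alpha> i * N' x"
      using i \<alpha>[OF i] N' by (auto simp: weighted_max_le_iff[OF I])
    finally show ?thesis .
  qed
  have eq: "dual_norm N' (f i) / \<alpha> i = (SUP x\<in>{x. N' x \<le> 1}. norm (f i x) / \<alpha> i)" if i: "i \<in> I" for i
  proof -
    have "mono (\<lambda>r. r / \<alpha> i)"
      using \<alpha>[OF i] by (intro monoI divide_right_mono) auto
    moreover have "bdd_above ((\<lambda>x. norm (f i x)) ` {x. N' x \<le> 1})"
    proof (rule bdd_aboveI2)
      fix x assume "x \<in> {x. N' x \<le> 1}"
      then have "\<alpha> i * N' x \<le> \<alpha> i * 1" using \<alpha>[OF i] by (intro mult_left_mono) auto
      then show "norm (f i x) \<le> \<alpha> i" using bf[OF i, of x] by simp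
    qed
    moreover have "continuous (at_left (dual_norm N' (f i))) (\<lambda>r. r / \<alpha> i)"
      by (intro continuous_intros) (use \<alpha>[OF i] in auto)
    moreover have "{x. N' x \<le> 1} \<noteq> {}" using N'(3) by (auto intro!: exI[of _ 0])
    ultimately show ?thesis
      unfolding dual_norm_def
      by (subst continuous_at_Sup_mono[of "\<lambda>r. r / \<alpha> i"]) (auto simp: image_image)
  qed
  have "(\<Sum>i\<in>I. SUP x\<in>{x. N' x \<le> 1}. norm (f i x) / \<alpha> i) \<le> 1"
  proof (rule sum_SUP_le[OF I])
    show "{x. N' x \<le> 1} \<noteq> {}" using N'(3) by (auto intro!: exI[of _ 0])
    fix z assume z: "\<And>i. i \<in> I \<Longrightarrow> z i \<in> {x. N' x \<le> 1}"
    \<comment> \<open>Multiplying the entries by unimodular scalars turns the values of the forms into their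
      moduli.\<close>
    define c where "c i = (if f i (z i) = 0 then 0 else of_real (norm (f i (z i))) / f i (z i))" for i
    have c: "c i * f i (z i) = of_real (norm (f i (z i)))" "norm (c i) \<le> 1" for i
      by (auto simp: c_def norm_divide)
    define w where "w i = sc (c i / of_real (\<alpha> i)) (z i)" for i
    have "f i (w i) = of_real (norm (f i (z i)) / \<alpha> i)" for i
    proof -
      have "f i (w i) = (c i * f i (z i)) / of_real (\<alpha> i)"
        using lin_f[of i] by (simp add: linear_form_def w_def)
      then show ?thesis using c(1) by simp
    qed
    then have "\<Lambda> w = of_real (\<Sum>i\<in>I. norm (f i (z i)) / \<alpha> i)"
      using repr by simp
    moreover have "0 \<le> (\<Sum>i\<in>I. norm (f i (z i)) / \<alpha> i)"
      using \<alpha> by (intro sum_nonneg divide_nonneg_pos) auto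
    ultimately have "(\<Sum>i\<in>I. norm (f i (z i)) / \<alpha> i) = norm (\<Lambda> w)"
      by (simp only: norm_of_real abs_of_nonneg)
    also have "\<dots> \<le> weighted_max \<alpha> I N w" by (rule bnd)
    also have "\<dots> \<le> 1"
      unfolding weighted_max_le_iff[OF I]
    proof (intro conjI ballI)
      fix i assume i: "i \<in> I"
      have "\<alpha> i * N (w i) = norm (c i) * N (z i)"
        using \<alpha>[OF i] by (simp add: w_def scaled norm_divide)
      also have "\<dots> \<le> 1 * 1"
        using c(2)[of i] z[OF i] N'(2)[of "z i"] by (intro mult_mono) auto
      finally show "\<alpha> i * N (w i) \<le> 1" by simp
    qed simp
    finally show "(\<Sum>i\<in>I. norm (f i (z i)) / \<alpha> i) \<le> 1" .
  qed
  then have "(\<Sum>i\<in>I. dual_norm N' (f i) / \<alpha> i) \<le> 1"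
    using eq by simp
  then show ?thesis
    using that repr lin_f bf unfolding bounded_form_def by blast
qed

context quasi_seminorm
begin

text \<open>
  This is the truncation of the signed averages \<open>f j\<close> at the height \<open>d\<close>, without functions. The
  product of copies of the space, indexed by the rows \<open>j\<close> and the signs \<open>\<eta>\<close>, carries the norm
  \<open>max (p (w j) / d) (d * p (w \<eta>))\<close>. The lemma says that the vector \<open>f'\<close> with the entries \<open>f j\<close>
  and \<open>0\<close> has distance at most \<open>c + 1\<close> from the subspace of the vectors with the entries \<open>b j\<close>
  and \<open>- (\<Sum>j. \<eta> j * b j)\<close>. A functional \<open>\<Lambda>\<close> that norms \<open>f'\<close> modulo this subspace vanishes on it,
  which means that its coordinates satisfy \<open>\<phi> j = (\<Sum>\<eta>. \<eta> j * \<psi> \<eta>)\<close>. Its value at \<open>f'\<close> is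
  \<open>2 ^ - n * (\<Sum>k. (\<Sum>j. H j k * \<phi> j) (h k))\<close>, and this is what the dual inequality estimates.
\<close>

lemma signed_averages_split:
  assumes dual: "dual_Hadamard_inequality sc N c" and c: "0 \<le> c"
    and H: "Hadamard n H" and R: "R \<subseteq> {..<2^n}" and d: "0 < d"
    and E: "finite E" "\<And>\<eta> j. \<eta> \<in> E \<Longrightarrow> j \<in> R \<Longrightarrow> \<bar>\<eta> j\<bar> \<le> 1"
    and h: "\<And>k. N (h k) \<le> 1"
    and f: "\<And>j. f j = sc (1 / 2 ^ n) (\<Sum>k<2^n. sc (of_real (H j k)) (h k))"
  obtains b where "\<And>j. j \<in> R \<Longrightarrow> conv_norm N (f j - b j) \<le> (c + 1) * d"
    "\<And>\<eta>. \<eta> \<in> E \<Longrightarrow> conv_norm N (\<Sum>j\<in>R. sc (of_real (\<eta> j)) (b j)) \<le> (c + 1) / d"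
proof -
  let ?p = "conv_norm N" and ?sW = "\<lambda>c w (i :: nat + (nat \<Rightarrow> real)). sc c (w i)"
  interpret p: seminorm sc ?p by (rule seminorm_conv_norm)
  interpret W: vector_space ?sW by (rule vector_space_fun)
  have finR: "finite R" using R finite_subset by blast
  define I where "I = Inl ` R \<union> Inr ` E"
  have I: "finite I" using finR E by (simp add: I_def)
  define \<alpha> where "\<alpha> i = (case i of Inl _ \<Rightarrow> 1 / d | Inr _ \<Rightarrow> d)" for i :: "nat + (nat \<Rightarrow> real)"
  have \<alpha>: "0 < \<alpha> i" for i using d by (simp add: \<alpha>_def split: sum.split)
  let ?n = "weighted_max \<alpha> I ?p"
  interpret n: seminorm ?sW ?n
    by (rule p.seminorm_weighted_max[OF I]) (simp add: less_imp_le[OF \<alpha>])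
  \<comment> \<open>The range of \<open>g\<close> is the subspace to which the distance of \<open>f'\<close> is measured.\<close>
  define g where "g b i = (case i of Inl j \<Rightarrow> b j | Inr \<eta> \<Rightarrow> - (\<Sum>j\<in>R. sc (of_real (\<eta> j)) (b j)))"
    for b and i :: "nat + (nat \<Rightarrow> real)"
  have g_add: "g b + g b' = g (b + b')" for b b'
    by (auto simp: fun_eq_iff g_def scale_right_distrib sum.distrib split: sum.split)
  have g_scale: "?sW a (g b) = g (\<lambda>j. sc a (b j))" for a b
    by (auto simp: fun_eq_iff g_def scale_sum_right mult.commute split: sum.split)
  have g_0: "g 0 = 0"
    by (auto simp: fun_eq_iff g_def split: sum.split)
  have subG: "W.subspace (range g)"
  proof (rule W.subspaceI)
    show "0 \<in> range g" using rangeI[of g 0] unfolding g_0 .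
    show "x + y \<in> range g" if "x \<in> range g" "y \<in> range g" for x y
    proof -
      from that obtain b b' where "x = g b" "y = g b'" by blast
      then have "x + y = g (b + b')" using g_add by simp
      then show ?thesis by simp
    qed
    show "?sW a x \<in> range g" if "x \<in> range g" for a x
    proof -
      from that obtain b where "x = g b" by blast
      then have "?sW a x = g (\<lambda>j. sc a (b j))" using g_scale by simp
      then show ?thesis by simp
    qed
  qed
  define q where "q w = (INF v\<in>range g. ?n (w - v))" for w
  interpret q: seminorm ?sW q
    unfolding q_def[abs_def] by (rule n.seminorm_quotient[OF subG])
  have bdd: "bdd_below ((\<lambda>v. ?n (w - v)) ` range g)" for w
    by (rule bdd_belowI2[of _ 0]) simp
  have q_le: "q w \<le> ?n (w - g b)" for w b
    unfolding q_def by (rule cINF_lower[OF bdd]) simp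
  define f' where "f' i = (case i of Inl j \<Rightarrow> f j | Inr _ \<Rightarrow> 0)" for i :: "nat + (nat \<Rightarrow> real)"
  obtain \<Lambda> where \<Lambda>: "linear_form ?sW \<Lambda>" "\<And>w. norm (\<Lambda> w) \<le> q w" "norm (\<Lambda> f') = q f'"
    using q.Hahn_Banach by blast
  have \<Lambda>_le: "norm (\<Lambda> w) \<le> ?n w" for w
    using \<Lambda>(2)[of w] q_le[of w 0] g_0 by simp
  obtain l where l: "\<And>w. \<Lambda> w = (\<Sum>i\<in>I. l i (w i))"
    and l_bnd: "\<And>i. i \<in> I \<Longrightarrow> bounded_form sc N (l i)"
    and l_sum: "(\<Sum>i\<in>I. dual_norm N (l i) / \<alpha> i) \<le> 1"
    by (rule p.coordinate_forms[OF I \<alpha> \<Lambda>(1) \<Lambda>_le nonneg conv_norm_le zero]) auto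
  define \<phi> where "\<phi> j = l (Inl j)" for j
  define \<psi> where "\<psi> \<eta> = l (Inr \<eta>)" for \<eta>
  have \<phi>: "bounded_form sc N (\<phi> j)" if "j \<in> R" for j
    using that l_bnd by (simp add: \<phi>_def I_def)
  have \<psi>: "bounded_form sc N (\<psi> \<eta>)" if "\<eta> \<in> E" for \<eta>
    using that l_bnd by (simp add: \<psi>_def I_def)
  have sum_I: "(\<Sum>i\<in>I. F i) = (\<Sum>j\<in>R. F (Inl j)) + (\<Sum>\<eta>\<in>E. F (Inr \<eta>))" for F :: "_ \<Rightarrow> 'z::comm_monoid_add"
  proof -
    have "(\<Sum>i\<in>I. F i) = (\<Sum>i\<in>Inl ` R. F i) + (\<Sum>i\<in>Inr ` E. F i)"
      unfolding I_def by (rule sum.union_disjoint) (use finR E in auto)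
    then show ?thesis by (simp add: sum.reindex)
  qed
  \<comment> \<open>Vanishing on the range of \<open>g\<close>, tested on the vectors \<open>g b\<close> with one entry \<open>b j\<close>,
    expresses the \<open>\<phi> j\<close> by the \<open>\<psi> \<eta>\<close>.\<close>
  have \<phi>_eq: "\<phi> j = (\<lambda>x. \<Sum>\<eta>\<in>E. of_real (\<eta> j) * \<psi> \<eta> x)" if j: "j \<in> R" for j
  proof
    fix x :: 'v
    define b where "b j' = (if j' = j then x else 0)" for j'
    have "?n (g b - g b) = 0" by simp
    then have "\<Lambda> (g b) = 0"
      using \<Lambda>(2)[of "g b"] q_le[of "g b" b] by (metis norm_le_zero_iff order_trans)
    moreover have "(\<Sum>j'\<in>R. \<phi> j' (b j')) = (\<Sum>j'\<in>R. if j' = j then \<phi> j x else 0)"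
      using \<phi> linear_form_0 by (intro sum.cong) (auto simp: b_def bounded_form_def)
    moreover have "\<psi> \<eta> (- (\<Sum>j'\<in>R. sc (of_real (\<eta> j')) (b j'))) = - (of_real (\<eta> j) * \<psi> \<eta> x)" if "\<eta> \<in> E" for \<eta>
    proof -
      have "(\<Sum>j'\<in>R. sc (of_real (\<eta> j')) (b j')) = (\<Sum>j'\<in>R. if j' = j then sc (of_real (\<eta> j)) x else 0)"
        by (intro sum.cong) (auto simp: b_def)
      also have "\<dots> = sc (of_real (\<eta> j)) x" using j finR by simp
      finally have "- (\<Sum>j'\<in>R. sc (of_real (\<eta> j')) (b j')) = sc (- of_real (\<eta> j)) x" by simp
      then show ?thesis using \<psi>[OF that] by (simp add: bounded_form_def linear_form_def del: scale_minus_left)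
    qed
    ultimately show "\<phi> j x = (\<Sum>\<eta>\<in>E. of_real (\<eta> j) * \<psi> \<eta> x)"
      using j finR by (simp add: l sum_I g_def \<phi>_def[symmetric] \<psi>_def[symmetric] sum_negf)
  qed
  define F where "F k = (\<lambda>x. \<Sum>j\<in>R. of_real (H j k) * \<phi> j x)" for k
  have F_le: "norm (F k (h k)) \<le> dual_norm N (F k)" for k
  proof -
    have "\<forall>j\<in>R. \<exists>a. \<forall>x. norm (\<phi> j x) \<le> a * N x"
      using \<phi> by (simp add: bounded_form_def)
    then obtain a where a: "\<And>j x. j \<in> R \<Longrightarrow> norm (\<phi> j x) \<le> a j * N x" by metis
    have "norm (F k x) \<le> (\<Sum>j\<in>R. \<bar>H j k\<bar> * a j) * N x" for x
    proof -
      have "norm (F k x) \<le> (\<Sum>j\<in>R. \<bar>H j k\<bar> * norm (\<phi> j x))"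
        unfolding F_def by (rule order_trans[OF norm_sum]) (simp add: norm_mult)
      also have "\<dots> \<le> (\<Sum>j\<in>R. \<bar>H j k\<bar> * (a j * N x))"
        using a by (intro sum_mono mult_left_mono) auto
      finally show ?thesis by (simp add: sum_distrib_right mult.assoc)
    qed
    then show ?thesis using h by (intro dual_norm_upper) auto
  qed
  have "\<Lambda> f' = (\<Sum>j\<in>R. \<phi> j (f j))"
  proof -
    have "\<psi> \<eta> 0 = 0" if "\<eta> \<in> E" for \<eta>
      using \<psi>[OF that] linear_form_0 by (simp add: bounded_form_def)
    then show ?thesis by (simp add: l sum_I f'_def flip: \<phi>_def \<psi>_def)
  qed
  also have "\<dots> = (\<Sum>j\<in>R. (1 / 2 ^ n) * (\<Sum>k<2^n. of_real (H j k) * \<phi> j (h k)))"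
  proof (intro sum.cong refl)
    fix j assume "j \<in> R"
    then have lin: "linear_form sc (\<phi> j)" using \<phi> by (simp add: bounded_form_def)
    then have scale: "\<phi> j (sc a x) = a * \<phi> j x" for a x by (simp add: linear_form_def)
    show "\<phi> j (f j) = (1 / 2 ^ n) * (\<Sum>k<2^n. of_real (H j k) * \<phi> j (h k))"
      by (simp only: f scale linear_form_sum[OF lin])
  qed
  also have "\<dots> = (1 / 2 ^ n) * (\<Sum>k<2^n. F k (h k))"
    unfolding F_def sum_distrib_left by (rule sum.swap)
  finally have "q f' = norm ((1 / 2 ^ n) * (\<Sum>k<2^n. F k (h k)))"
    using \<Lambda>(3) by simp
  also have "\<dots> = norm (\<Sum>k<2^n. F k (h k)) / 2 ^ n"
    by (simp add: norm_mult norm_divide norm_power)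
  also have "\<dots> \<le> (\<Sum>k<2^n. dual_norm N (F k)) / 2 ^ n"
    using F_le by (intro divide_right_mono sum_norm_le) auto
  also have "\<dots> \<le> c * (d * (\<Sum>j\<in>R. dual_norm N (\<phi> j)) + (\<Sum>\<eta>\<in>E. dual_norm N (\<psi> \<eta>)) / d)"
    unfolding F_def
    using dual[unfolded dual_Hadamard_inequality_def, rule_format, OF H R d E(1), of \<psi> \<phi>] E(2) \<psi> \<phi>_eq
    by blast
  also have "d * (\<Sum>j\<in>R. dual_norm N (\<phi> j)) + (\<Sum>\<eta>\<in>E. dual_norm N (\<psi> \<eta>)) / d
      = (\<Sum>i\<in>I. dual_norm N (l i) / \<alpha> i)"
    by (simp add: sum_I \<alpha>_def \<phi>_def \<psi>_def sum_distrib_left sum_divide_distrib mult.commute)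
  also have "c * \<dots> \<le> c * 1"
    using l_sum c by (intro mult_left_mono)
  finally have "q f' < c + 1" by simp
  then obtain b where b: "?n (f' - g b) < c + 1"
    unfolding q_def by (subst (asm) cINF_less_iff[OF _ bdd]) auto
  show ?thesis
  proof
    fix j assume "j \<in> R"
    then have "\<alpha> (Inl j) * ?p ((f' - g b) (Inl j)) < c + 1"
      using weighted_max_ge[OF I, of "Inl j" \<alpha> ?p "f' - g b"] b by (simp add: I_def)
    then show "?p (f j - b j) \<le> (c + 1) * d"
      using d by (simp add: \<alpha>_def f'_def g_def field_simps)
  next
    fix \<eta> assume "\<eta> \<in> E"
    then have "\<alpha> (Inr \<eta>) * ?p ((f' - g b) (Inr \<eta>)) < c + 1"
      using weighted_max_ge[OF I, of "Inr \<eta>" \<alpha> ?p "f' - g b"] b by (simp add: I_def)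
    then show "?p (\<Sum>j\<in>R. sc (of_real (\<eta> j)) (b j)) \<le> (c + 1) / d"
      using d by (simp add: \<alpha>_def f'_def g_def field_simps)
  qed
qed

end

section \<open>Cotype and sums in quasi-normed spaces\<close>

lemma finite_sign_cube: "finite (sign_cube n)" and sign_cube_nonempty: "sign_cube n \<noteq> {}"
  by (auto simp: sign_cube_def finite_PiE PiE_eq_empty_iff)

lemma sign_cubeD: "\<eta> \<in> sign_cube n \<Longrightarrow> i \<in> {1..n} \<Longrightarrow> \<bar>\<eta> i\<bar> = 1"
  by (auto simp: sign_cube_def PiE_def Pi_def)

definition cotype_const ::
    "real \<Rightarrow> ('k::real_normed_field \<Rightarrow> 'v::ab_group_add \<Rightarrow> 'v) \<Rightarrow> ('v \<Rightarrow> real) \<Rightarrow> real \<Rightarrow> bool" where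
  "cotype_const q sc N C \<longleftrightarrow>
     (\<forall>n. \<forall>y :: nat \<Rightarrow> 'v. (\<Sum>i=1..n. N (y i) powr q) powr (1 / q)
        \<le> C * (\<integral>t. N (\<Sum>i=1..n. sc (of_real (t i)) (y i)) powr q
                  \<partial>uniform_count_measure (sign_cube n)) powr (1 / q))"

text \<open>
  Cotype bounds the \<open>q\<close>-th powers in the mean, hence also the smallest of them.
\<close>

lemma (in quasi_seminorm) cotype_small_term:
  fixes y :: "nat \<Rightarrow> 'v"
  assumes C: "cotype_const q sc N C" "0 \<le> C" and q: "0 < q" and n: "1 \<le> n"
    and B: "\<And>\<eta>. \<eta> \<in> sign_cube n \<Longrightarrow> N (\<Sum>i=1..n. sc (of_real (\<eta> i)) (y i)) \<le> B" "0 \<le> B"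
  obtains i where "i \<in> {1..n}" "N (y i) \<le> C * B * real n powr (- (1 / q))"
proof -
  let ?avg = "\<integral>t. N (\<Sum>i=1..n. sc (of_real (t i)) (y i)) powr q \<partial>uniform_count_measure (sign_cube n)"
  have card: "card (sign_cube n) > 0"
    using finite_sign_cube sign_cube_nonempty by (simp add: card_gt_0_iff)
  have "?avg = (\<Sum>t\<in>sign_cube n. N (\<Sum>i=1..n. sc (of_real (t i)) (y i)) powr q) / card (sign_cube n)"
    by (rule integral_uniform_count_measure[OF finite_sign_cube])
  also have "\<dots> \<le> (\<Sum>t\<in>sign_cube n. B powr q) / card (sign_cube n)"
    using B q by (intro divide_right_mono sum_mono powr_mono2) auto
  also have "\<dots> = B powr q" using card by simp
  finally have avg: "?avg \<le> B powr q" .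
  have "0 \<le> ?avg" by (intro integral_nonneg_AE) auto
  then have "?avg powr (1 / q) \<le> (B powr q) powr (1 / q)"
    using avg q by (intro powr_mono2) auto
  also have "\<dots> = B" using B(2) q by (simp add: powr_powr)
  finally have "C * ?avg powr (1 / q) \<le> C * B" using C(2) by (intro mult_left_mono)
  then have sum_le: "(\<Sum>i=1..n. N (y i) powr q) powr (1 / q) \<le> C * B"
    using C(1)[unfolded cotype_const_def, rule_format, of y n] by linarith
  obtain i where i: "i \<in> {1..n}" and min: "\<And>j. j \<in> {1..n} \<Longrightarrow> N (y i) \<le> N (y j)"
  proof -
    have "finite ((\<lambda>i. N (y i)) ` {1..n})" "(\<lambda>i. N (y i)) ` {1..n} \<noteq> {}" using n by auto
    from Min_in[OF this] obtain i where "i \<in> {1..n}" "N (y i) = Min ((\<lambda>i. N (y i)) ` {1..n})"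
      by auto
    then show ?thesis using that by auto
  qed
  have "real n * N (y i) powr q \<le> (\<Sum>j=1..n. N (y j) powr q)"
  proof -
    have "(\<Sum>j=1..n. N (y i) powr q) \<le> (\<Sum>j=1..n. N (y j) powr q)"
      using min q by (intro sum_mono powr_mono2) auto
    then show ?thesis by simp
  qed
  then have "(real n * N (y i) powr q) powr (1 / q) \<le> (\<Sum>j=1..n. N (y j) powr q) powr (1 / q)"
    using q by (intro powr_mono2) auto
  also have "(real n * N (y i) powr q) powr (1 / q) = real n powr (1 / q) * N (y i)"
    using q by (simp add: powr_mult powr_powr)
  finally have "real n powr (1 / q) * N (y i) \<le> C * B" using sum_le by simp
  then have "N (y i) \<le> C * B * real n powr (- (1 / q))"
    using n by (simp add: powr_minus field_simps)
  then show ?thesis using i that by blast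
qed

text \<open>
  A quasi-norm loses a factor \<open>K\<close> with every addition, which may exceed the gain \<open>1 / \<rho>\<close> of one
  step. Adding blocks of \<open>s\<close> terms instead, the loss is still \<open>K\<close> per block whereas the gain is
  \<open>1 / \<rho> ^ s\<close>.
\<close>

lemma (in quasi_seminorm) geometric_sum_bounded:
  assumes \<rho>: "0 < \<rho>" "\<rho> < 1"
  obtains G where "0 \<le> G"
    "\<And>n e B. 0 \<le> B \<Longrightarrow> (\<And>i. i < n \<Longrightarrow> N (e i) \<le> B * \<rho> ^ i) \<Longrightarrow> N (\<Sum>i<n. e i) \<le> G * B"
proof -
  \<comment> \<open>Over blocks of \<open>s\<close> terms the decay beats the constant of the quasi-triangle inequality.\<close>
  have "(\<lambda>s. K * \<rho> ^ s) \<longlonglongrightarrow> K * 0"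
    using \<rho> by (intro tendsto_intros LIMSEQ_power_zero) auto
  then have "\<forall>\<^sub>F s in sequentially. K * \<rho> ^ s < 1 / 2"
    by (intro order_tendstoD(2)) auto
  then obtain s0 where s0: "\<And>s. s \<ge> s0 \<Longrightarrow> K * \<rho> ^ s < 1 / 2"
    by (auto simp: eventually_sequentially)
  define s where "s = Suc s0"
  have s: "K * \<rho> ^ s \<le> 1 / 2" "0 < s" using s0[of s] by (auto simp: s_def)
  define A where "A = K ^ s * s"
  have A: "0 \<le> A" using K_ge_1 by (simp add: A_def)
  have short: "N (\<Sum>i<n. e i) \<le> A * B"
    if "0 \<le> B" "\<And>i. i < n \<Longrightarrow> N (e i) \<le> B * \<rho> ^ i" "n \<le> s" for n e B
  proof -
    have "N (\<Sum>i<n. e i) \<le> K ^ n * (\<Sum>i<n. N (e i))"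
      using sum_le[of "{..<n}" e] by simp
    also have "(\<Sum>i<n. N (e i)) \<le> (\<Sum>i<n. B)"
    proof (rule sum_mono)
      fix i assume "i \<in> {..<n}"
      moreover have "B * \<rho> ^ i \<le> B * 1"
        using that(1) \<rho> by (intro mult_left_mono power_le_one) auto
      ultimately show "N (e i) \<le> B" using that(2)[of i] by simp
    qed
    also have "K ^ n * (\<Sum>i<n. B) \<le> K ^ s * (s * B)"
      using that K_ge_1 by (auto intro!: mult_mono power_increasing)
    finally show ?thesis using K_ge_1 by (simp add: A_def mult.assoc mult_left_mono)
  qed
  define G where "G = 2 * K * A"
  have G: "0 \<le> G" using A K_ge_1 by (simp add: G_def)
  have "N (\<Sum>i<n. e i) \<le> G * B"
    if "0 \<le> B" "\<And>i. i < n \<Longrightarrow> N (e i) \<le> B * \<rho> ^ i" for n e B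
    using that
  proof (induction n arbitrary: e B rule: less_induct)
    case (less n)
    show ?case
    proof (cases "n \<le> s")
      case True
      have "A * 1 \<le> A * (2 * K)" using A K_ge_1 by (intro mult_left_mono) auto
      then have "A * B \<le> G * B" using less.prems(1) by (intro mult_right_mono) (auto simp: G_def mult_ac)
      then show ?thesis using short[OF less.prems True] by simp
    next
      case False
      define m where "m = n - s"
      have n: "n = s + m" using False by (simp add: m_def)
      have tail: "N (\<Sum>i<m. e (s + i)) \<le> G * (B * \<rho> ^ s)"
      proof (rule less.IH)
        show "m < n" using s n by simp
        show "0 \<le> B * \<rho> ^ s" using less.prems(1) \<rho> by simp
        show "N (e (s + i)) \<le> B * \<rho> ^ s * \<rho> ^ i" if "i < m" for i
          using less.prems(2)[of "s + i"] that n by (simp add: power_add mult.assoc)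
      qed
      have "(\<Sum>i<n. e i) = (\<Sum>i<s. e i) + (\<Sum>i<m. e (s + i))"
      proof -
        have "(\<Sum>i<n. e i) = sum e {0..<s} + sum e {s..<s + m}"
          by (simp add: n lessThan_atLeast0 sum.atLeastLessThan_concat)
        also have "sum e {s..<s + m} = (\<Sum>i<m. e (s + i))"
          using sum.shift_bounds_nat_ivl[of e 0 s m] by (simp add: add.commute lessThan_atLeast0)
        finally show ?thesis by (simp add: lessThan_atLeast0)
      qed
      then have "N (\<Sum>i<n. e i) \<le> K * (N (\<Sum>i<s. e i) + N (\<Sum>i<m. e (s + i)))"
        using quasi_triangle by simp
      also have "\<dots> \<le> K * (A * B + G * (B * \<rho> ^ s))"
        using K_ge_1 tail less.prems n by (intro mult_left_mono add_mono short) auto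
      also have "\<dots> = G * B / 2 + G * B * (K * \<rho> ^ s)"
        by (simp add: G_def algebra_simps)
      also have "\<dots> \<le> G * B / 2 + G * B * (1 / 2)"
        using s(1) G less.prems(1) by (intro add_left_mono mult_left_mono) auto
      finally show ?thesis by (simp add: mult.commute)
    qed
  qed
  with G that show ?thesis by blast
qed

text \<open>
  A crude bound, growing quickly with \<open>m\<close>; it will be used for one fixed \<open>m\<close>.
\<close>

lemma (in quasi_seminorm) dyadic_averages_bound:
  assumes Y: "quasi_seminorm sY NY L" and u: "Vector_Spaces.linear sc sY u"
    and U: "\<And>x. NY (u x) \<le> U * N x" "0 \<le> U" and z: "z \<in> dyadic_averages sc N m"
  shows "NY (u z) \<le> L ^ (2 ^ m) * U"
proof -
  interpret Y: quasi_seminorm sY NY L by fact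
  interpret u: Vector_Spaces.linear sc sY u by fact
  obtain h :: "nat \<Rightarrow> 'v" where h: "\<And>k. N (h k) \<le> 1" and z: "z = sc (1 / 2 ^ m) (\<Sum>k<2^m. h k)"
    using z by (auto simp: dyadic_averages_def)
  have "NY (u z) = NY (\<Sum>k<2^m. u (h k)) / 2 ^ m"
    by (simp add: z u.scale u.sum Y.scaled norm_divide norm_power)
  also have "\<dots> \<le> (L ^ (2 ^ m) * (\<Sum>k<(2::nat)^m. U)) / 2 ^ m"
  proof (rule divide_right_mono)
    have "NY (u (h k)) \<le> U" for k
      using U(1)[of "h k"] mult_left_mono[OF h[of k] U(2)] by simp
    then have "L ^ (2 ^ m) * (\<Sum>k<2^m. NY (u (h k))) \<le> L ^ (2 ^ m) * (\<Sum>k<(2::nat)^m. U)"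
      using Y.K_ge_1 by (intro mult_left_mono sum_mono) auto
    then show "NY (\<Sum>k<2^m. u (h k)) \<le> L ^ (2 ^ m) * (\<Sum>k<(2::nat)^m. U)"
      using Y.sum_le[of "{..<2^m}" "\<lambda>k. u (h k)"] by simp
  qed simp
  finally show ?thesis by simp
qed

section \<open>The a priori bound: halving averages\<close>

locale cotype_pair =
  X: quasi_seminorm sX NX KX + Y: quasi_seminorm sY NY KY
  for sX :: "'k::{real_normed_field,euclidean_space} \<Rightarrow> 'x::ab_group_add \<Rightarrow> 'x" and NX KX
    and sY :: "'k \<Rightarrow> 'y::ab_group_add \<Rightarrow> 'y" and NY KY +
  fixes c q C :: real
  assumes dual: "dual_Hadamard_inequality sX NX c" and c: "0 \<le> c"
    and q: "1 \<le> q" and cotype: "cotype_const q sY NY C" and C: "0 \<le> C"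
begin

text \<open>
  The rate \<open>2 ^ (- 1 / (2 * q))\<close> balances the two parts of a signed average: truncating at the
  height \<open>d\<close> leaves errors proportional to \<open>d\<close> and to \<open>2 ^ (- n / q) / d\<close>.
\<close>

definition decay :: real where "decay = 2 powr (- 1 / (2 * q))"

definition halving_const :: real where "halving_const = KY * (c + 1) * (1 + 2 * C)"

lemma decay_bounds: "0 < decay" "decay < 1"
  using q by (auto simp: decay_def powr_less_one)

lemma halving_const_nonneg: "0 \<le> halving_const"
  using Y.K_ge_1 c C by (simp add: halving_const_def)

text \<open>
  The first part of the splitting is estimated by \<open>D\<close>, the second one by cotype.
\<close>

lemma signed_average_small:
  assumes H: "Hadamard n H" and n: "1 \<le> n"
    and u: "Vector_Spaces.linear sX sY u" and D: "\<And>x. NY (u x) \<le> D * conv_norm NX x" "0 \<le> D"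
    and h: "\<And>k. NX (h k) \<le> 1"
  obtains j where "1 \<le> j" "j < 2 ^ n"
    "NY (u (sX (1 / 2 ^ n) (\<Sum>k<2^n. sX (of_real (H j k)) (h k)))) \<le> halving_const * decay ^ n * D"
proof -
  interpret u: Vector_Spaces.linear sX sY u by fact
  define m :: nat where "m = 2 ^ n - 1"
  have "(2::nat) ^ 1 \<le> 2 ^ n" using n by (intro power_increasing) auto
  then have m: "1 \<le> m" "m + 1 = 2 ^ n" by (auto simp: m_def)
  have R: "{1..m} \<subseteq> {..<2^n}" using m by auto
  define f where "f j = sX (1 / 2 ^ n) (\<Sum>k<2^n. sX (of_real (H j k)) (h k))" for j
  define d where "d = decay ^ n"
  have d: "0 < d" using decay_bounds by (simp add: d_def)
  obtain b where b: "\<And>j. j \<in> {1..m} \<Longrightarrow> conv_norm NX (f j - b j) \<le> (c + 1) * d"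
    "\<And>\<eta>. \<eta> \<in> sign_cube m \<Longrightarrow> conv_norm NX (\<Sum>j=1..m. sX (of_real (\<eta> j)) (b j)) \<le> (c + 1) / d"
    by (rule X.signed_averages_split[OF dual c H R d finite_sign_cube[of m] _ h f_def])
      (auto simp: sign_cubeD)
  define B where "B = D * ((c + 1) / d)"
  have B: "0 \<le> B" using D(2) c d by (simp add: B_def)
  have "NY (\<Sum>j=1..m. sY (of_real (\<eta> j)) (u (b j))) \<le> B" if "\<eta> \<in> sign_cube m" for \<eta>
  proof -
    have "(\<Sum>j=1..m. sY (of_real (\<eta> j)) (u (b j))) = u (\<Sum>j=1..m. sX (of_real (\<eta> j)) (b j))"
      by (simp add: u.sum u.scale)
    then show ?thesis
      using D(1)[of "\<Sum>j=1..m. sX (of_real (\<eta> j)) (b j)"] mult_left_mono[OF b(2)[OF that] D(2)]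
      by (simp add: B_def)
  qed
  then obtain j where j: "j \<in> {1..m}" "NY (u (b j)) \<le> C * B * real m powr (- (1 / q))"
    using Y.cotype_small_term[OF cotype C _ m(1) _ B] q by force
  \<comment> \<open>The first row is left out, so only \<open>m = 2 ^ n - 1\<close> rows remain; as \<open>2 * m \<ge> 2 ^ n\<close>, this
    costs at most a factor 2.\<close>
  have powr_m: "real m powr (- (1 / q)) \<le> 2 * d * d"
  proof -
    have "(2::nat) ^ n \<le> 2 * m" using m by linarith
    then have "real (2 ^ n) \<le> real (2 * m)" by (simp only: of_nat_le_iff)
    then have "2 powr real n / 2 \<le> real m" by (simp add: powr_realpow)
    then have "real m powr (- (1 / q)) \<le> (2 powr real n / 2) powr (- (1 / q))"
      using q by (intro powr_mono2') auto
    also have "\<dots> = 2 powr (1 / q) * (2 powr real n) powr (- (1 / q))"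
      by (simp add: powr_divide powr_minus field_simps)
    also have "(2 powr real n) powr (- (1 / q)) = decay powr real n * decay powr real n"
      using q by (simp add: decay_def powr_powr powr_add[symmetric] field_simps)
    also have "decay powr real n = d" using decay_bounds by (simp add: d_def powr_realpow)
    also have "2 powr (1 / q) * (d * d) \<le> 2 powr 1 * (d * d)"
      using q d by (intro mult_right_mono powr_mono) auto
    finally show ?thesis by simp
  qed
  have "C * B * real m powr (- (1 / q)) \<le> C * B * (2 * d * d)"
    using C B powr_m by (intro mult_left_mono) auto
  also have "\<dots> = 2 * C * (c + 1) * d * D" using d by (simp add: B_def)
  finally have b_small: "NY (u (b j)) \<le> 2 * C * (c + 1) * d * D" using j(2) by simp
  have "NY (u (f j - b j)) \<le> D * ((c + 1) * d)"
    using D(1)[of "f j - b j"] mult_left_mono[OF b(1)[OF j(1)] D(2)] by simp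
  moreover have "NY (u (f j)) \<le> KY * (NY (u (f j - b j)) + NY (u (b j)))"
    using Y.quasi_triangle[of "u (f j - b j)" "u (b j)"] by (simp add: u.diff)
  ultimately have "NY (u (f j)) \<le> KY * (D * ((c + 1) * d) + 2 * C * (c + 1) * d * D)"
    using b_small Y.K_ge_1 by (meson add_mono mult_left_mono order_trans zero_le_one)
  also have "\<dots> = halving_const * decay ^ n * D" by (simp add: halving_const_def d_def algebra_simps)
  finally show ?thesis
    using that[of j] j(1) m by (simp add: f_def)
qed

text \<open>
  The row \<open>j\<close> of the Hadamard matrix is orthogonal to the constant row, so exactly half of its
  entries are \<open>-1\<close>. The average over this half is \<open>z - f j\<close>.
\<close>

lemma halving:
  assumes u: "Vector_Spaces.linear sX sY u" and D: "\<And>x. NY (u x) \<le> D * conv_norm NX x" "0 \<le> D"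
    and z: "z \<in> dyadic_averages sX NX (Suc n)"
  obtains z' where "z' \<in> dyadic_averages sX NX n" "NY (u (z - z')) \<le> halving_const * decay ^ Suc n * D"
proof -
  obtain h :: "nat \<Rightarrow> 'x" where h: "\<And>k. NX (h k) \<le> 1" and z_eq: "z = sX (1 / 2 ^ Suc n) (\<Sum>k<2^Suc n. h k)"
    using z by (auto simp: dyadic_averages_def)
  obtain H where H: "Hadamard (Suc n) H" using exists_Hadamard by blast
  define f where "f j = sX (1 / 2 ^ Suc n) (\<Sum>k<2^Suc n. sX (of_real (H j k)) (h k))" for j
  obtain j where j: "1 \<le> j" "j < 2 ^ Suc n" "NY (u (f j)) \<le> halving_const * decay ^ Suc n * D"
    unfolding f_def by (rule signed_average_small[OF H _ u D h]) simp_all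
  have Hj: "H j k \<in> {-1, 1}" for k using H by (simp add: Hadamard_def)
  define S where "S = {k. k < 2 ^ Suc n \<and> H j k = -1}"
  have S: "finite S" "S \<subseteq> {..<2^Suc n}" by (auto simp: S_def)
  have not_S: "H j k = 1" if "k \<in> {..<2^Suc n} - S" for k
    using that Hj[of k] by (auto simp: S_def)
  have sum_S: "sX (of_real 2) (\<Sum>k\<in>S. h k) = (\<Sum>k<2^Suc n. h k) - (\<Sum>k<2^Suc n. sX (of_real (H j k)) (h k))"
  proof -
    have "sX (of_real 2) (\<Sum>k\<in>S. h k) = (\<Sum>k\<in>S. h k - sX (of_real (H j k)) (h k))"
      unfolding X.scale_sum_right
    proof (rule sum.cong)
      fix k assume "k \<in> S"
      then have "H j k = -1" by (simp add: S_def)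
      moreover have "sX (of_real 2) (h k) = sX 1 (h k) + sX 1 (h k)"
        unfolding X.scale_left_distrib[symmetric] by simp
      ultimately show "sX (of_real 2) (h k) = h k - sX (of_real (H j k)) (h k)" by simp
    qed simp
    also have "\<dots> = (\<Sum>k<2^Suc n. h k - sX (of_real (H j k)) (h k))"
      using S not_S by (intro sum.mono_neutral_left) auto
    finally show ?thesis by (simp add: sum_subtractf)
  qed
  have card_S: "card S = 2 ^ n"
  proof -
    have "(\<Sum>k<2^Suc n. H 0 k * H j k) = (if 0 = j then 2 ^ Suc n else 0)"
      by (rule H[unfolded Hadamard_def, THEN conjunct2, THEN conjunct2, rule_format])
        (use j(2) in simp_all)
    moreover have "H 0 k = 1" for k using H by (simp add: Hadamard_def)
    ultimately have "(\<Sum>k<2^Suc n. H j k) = 0" using j(1) by simp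
    moreover have "(\<Sum>k<2^Suc n. 1 - H j k) = (\<Sum>k\<in>S. 1 - H j k)"
      by (rule sum.mono_neutral_right) (use S not_S in auto)
    moreover have "(\<Sum>k\<in>S. 1 - H j k) = (\<Sum>k\<in>S. 2)"
      by (rule sum.cong) (simp_all add: S_def)
    ultimately have "2 * real (card S) = 2 * 2 ^ n"
      by (simp add: sum_subtractf)
    then have "real (card S) = real (2 ^ n)" by simp
    then show ?thesis by (simp only: of_nat_eq_iff)
  qed
  have "\<exists>e. bij_betw e {..<(2::nat)^n} S"
    by (rule finite_same_card_bij) (simp_all add: S card_S)
  then obtain e where e: "bij_betw e {..<(2::nat)^n} S" ..
  define z' where "z' = sX (1 / 2 ^ n) (\<Sum>k<2^n. h (e k))"
  have "z' \<in> dyadic_averages sX NX n"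
    unfolding dyadic_averages_def z'_def mem_Collect_eq
    by (rule exI[of _ "\<lambda>k. h (e k)"]) (simp add: h)
  moreover have "z - z' = f j"
  proof -
    have "(\<Sum>k<2^n. h (e k)) = (\<Sum>k\<in>S. h k)"
      by (rule sum.reindex_bij_betw[OF e])
    then have "z' = sX (1 / 2 ^ Suc n) (sX (of_real 2) (\<Sum>k\<in>S. h k))"
      by (simp add: z'_def)
    then show ?thesis
      unfolding sum_S by (simp add: z_eq f_def X.scale_right_diff_distrib)
  qed
  ultimately show ?thesis using that j(3) by simp
qed

lemma iterated_halving:
  assumes u: "Vector_Spaces.linear sX sY u" and D: "\<And>x. NY (u x) \<le> D * conv_norm NX x" "0 \<le> D"
    and z: "z \<in> dyadic_averages sX NX (m + i)"
  obtains z' e where "z' \<in> dyadic_averages sX NX m" "u z = u z' + (\<Sum>l<i. e l)"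
    "\<And>l. l < i \<Longrightarrow> NY (e l) \<le> halving_const * decay ^ m * D * decay ^ l"
  using z
proof (induction i arbitrary: z thesis)
  case 0
  show ?case by (rule 0(1)[of z "\<lambda>_. 0"]) (use 0 in auto)
next
  case (Suc i)
  interpret u: Vector_Spaces.linear sX sY u by fact
  obtain y where y: "y \<in> dyadic_averages sX NX (m + i)" "NY (u (z - y)) \<le> halving_const * decay ^ Suc (m + i) * D"
    using halving[OF u D] Suc.prems(2) by auto
  obtain z' e where IH: "z' \<in> dyadic_averages sX NX m" "u y = u z' + (\<Sum>l<i. e l)"
    "\<And>l. l < i \<Longrightarrow> NY (e l) \<le> halving_const * decay ^ m * D * decay ^ l"
    using Suc.IH[OF _ y(1)] by blast
  have last: "NY (u (z - y)) \<le> halving_const * decay ^ m * D * decay ^ i"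
  proof -
    have "decay ^ Suc (m + i) \<le> decay ^ (m + i)" using decay_bounds by (intro power_decreasing) auto
    then have "halving_const * decay ^ Suc (m + i) * D \<le> halving_const * decay ^ (m + i) * D"
      using halving_const_nonneg D(2) by (intro mult_right_mono mult_left_mono) auto
    then show ?thesis using y(2) by (simp add: power_add mult_ac)
  qed
  show ?case
  proof (rule Suc.prems(1)[OF IH(1)])
    show "u z = u z' + (\<Sum>l<Suc i. (e(i := u (z - y))) l)"
      using IH(2) by (simp add: u.diff algebra_simps)
    show "NY ((e(i := u (z - y))) l) \<le> halving_const * decay ^ m * D * decay ^ l" if "l < Suc i" for l
      using that IH(3) last by (auto simp: less_Suc_eq)
  qed
qed

text \<open>
  The number \<open>m\<close> at which halving stops depends only on the constants of the locale. It is
  chosen such that the accumulated error, multiplied by the factors lost on the way, is at most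
  \<open>D / 2\<close>.
\<close>

theorem convex_bound_improves:
  obtains B where "0 \<le> B"
    "\<And>u U D x. Vector_Spaces.linear sX sY u \<Longrightarrow> (\<And>x. NY (u x) \<le> U * NX x) \<Longrightarrow> 0 \<le> U \<Longrightarrow>
       (\<And>x. NY (u x) \<le> D * conv_norm NX x) \<Longrightarrow> 0 \<le> D \<Longrightarrow>
       NY (u x) \<le> (B * U + D / 2) * conv_norm NX x"
proof -
  obtain G where G: "0 \<le> G"
    "\<And>n e B. 0 \<le> B \<Longrightarrow> (\<And>i. i < n \<Longrightarrow> NY (e i) \<le> B * decay ^ i) \<Longrightarrow> NY (\<Sum>i<n. e i) \<le> G * B"
    using Y.geometric_sum_bounded[OF decay_bounds] by metis
  have "(\<lambda>m. 2 * KY * G * halving_const * decay ^ m) \<longlonglongrightarrow> 2 * KY * G * halving_const * 0"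
    using decay_bounds by (intro tendsto_intros LIMSEQ_power_zero) auto
  then have "\<forall>\<^sub>F m in sequentially. 2 * KY * G * halving_const * decay ^ m < 1 / 2"
    by (intro order_tendstoD(2)) auto
  then obtain m where m: "2 * KY * G * halving_const * decay ^ m < 1 / 2"
    by (auto simp: eventually_sequentially)
  define B where "B = 2 * KY * KY ^ (2 ^ m)"
  show ?thesis
  proof
    show "0 \<le> B" using Y.K_ge_1 by (simp add: B_def)
    fix u U D x
    assume u: "Vector_Spaces.linear sX sY u" and U: "\<And>x. NY (u x) \<le> U * NX x" "0 \<le> U"
      and D: "\<And>x. NY (u x) \<le> D * conv_norm NX x" "0 \<le> D"
    interpret u: Vector_Spaces.linear sX sY u by fact
    interpret p: seminorm sX "conv_norm NX" by (rule X.seminorm_conv_norm)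
    have unit: "NY (u x) \<le> B * U + D / 2" if "conv_norm NX x < 1" for x
    proof -
      obtain n z where n: "m \<le> n" and z: "z \<in> dyadic_averages sX NX n" and x: "x = sX 2 z"
        using X.exists_dyadic_average[OF \<open>conv_norm NX x < 1\<close>] by blast
      obtain z' e where z': "z' \<in> dyadic_averages sX NX m" "u z = u z' + (\<Sum>l<n - m. e l)"
        "\<And>l. l < n - m \<Longrightarrow> NY (e l) \<le> halving_const * decay ^ m * D * decay ^ l"
        using iterated_halving[OF u D, of z m "n - m"] z n by auto
      have "NY (\<Sum>l<n - m. e l) \<le> G * (halving_const * decay ^ m * D)"
        by (rule G(2)) (use z'(3) halving_const_nonneg decay_bounds D(2) in auto)
      moreover have "NY (u z') \<le> KY ^ (2 ^ m) * U"
        by (rule X.dyadic_averages_bound[OF Y.quasi_seminorm_axioms u U z'(1)])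
      ultimately have "NY (u z) \<le> KY * (KY ^ (2 ^ m) * U + G * (halving_const * decay ^ m * D))"
        unfolding z'(2) using Y.K_ge_1
        by (meson Y.quasi_triangle add_mono mult_left_mono order_trans zero_le_one)
      then have "NY (u x) \<le> 2 * (KY * (KY ^ (2 ^ m) * U + G * (halving_const * decay ^ m * D)))"
        by (simp add: x u.scale Y.scaled)
      also have "\<dots> = B * U + (2 * KY * G * halving_const * decay ^ m) * D"
        by (simp add: B_def algebra_simps)
      also have "\<dots> \<le> B * U + 1 / 2 * D"
        using m D(2) by (intro add_left_mono mult_right_mono) auto
      finally show ?thesis by simp
    qed
    have "NY (u x) \<le> t * (B * U + D / 2)" if t: "conv_norm NX x < t" for t
    proof -
      have "0 < t" using t X.conv_norm_nonneg[of x] by linarith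
      then have "NY (u (sX (of_real (1 / t)) x)) \<le> B * U + D / 2"
        using t by (intro unit) (simp add: p.scaled norm_divide)
      then show ?thesis
        using \<open>0 < t\<close> by (simp add: u.scale Y.scaled norm_divide field_simps)
    qed
    then have "\<And>t. conv_norm NX x < t \<Longrightarrow> NY (u x) \<le> t * (B * U + D / 2)" .
    moreover have "((\<lambda>t. t * (B * U + D / 2)) \<longlongrightarrow> conv_norm NX x * (B * U + D / 2)) (at_right (conv_norm NX x))"
      by (intro tendsto_intros)
    ultimately have "NY (u x) \<le> conv_norm NX x * (B * U + D / 2)"
      by (intro tendsto_lowerbound[of "\<lambda>t. t * (B * U + D / 2)" _ "at_right (conv_norm NX x)"])
        (auto simp: eventually_at_right_less eventually_at_filter)
    then show "NY (u x) \<le> (B * U + D / 2) * conv_norm NX x" by (simp add: mult.commute)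
  qed
qed

text \<open>
  The least admissible \<open>D\<close> satisfies \<open>D \<le> B * U + D / 2\<close>. By hypothesis the set of the
  admissible \<open>D\<close> is nonempty, so that this bounds its infimum.
\<close>

theorem convex_bound:
  obtains B where "0 \<le> B"
    "\<And>u U D x. Vector_Spaces.linear sX sY u \<Longrightarrow> (\<And>x. NY (u x) \<le> U * NX x) \<Longrightarrow> 0 \<le> U \<Longrightarrow>
       (\<And>x. NY (u x) \<le> D * conv_norm NX x) \<Longrightarrow>
       NY (u x) \<le> B * U * conv_norm NX x"
proof -
  obtain B where B: "0 \<le> B"
    "\<And>u U D x. Vector_Spaces.linear sX sY u \<Longrightarrow> (\<And>x. NY (u x) \<le> U * NX x) \<Longrightarrow> 0 \<le> U \<Longrightarrow>
       (\<And>x. NY (u x) \<le> D * conv_norm NX x) \<Longrightarrow> 0 \<le> D \<Longrightarrow>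
       NY (u x) \<le> (B * U + D / 2) * conv_norm NX x"
    using convex_bound_improves by blast
  show ?thesis
  proof
    show "0 \<le> 2 * B" using B by simp
    fix u U D' x
    assume u: "Vector_Spaces.linear sX sY u" and U: "\<And>x. NY (u x) \<le> U * NX x" "0 \<le> U"
      and D': "\<And>x. NY (u x) \<le> D' * conv_norm NX x"
    define S where "S = {D. 0 \<le> D \<and> (\<forall>x. NY (u x) \<le> D * conv_norm NX x)}"
    have "NY (u x) \<le> \<bar>D'\<bar> * conv_norm NX x" for x
      using D'[of x] X.conv_norm_nonneg[of x] by (meson abs_ge_self mult_right_mono order_trans)
    then have "\<bar>D'\<bar> \<in> S" by (simp add: S_def)
    then have ne: "S \<noteq> {}" by blast
    have bdd: "bdd_below S" by (rule bdd_belowI[of _ 0]) (auto simp: S_def)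
    have step: "B * U + D / 2 \<in> S" if "D \<in> S" for D
      using that B(1) B(2)[OF u U, of D] U(2) by (auto simp: S_def)
    \<comment> \<open>Every admissible \<open>D\<close> leads to the admissible \<open>B * U + D / 2\<close>, which \<open>Inf S\<close> does not
      exceed.\<close>
    have "2 * (Inf S - B * U) \<le> Inf S"
    proof (rule cInf_greatest[OF ne])
      fix D assume "D \<in> S"
      then have "Inf S \<le> B * U + D / 2" by (intro cInf_lower[OF _ bdd] step)
      then show "2 * (Inf S - B * U) \<le> D" by simp
    qed
    then have Inf: "Inf S \<le> 2 * B * U" by simp
    show "NY (u x) \<le> 2 * B * U * conv_norm NX x"
    proof (cases "conv_norm NX x = 0")
      case True
      then show ?thesis using D'[of x] by simp
    next
      case False
      then have pos: "0 < conv_norm NX x" using X.conv_norm_nonneg[of x] by simp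
      have "NY (u x) / conv_norm NX x \<le> Inf S"
        by (rule cInf_greatest[OF ne]) (use pos in \<open>auto simp: S_def field_simps\<close>)
      then have "NY (u x) / conv_norm NX x \<le> 2 * B * U" using Inf by simp
      then show ?thesis using pos by (simp add: field_simps)
    qed
  qed
qed

end

section \<open>Passing from carriers to whole types\<close>

text \<open>
  A linear map onto the carrier need not be bounded; it serves only to extend the quasi-norm and
  the operators to the whole type.
\<close>

definition carrier_projection ::
    "('k::{real_normed_field,euclidean_space}, 'a::ab_group_add) qspace \<Rightarrow> ('a \<Rightarrow> 'a) \<Rightarrow> bool" where
  "carrier_projection V \<pi> \<longleftrightarrow> Vector_Spaces.linear (smul V) (smul V) \<pi> \<and>
     (\<forall>x. \<pi> x \<in> carrier V) \<and> (\<forall>x\<in>carrier V. \<pi> x = x)"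

lemma exists_carrier_projection:
  assumes "quasi_normed V"
  obtains \<pi> where "carrier_projection V \<pi>"
proof -
  interpret vector_space "smul V" using assms by (simp add: quasi_normed_def)
  interpret vector_space_pair "smul V" "smul V" ..
  have "Vector_Spaces.linear (smul V) (smul V) id" by (rule linear_id)
  then have "\<exists>g. g ` UNIV \<subseteq> carrier V \<and> Vector_Spaces.linear (smul V) (smul V) g \<and>
      (\<forall>v\<in>carrier V. g (id v) = v)"
    by (rule linear_exists_left_inverse_on) (use assms in \<open>auto simp: quasi_normed_def\<close>)
  then show ?thesis using that by (fastforce simp: carrier_projection_def)
qed

lemma quasi_seminorm_projection:
  assumes V: "quasi_normed V" and \<pi>: "carrier_projection V \<pi>"
  obtains K where "quasi_seminorm (smul V) (\<lambda>x. qnorm V (\<pi> x)) K"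
proof -
  have vs: "vector_space (smul V)" using V by (simp add: quasi_normed_def)
  interpret \<pi>: Vector_Spaces.linear "smul V" "smul V" \<pi> using \<pi> by (simp add: carrier_projection_def)
  have c: "\<pi> x \<in> carrier V" for x
    using \<pi> by (simp add: carrier_projection_def)
  have n0: "0 \<le> qnorm V x" and s: "qnorm V (smul V a x) = norm a * qnorm V x" if "x \<in> carrier V" for x a
    using V that by (auto simp: quasi_normed_def)
  have "\<exists>K. \<forall>x\<in>carrier V. \<forall>y\<in>carrier V. qnorm V (x + y) \<le> K * (qnorm V x + qnorm V y)"
    using V by (simp add: quasi_normed_def)
  then obtain K where K: "\<forall>x\<in>carrier V. \<forall>y\<in>carrier V. qnorm V (x + y) \<le> K * (qnorm V x + qnorm V y)" ..
  have "quasi_seminorm (smul V) (\<lambda>x. qnorm V (\<pi> x)) (max 1 K)"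
  proof (intro quasi_seminorm.intro quasi_seminorm_axioms.intro vs)
    fix x y
    have "K * (qnorm V (\<pi> x) + qnorm V (\<pi> y)) \<le> max 1 K * (qnorm V (\<pi> x) + qnorm V (\<pi> y))"
      using n0 c by (intro mult_right_mono) auto
    then show "qnorm V (\<pi> (x + y)) \<le> max 1 K * (qnorm V (\<pi> x) + qnorm V (\<pi> y))"
      using K[rule_format, OF c c, of x y] by (simp add: \<pi>.add)
  qed (use s c in \<open>auto simp: \<pi>.scale\<close>)
  then show ?thesis using that by blast
qed

lemma bounded_form_sum:
  assumes I: "finite I" and f: "\<And>i. i \<in> I \<Longrightarrow> bounded_form sc N (f i)"
  shows "bounded_form sc N (\<lambda>x. \<Sum>i\<in>I. a i * f i x)"
proof -
  have "\<forall>i\<in>I. \<exists>c. \<forall>x. norm (f i x) \<le> c * N x" using f by (simp add: bounded_form_def)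
  then obtain c where c: "\<And>i x. i \<in> I \<Longrightarrow> norm (f i x) \<le> c i * N x" by metis
  have "norm (\<Sum>i\<in>I. a i * f i x) \<le> (\<Sum>i\<in>I. norm (a i) * c i) * N x" for x
  proof -
    have "norm (\<Sum>i\<in>I. a i * f i x) \<le> (\<Sum>i\<in>I. norm (a i) * norm (f i x))"
      by (rule order_trans[OF norm_sum]) (simp add: norm_mult)
    also have "\<dots> \<le> (\<Sum>i\<in>I. norm (a i) * (c i * N x))"
      using c by (intro sum_mono mult_left_mono) auto
    finally show ?thesis by (simp add: sum_distrib_right mult.assoc)
  qed
  moreover have "linear_form sc (\<lambda>x. \<Sum>i\<in>I. a i * f i x)"
  proof -
    have "f i (x + y) = f i x + f i y" "f i (sc b x) = b * f i x" if "i \<in> I" for i x y b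
      using f[OF that] by (auto simp: bounded_form_def linear_form_def)
    then have "(\<Sum>i\<in>I. a i * f i (x + y)) = (\<Sum>i\<in>I. a i * f i x) + (\<Sum>i\<in>I. a i * f i y)"
      "(\<Sum>i\<in>I. a i * f i (sc b x)) = b * (\<Sum>i\<in>I. a i * f i x)" for x y b
      unfolding sum.distrib[symmetric] sum_distrib_left
      by (auto intro!: sum.cong simp: distrib_left)
    then show ?thesis by (simp add: linear_form_def)
  qed
  ultimately show ?thesis unfolding bounded_form_def by blast
qed

lemma dual_simps [simp]:
  "carrier (dual V) = bounded_ops V scalars" "smul (dual V) = (\<lambda>c f x. c * f x)"
  "qnorm (dual V) = opnorm V scalars"
  by (simp_all add: dual_def)

lemma vector_space_mult: "vector_space ((*) :: 'k::field \<Rightarrow> 'k \<Rightarrow> 'k)"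
  by unfold_locales (auto simp: algebra_simps)

lemma vector_space_dual: "vector_space (smul (dual V))"
  using vector_space.vector_space_fun[OF vector_space_mult] by simp

lemma subspace_dual: "module.subspace (smul (dual V)) (carrier (dual V))"
proof -
  interpret vector_space "smul (dual V)" by (rule vector_space_dual)
  show ?thesis
  proof (rule subspaceI)
    show "0 \<in> carrier (dual V)" by (auto simp: bounded_ops_def scalars_def intro!: exI[of _ 0])
  next
    fix f g assume fg: "f \<in> carrier (dual V)" "g \<in> carrier (dual V)"
    then obtain k l where "\<forall>x\<in>carrier V. norm (f x) \<le> k * qnorm V x" "\<forall>x\<in>carrier V. norm (g x) \<le> l * qnorm V x"
      by (auto simp: bounded_ops_def scalars_def)
    then have "\<forall>x\<in>carrier V. norm (f x + g x) \<le> (k + l) * qnorm V x"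
      by (auto simp: distrib_right intro: order_trans[OF norm_triangle_ineq] add_mono)
    then have "\<exists>k. \<forall>x\<in>carrier V. norm (f x + g x) \<le> k * qnorm V x" by blast
    then show "f + g \<in> carrier (dual V)"
      using fg by (simp add: bounded_ops_def scalars_def distrib_left)
  next
    fix c f assume f: "f \<in> carrier (dual V)"
    then obtain k where "\<forall>x\<in>carrier V. norm (f x) \<le> k * qnorm V x"
      by (auto simp: bounded_ops_def scalars_def)
    then have "\<forall>x\<in>carrier V. norm (c * f x) \<le> norm c * k * qnorm V x"
      by (auto simp: norm_mult mult.assoc intro: mult_left_mono)
    then have "\<exists>k. \<forall>x\<in>carrier V. norm (c * f x) \<le> k * qnorm V x" by blast
    then show "smul (dual V) c f \<in> carrier (dual V)"
      using f by (simp add: bounded_ops_def scalars_def distrib_left mult.left_commute)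
  qed
qed

lemma dual_norm_nonneg:
  assumes "quasi_seminorm sc N K" "bounded_form sc N f"
  shows "0 \<le> dual_norm N f"
proof -
  interpret quasi_seminorm sc N K by fact
  obtain c where c: "\<And>x. norm (f x) \<le> c * N x"
    using assms(2) unfolding bounded_form_def by metis
  show ?thesis
  proof (rule order_trans[OF norm_ge_zero])
    show "norm (f 0) \<le> dual_norm N f" by (rule dual_norm_upper[OF c nonneg]) simp
  qed
qed

text \<open>
  Elements of the dual vanish outside the carrier by convention, so a form on the whole type has
  to be cut off.
\<close>

definition restrict_form :: "('k, 'a) qspace \<Rightarrow> ('a \<Rightarrow> 'k) \<Rightarrow> 'a \<Rightarrow> 'k::zero" where
  "restrict_form V f x = (if x \<in> carrier V then f x else 0)"

lemma
  fixes V :: "('k::{real_normed_field,euclidean_space}, 'a::ab_group_add) qspace"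
  assumes V: "quasi_normed V" and \<pi>: "carrier_projection V \<pi>"
    and f: "bounded_form (smul V) (\<lambda>x. qnorm V (\<pi> x)) f"
  shows restrict_form_in_dual: "restrict_form V f \<in> carrier (dual V)"
    and qnorm_restrict_form: "qnorm (dual V) (restrict_form V f) = dual_norm (\<lambda>x. qnorm V (\<pi> x)) f"
proof -
  interpret vector_space "smul V" using V by (simp add: quasi_normed_def)
  interpret \<pi>: Vector_Spaces.linear "smul V" "smul V" \<pi> using \<pi> by (simp add: carrier_projection_def)
  have sub: "subspace (carrier V)" using V by (simp add: quasi_normed_def)
  have \<pi>c: "\<pi> x \<in> carrier V" and \<pi>id: "x \<in> carrier V \<Longrightarrow> \<pi> x = x" for x
    using \<pi> by (auto simp: carrier_projection_def)
  have lin: "linear_form (smul V) f" using f by (simp add: bounded_form_def)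
  obtain c where c: "\<And>x. norm (f x) \<le> c * qnorm V (\<pi> x)"
    using f unfolding bounded_form_def by metis
  show "restrict_form V f \<in> carrier (dual V)"
    using lin c subspace_add[OF sub] subspace_scale[OF sub] \<pi>id
    by (auto simp: bounded_ops_def scalars_def restrict_form_def linear_form_def intro!: exI[of _ c])
      (metis)
  have f\<pi>: "f (\<pi> x) = f x" for x
  proof -
    have "\<pi> (x - \<pi> x) = 0" using \<pi>c \<pi>id by (simp add: \<pi>.diff)
    moreover have "qnorm V 0 = 0"
      using V subspace_0[OF sub] by (auto simp: quasi_normed_def)
    ultimately have "f (x - \<pi> x) = 0" using c[of "x - \<pi> x"] by simp
    then show ?thesis using linear_form_diff[OF lin] by simp
  qed
  have "(\<lambda>x. norm (f x)) ` {x. qnorm V (\<pi> x) \<le> 1}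
      = (\<lambda>x. norm (restrict_form V f x)) ` {x \<in> carrier V. qnorm V x \<le> 1}"
  proof (intro equalityI subsetI)
    fix r assume "r \<in> (\<lambda>x. norm (f x)) ` {x. qnorm V (\<pi> x) \<le> 1}"
    then obtain x where "qnorm V (\<pi> x) \<le> 1" "r = norm (f x)" by blast
    then show "r \<in> (\<lambda>x. norm (restrict_form V f x)) ` {x \<in> carrier V. qnorm V x \<le> 1}"
      using \<pi>c by (intro image_eqI[of _ _ "\<pi> x"]) (auto simp: restrict_form_def f\<pi>)
  next
    fix r assume "r \<in> (\<lambda>x. norm (restrict_form V f x)) ` {x \<in> carrier V. qnorm V x \<le> 1}"
    then obtain x where "x \<in> carrier V" "qnorm V x \<le> 1" "r = norm (restrict_form V f x)" by blast
    then show "r \<in> (\<lambda>x. norm (f x)) ` {x. qnorm V (\<pi> x) \<le> 1}"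
      by (intro image_eqI[of _ _ x]) (auto simp: restrict_form_def \<pi>id)
  qed
  then show "qnorm (dual V) (restrict_form V f) = dual_norm (\<lambda>x. qnorm V (\<pi> x)) f"
    by (simp add: opnorm_def dual_norm_def scalars_def)
qed

text \<open>
  A bounded form vanishes on the kernel of the projection, hence restricting it to the carrier
  is isometric and linear, and the inequality for the dual space carries over.
\<close>

lemma dual_Hadamard_inequality_if_embeds_in_L1:
  fixes V :: "('k::{real_normed_field,euclidean_space}, 'a::ab_group_add) qspace"
  assumes V: "quasi_normed V" and \<pi>: "carrier_projection V \<pi>" and emb: "embeds_in_L1 (dual V) M"
  obtains c where "0 \<le> c" "dual_Hadamard_inequality (smul V) (\<lambda>x. qnorm V (\<pi> x)) c"
proof -
  define N where "N x = qnorm V (\<pi> x)" for x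
  obtain K where K: "quasi_seminorm (smul V) N K"
    using quasi_seminorm_projection[OF V \<pi>] by (auto simp: N_def[abs_def])
  note restr = restrict_form_in_dual[OF V \<pi>, folded N_def] qnorm_restrict_form[OF V \<pi>, folded N_def]
  obtain c where c: "Hadamard_inequality (dual V) c"
    using L1_Hadamard_inequality[OF vector_space_dual subspace_dual emb] by blast
  have sum_restrict: "(\<Sum>i\<in>I. smul (dual V) (a i) (restrict_form V (f i)))
      = restrict_form V (\<lambda>x. \<Sum>i\<in>I. a i * f i x)" for I :: "'i set" and a f
    by (auto simp: fun_eq_iff restrict_form_def sum_apply)
  have "dual_Hadamard_inequality (smul V) N \<bar>c\<bar>"
    unfolding dual_Hadamard_inequality_def
  proof (intro allI impI)
    fix n :: nat and H and R :: "nat set" and d :: real and E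
      and \<psi> :: "(nat \<Rightarrow> real) \<Rightarrow> 'a \<Rightarrow> 'k" and \<phi> :: "nat \<Rightarrow> 'a \<Rightarrow> 'k"
    assume H: "Hadamard n H" and R: "R \<subseteq> {..<2^n}" and d: "0 < d" and E: "finite E"
      and s: "\<forall>\<eta>\<in>E. \<forall>j\<in>R. \<bar>\<eta> j\<bar> \<le> 1" and \<psi>: "\<forall>\<eta>\<in>E. bounded_form (smul V) N (\<psi> \<eta>)"
      and \<phi>: "\<forall>j\<in>R. \<phi> j = (\<lambda>x. \<Sum>\<eta>\<in>E. of_real (\<eta> j) * \<psi> \<eta> x)"
    have finR: "finite R" using R finite_subset by blast
    have \<phi>b: "bounded_form (smul V) N (\<phi> j)" if "j \<in> R" for j
      using bounded_form_sum[OF E, of "smul V" N \<psi> "\<lambda>\<eta>. of_real (\<eta> j)"] \<psi> \<phi> that by simp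
    have Fb: "bounded_form (smul V) N (\<lambda>x. \<Sum>j\<in>R. of_real (H j k) * \<phi> j x)" for k
      by (rule bounded_form_sum[OF finR \<phi>b])
    let ?S = "d * (\<Sum>j\<in>R. dual_norm N (\<phi> j)) + (\<Sum>\<eta>\<in>E. dual_norm N (\<psi> \<eta>)) / d"
    have "(\<Sum>k<2^n. qnorm (dual V) (\<Sum>j\<in>R. smul (dual V) (of_real (H j k)) (restrict_form V (\<phi> j)))) / 2 ^ n
        \<le> c * (d * (\<Sum>j\<in>R. qnorm (dual V) (restrict_form V (\<phi> j)))
                + (\<Sum>\<eta>\<in>E. qnorm (dual V) (restrict_form V (\<psi> \<eta>))) / d)"
    proof (rule c[unfolded Hadamard_inequality_def, rule_format, OF H R d E])
      show "restrict_form V (\<phi> j) = (\<Sum>\<eta>\<in>E. smul (dual V) (of_real (\<eta> j)) (restrict_form V (\<psi> \<eta>)))"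
        if "j \<in> R" for j
        using \<phi> that by (simp only: sum_restrict)
    qed (use s \<psi> restr(1) in auto)
    moreover have "(\<Sum>j\<in>R. qnorm (dual V) (restrict_form V (\<phi> j))) = (\<Sum>j\<in>R. dual_norm N (\<phi> j))"
      using restr(2) \<phi>b by (intro sum.cong) auto
    moreover have "(\<Sum>\<eta>\<in>E. qnorm (dual V) (restrict_form V (\<psi> \<eta>))) = (\<Sum>\<eta>\<in>E. dual_norm N (\<psi> \<eta>))"
      using restr(2) \<psi> by (intro sum.cong) auto
    moreover have "qnorm (dual V) (\<Sum>j\<in>R. smul (dual V) (of_real (H j k)) (restrict_form V (\<phi> j)))
        = dual_norm N (\<lambda>x. \<Sum>j\<in>R. of_real (H j k) * \<phi> j x)" for k
      unfolding sum_restrict by (rule restr(2)[OF Fb])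
    ultimately have "(\<Sum>k<2^n. dual_norm N (\<lambda>x. \<Sum>j\<in>R. of_real (H j k) * \<phi> j x)) / 2 ^ n \<le> c * ?S"
      by simp
    also have "\<dots> \<le> \<bar>c\<bar> * ?S"
      using d \<phi>b \<psi> dual_norm_nonneg[OF K]
      by (intro mult_right_mono add_nonneg_nonneg mult_nonneg_nonneg divide_nonneg_pos sum_nonneg) auto
    finally show "(\<Sum>k<2^n. dual_norm N (\<lambda>x. \<Sum>j\<in>R. of_real (H j k) * \<phi> j x)) / 2 ^ n \<le> \<bar>c\<bar> * ?S" .
  qed
  then show ?thesis using that[of "\<bar>c\<bar>"] by (simp add: N_def[abs_def])
qed

lemma cotype_const_projection:
  assumes \<pi>: "carrier_projection V \<pi>" and "cotype q V"
  obtains C where "0 \<le> C" "cotype_const q (smul V) (\<lambda>x. qnorm V (\<pi> x)) C"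
proof -
  interpret \<pi>: Vector_Spaces.linear "smul V" "smul V" \<pi> using \<pi> by (simp add: carrier_projection_def)
  have \<pi>c: "\<pi> x \<in> carrier V" for x using \<pi> by (simp add: carrier_projection_def)
  obtain C where C: "\<And>n (y :: nat \<Rightarrow> 'b). (\<forall>i\<in>{1..n}. y i \<in> carrier V) \<Longrightarrow>
        (\<Sum>i=1..n. qnorm V (y i) powr q) powr (1 / q)
        \<le> C * (\<integral>t. qnorm V (\<Sum>i=1..n. smul V (of_real (t i)) (y i)) powr q
                  \<partial>uniform_count_measure (sign_cube n)) powr (1 / q)"
    using assms(2) unfolding cotype_def by blast
  have "cotype_const q (smul V) (\<lambda>x. qnorm V (\<pi> x)) \<bar>C\<bar>"
    unfolding cotype_const_def
  proof (intro allI)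
    fix n and y :: "nat \<Rightarrow> 'b"
    let ?I = "\<integral>t. qnorm V (\<pi> (\<Sum>i=1..n. smul V (of_real (t i)) (y i))) powr q
                  \<partial>uniform_count_measure (sign_cube n)"
    have "(\<Sum>i=1..n. qnorm V (\<pi> (y i)) powr q) powr (1 / q) \<le> C * ?I powr (1 / q)"
      using C[of n "\<lambda>i. \<pi> (y i)"] \<pi>c by (simp add: \<pi>.sum \<pi>.scale)
    also have "\<dots> \<le> \<bar>C\<bar> * ?I powr (1 / q)" by (intro mult_right_mono) auto
    finally show "(\<Sum>i=1..n. qnorm V (\<pi> (y i)) powr q) powr (1 / q) \<le> \<bar>C\<bar> * ?I powr (1 / q)" .
  qed
  then show ?thesis using that[of "\<bar>C\<bar>"] by simp
qed

section \<open>Operators of finite rank\<close>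

text \<open>
  In a finite-dimensional space every definite quasi-norm dominates the coordinates. A
  quasi-norm need not be continuous, so instead of compactness of the sphere the proof uses
  completeness of the scalar field, by induction on the basis.
\<close>

lemma (in quasi_seminorm) coordinates_bounded:
  assumes B: "finite B" "independent B" and definite: "\<And>x. x \<in> span B \<Longrightarrow> N x = 0 \<Longrightarrow> x = 0"
  shows "\<exists>C\<ge>0. \<forall>a. \<forall>b\<in>B. norm (a b) \<le> C * N (\<Sum>b\<in>B. sc (a b) b)"
  using B definite
proof (induction rule: finite_induct)
  case empty
  show ?case by (rule exI[of _ 0]) simp
next
  case (insert b0 B)
  have indep: "independent B" and b0: "b0 \<notin> span B"
    using insert.prems(1) insert.hyps by (auto simp: independent_insert)
  have span_sum: "(\<Sum>b\<in>B. sc (a b) b) \<in> span B" for a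
    by (intro span_sum span_scale span_base)
  have "\<exists>C\<ge>0. \<forall>a. \<forall>b\<in>B. norm (a b) \<le> C * N (\<Sum>b\<in>B. sc (a b) b)"
  proof (rule insert.IH[OF indep])
    show "x = 0" if "x \<in> span B" "N x = 0" for x
      using that insert.prems(2)[of x] span_mono[of B "insert b0 B"] by blast
  qed
  then obtain C where C: "0 \<le> C"
    "\<forall>a. \<forall>b\<in>B. norm (a b) \<le> C * N (\<Sum>b\<in>B. sc (a b) b)" by auto
  \<comment> \<open>The crucial point is that \<open>b0\<close> has a positive distance from the span of the other
    vectors; otherwise completeness of the scalars would put it into that span.\<close>
  have "\<exists>r>0. \<forall>a. r \<le> N (b0 + (\<Sum>b\<in>B. sc (a b) b))"
  proof (rule ccontr)
    assume "\<not> ?thesis"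
    then have "\<exists>a. N (b0 + (\<Sum>b\<in>B. sc (a b) b)) < r" if "0 < r" for r
      using that by (auto simp: not_le)
    then have "\<forall>n. \<exists>a. N (b0 + (\<Sum>b\<in>B. sc (a b) b)) < inverse (real (Suc n))" by simp
    then obtain a where a: "\<And>n. N (b0 + (\<Sum>b\<in>B. sc (a n b) b)) < inverse (real (Suc n))" by metis
    define v where "v n = b0 + (\<Sum>b\<in>B. sc (a n b) b)" for n
    have v: "N (v n) < inverse (real (Suc n))" for n using a by (simp add: v_def)
    have diff: "norm (a m b - a n b) \<le> C * (K * (N (v m) + N (v n)))" if "b \<in> B" for b m n
    proof -
      have "v m - v n = (\<Sum>b\<in>B. sc (a m b - a n b) b)"
        by (simp add: v_def scale_left_diff_distrib sum_subtractf)
      then have "norm (a m b - a n b) \<le> C * N (v m - v n)"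
        using C(2)[THEN spec, of "\<lambda>b. a m b - a n b"] that by simp
      also have "\<dots> \<le> C * (K * (N (v m) + N (v n)))"
        using C(1) diff_triangle by (intro mult_left_mono)
      finally show ?thesis .
    qed
    have lim0: "(\<lambda>n. N (v n)) \<longlonglongrightarrow> 0"
      by (rule tendsto_sandwich[OF _ _ tendsto_const LIMSEQ_inverse_real_of_nat])
        (use v in \<open>auto intro!: always_eventually less_imp_le\<close>)
    have "Cauchy (\<lambda>n. a n b)" if b: "b \<in> B" for b
    proof (rule metric_CauchyI)
      fix e :: real assume e: "0 < e"
      define r where "r = e / (2 * ((C + 1) * K))"
      have r: "0 < r" using e C(1) K_ge_1 by (simp add: r_def)
      obtain n0 where n0: "\<And>n. n \<ge> n0 \<Longrightarrow> N (v n) < r"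
        using order_tendstoD(2)[OF lim0 r] by (auto simp: eventually_sequentially)
      have "dist (a m b) (a n b) < e" if "m \<ge> n0" "n \<ge> n0" for m n
      proof -
        have "C * (K * (N (v m) + N (v n))) \<le> (C + 1) * (K * (N (v m) + N (v n)))"
          using K_ge_1 by (intro mult_right_mono) auto
        also have "\<dots> < (C + 1) * (K * (r + r))"
          using n0[OF that(1)] n0[OF that(2)] C(1) K_ge_1 by (intro mult_strict_left_mono add_strict_mono) auto
        also have "\<dots> = 2 * ((C + 1) * K) * r" by (simp add: algebra_simps)
        also have "\<dots> = e"
        proof -
          have "C + 1 \<noteq> 0" "K \<noteq> 0" using C(1) K_ge_1 by auto
          then show ?thesis by (simp add: r_def)
        qed
        finally show ?thesis using diff[OF b, of m n] by (simp add: dist_norm)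
      qed
      then show "\<exists>M. \<forall>m\<ge>M. \<forall>n\<ge>M. dist (a m b) (a n b) < e" by blast
    qed
    then have "\<forall>b\<in>B. \<exists>l. (\<lambda>n. a n b) \<longlonglongrightarrow> l" by (simp add: Cauchy_convergent_iff convergent_def)
    then obtain l where l: "\<And>b. b \<in> B \<Longrightarrow> (\<lambda>n. a n b) \<longlonglongrightarrow> l b" by metis
    define w where "w = b0 + (\<Sum>b\<in>B. sc (l b) b)"
    have "N w \<le> K * (N (v n) + K ^ card B * (\<Sum>b\<in>B. norm (l b - a n b) * N b))" for n
    proof -
      have "w - v n = (\<Sum>b\<in>B. sc (l b - a n b) b)"
        by (simp add: w_def v_def scale_left_diff_distrib sum_subtractf)
      then have "N (w - v n) \<le> K ^ card B * (\<Sum>b\<in>B. norm (l b - a n b) * N b)"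
        using sum_le[OF insert.hyps(1), of "\<lambda>b. sc (l b - a n b) b"] by (simp add: scaled)
      moreover have "N w \<le> K * (N (v n) + N (w - v n))"
        using quasi_triangle[of "v n" "w - v n"] by simp
      ultimately show ?thesis
        using K_ge_1 by (meson add_left_mono mult_left_mono order_trans zero_le_one)
    qed
    moreover have "(\<lambda>n. K * (N (v n) + K ^ card B * (\<Sum>b\<in>B. norm (l b - a n b) * N b)))
        \<longlonglongrightarrow> K * (0 + K ^ card B * (\<Sum>b\<in>B. norm (l b - l b) * N b))"
      using l by (intro tendsto_intros lim0) auto
    ultimately have "N w \<le> 0"
      by (intro LIMSEQ_le_const) auto
    then have "N w = 0" using nonneg[of w] by linarith
    moreover have "w \<in> span (insert b0 B)"
      unfolding w_def using span_sum[of l] span_mono[of B "insert b0 B"]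
      by (intro span_add) (auto intro: span_base)
    ultimately have "w = 0" using insert.prems(2) by blast
    then have "b0 = - (\<Sum>b\<in>B. sc (l b) b)" by (simp add: w_def eq_neg_iff_add_eq_0)
    then show False using b0 span_neg[OF span_sum[of l]] by simp
  qed
  then obtain r where r: "0 < r" "\<And>a. r \<le> N (b0 + (\<Sum>b\<in>B. sc (a b) b))" by blast
  have first: "norm (a b0) \<le> 1 / r * N (\<Sum>b\<in>insert b0 B. sc (a b) b)" for a
  proof (cases "a b0 = 0")
    case False
    have "(\<Sum>b\<in>insert b0 B. sc (a b) b) = sc (a b0) (b0 + (\<Sum>b\<in>B. sc (a b / a b0) b))"
      using False insert.hyps by (simp add: scale_right_distrib scale_sum_right)
    then have "N (\<Sum>b\<in>insert b0 B. sc (a b) b) = norm (a b0) * N (b0 + (\<Sum>b\<in>B. sc (a b / a b0) b))"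
      by (simp only: scaled)
    also have "norm (a b0) * r \<le> \<dots>" using r(2) by (intro mult_left_mono) auto
    finally show ?thesis using r(1) by (simp add: field_simps)
  qed (use r in simp)
  define C' where "C' = 1 / r + C * K * (1 + 1 / r * N b0)"
  have "norm (a b) \<le> C' * N (\<Sum>b\<in>insert b0 B. sc (a b) b)" if b: "b \<in> insert b0 B" for a b
  proof -
    let ?x = "\<Sum>b\<in>insert b0 B. sc (a b) b"
    have pos: "0 \<le> 1 / r * N ?x" "0 \<le> C * K * (1 + 1 / r * N b0) * N ?x"
      using r(1) C(1) K_ge_1 by (auto intro!: mult_nonneg_nonneg add_nonneg_nonneg)
    have split: "C' * N ?x = 1 / r * N ?x + C * K * (1 + 1 / r * N b0) * N ?x"
      unfolding C'_def by (simp only: distrib_right)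
    show ?thesis
    proof (cases "b = b0")
      case True
      show ?thesis unfolding True using first[of a] pos split by linarith
    next
      case False
      then have "b \<in> B" using b by simp
      then have "norm (a b) \<le> C * N (\<Sum>b\<in>B. sc (a b) b)" using C(2) by blast
      also have "(\<Sum>b\<in>B. sc (a b) b) = ?x - sc (a b0) b0" using insert.hyps by simp
      also have "C * N (?x - sc (a b0) b0) \<le> C * (K * (N ?x + norm (a b0) * N b0))"
        using diff_triangle[of ?x "sc (a b0) b0"] C(1) by (intro mult_left_mono) (auto simp: scaled)
      also have "\<dots> \<le> C * (K * (N ?x + (1 / r * N ?x) * N b0))"
        using first[of a] C(1) K_ge_1 by (intro mult_left_mono add_left_mono mult_right_mono) auto
      also have "\<dots> = C * K * (1 + 1 / r * N b0) * N ?x"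
        by (simp add: algebra_simps)
      finally show ?thesis using pos split by linarith
    qed
  qed
  moreover have "0 \<le> C'"
    using r(1) C(1) K_ge_1 by (auto simp: C'_def intro!: mult_nonneg_nonneg add_nonneg_nonneg)
  ultimately show ?case by blast
qed

text \<open>
  The coordinates of \<open>u x\<close> with respect to a basis of the range are scalar functionals bounded
  by a multiple of the quasi-norm. Their moduli are subadditive, hence bounded by a multiple of
  the convex gauge, and then so is \<open>u\<close>.
\<close>

lemma (in quasi_seminorm) finite_rank_conv_bound:
  fixes sY :: "'k \<Rightarrow> 'y::ab_group_add \<Rightarrow> 'y"
  assumes Y: "quasi_seminorm sY NY L" and u: "Vector_Spaces.linear sc sY u"
    and U: "\<And>x. NY (u x) \<le> U * N x" "0 \<le> U"
    and definite: "\<And>x. NY (u x) = 0 \<Longrightarrow> u x = 0"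
    and F: "finite F" "range u \<subseteq> module.span sY F"
  obtains D where "\<And>x. NY (u x) \<le> D * conv_norm N x"
proof -
  interpret Y: quasi_seminorm sY NY L by fact
  interpret u: Vector_Spaces.linear sc sY u by fact
  obtain B where B: "B \<subseteq> range u" "Y.independent B" "range u \<subseteq> Y.span B"
    by (rule Y.basis_exists)
  have finB: "finite B" using Y.independent_span_bound[OF F(1) B(2) subset_trans[OF B(1) F(2)]] by simp
  have "Y.subspace (range u)" using u.subspace_image[of UNIV] by simp
  then have span_range: "Y.span B = range u" by (rule Y.span_subspace[OF B(1,3)])
  have definite_span: "x = 0" if "x \<in> Y.span B" "NY x = 0" for x
  proof -
    from that(1) obtain z where "x = u z" unfolding span_range by blast
    then show ?thesis using that(2) definite[of z] by simp
  qed
  obtain C where C: "0 \<le> C" "\<forall>a. \<forall>b\<in>B. norm (a b) \<le> C * NY (\<Sum>b\<in>B. sY (a b) b)"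
    using Y.coordinates_bounded[OF finB B(2) definite_span] by blast
  define a where "a b x = Y.representation B (u x) b" for b x
  have in_span: "u x \<in> Y.span B" for x using B(3) by auto
  have expand: "(\<Sum>b\<in>B. sY (a b x) b) = u x" for x
    unfolding a_def by (rule Y.sum_representation_eq[OF B(2) in_span finB order_refl])
  have coeff: "norm (a b x) \<le> C * U * conv_norm N x" if b: "b \<in> B" for b x
  proof (rule subadditive_le_conv_norm)
    show "norm (a b x) \<le> C * U * N x" for x
    proof -
      have "norm (a b x) \<le> C * NY (u x)"
        using C(2)[THEN spec, of "\<lambda>b. a b x"] b by (simp add: expand)
      also have "\<dots> \<le> C * (U * N x)" using U(1) C(1) by (intro mult_left_mono)
      finally show ?thesis by (simp add: mult.assoc)
    qed
    show "norm (a b (x + y)) \<le> norm (a b x) + norm (a b y)" for x y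
      unfolding a_def u.add Y.representation_add[OF B(2) in_span in_span]
      by (rule norm_triangle_ineq)
  qed (use C(1) U(2) in simp)
  have "NY (u x) \<le> (L ^ card B * (\<Sum>b\<in>B. C * U * NY b)) * conv_norm N x" for x
  proof -
    have "NY (u x) \<le> L ^ card B * (\<Sum>b\<in>B. norm (a b x) * NY b)"
      using Y.sum_le[OF finB, of "\<lambda>b. sY (a b x) b"] by (simp add: expand Y.scaled)
    also have "\<dots> \<le> L ^ card B * (\<Sum>b\<in>B. (C * U * conv_norm N x) * NY b)"
      using coeff Y.K_ge_1 by (intro mult_left_mono sum_mono mult_right_mono) auto
    also have "\<dots> = (L ^ card B * (\<Sum>b\<in>B. C * U * NY b)) * conv_norm N x"
      by (simp add: sum_distrib_left sum_distrib_right mult_ac)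
    finally show ?thesis .
  qed
  then show ?thesis using that by blast
qed

section \<open>Factorization through a Banach space\<close>

text \<open>
  The map \<open>e\<close> has the kernel of \<open>N\<close> as its kernel, so \<open>B\<close> is the completion of a quotient.
\<close>

definition completion_map ::
    "('k::{real_normed_field,euclidean_space} \<Rightarrow> 'v::ab_group_add \<Rightarrow> 'v) \<Rightarrow> ('v \<Rightarrow> real) \<Rightarrow>
     ('k, 'b::ab_group_add) qspace \<Rightarrow> ('v \<Rightarrow> 'b) \<Rightarrow> bool" where
  "completion_map sc N B e \<longleftrightarrow> banach_space B \<and> (\<forall>x. e x \<in> carrier B) \<and>
     (\<forall>x y. e (x + y) = e x + e y) \<and> (\<forall>c x. e (sc c x) = smul B c (e x)) \<and>
     (\<forall>x. qnorm B (e x) = N x) \<and>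
     (\<forall>\<Psi>\<in>carrier B. \<exists>x. (\<lambda>n. qnorm B (e (x n) - \<Psi>)) \<longlonglongrightarrow> 0)"

text \<open>
  Evaluation maps the space isometrically, by the Hahn-Banach theorem, into the bounded
  functions on the set \<open>U\<close> of forms of norm at most 1, with the supremum norm. The completion is
  the closure \<open>Cr\<close> of the image.
\<close>

lemma (in seminorm) exists_completion:
  obtains B :: "('k, ('v \<Rightarrow> 'k) \<Rightarrow> 'k) qspace" and e where "completion_map sc N B e"
proof -
  define U where "U = {f. linear_form sc f \<and> (\<forall>x. norm (f x) \<le> N x)}"
  have zeroU: "(\<lambda>_. 0) \<in> U" by (simp add: U_def linear_form_def)
  then have U_ne: "U \<noteq> {}" by blast
  define e where "e x f = (if f \<in> U then f x else 0)" for x f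
  define Cr where "Cr = {\<Psi>. (\<forall>f. f \<notin> U \<longrightarrow> \<Psi> f = (0::'k)) \<and> (\<forall>\<epsilon>>0. \<exists>x. \<forall>f\<in>U. norm (f x - \<Psi> f) \<le> \<epsilon>)}"
  have approx: "\<exists>x. \<forall>f\<in>U. norm (f x - \<Psi> f) \<le> \<epsilon>" if "\<Psi> \<in> Cr" "0 < \<epsilon>" for \<Psi> \<epsilon>
    using that by (simp add: Cr_def)
  define nrm where "nrm \<Psi> = (SUP f\<in>U. norm (\<Psi> f))" for \<Psi> :: "('v \<Rightarrow> 'k) \<Rightarrow> 'k"
  define B :: "('k, ('v \<Rightarrow> 'k) \<Rightarrow> 'k) qspace"
    where "B = \<lparr>carrier = Cr, smul = (\<lambda>c \<Psi> f. c * \<Psi> f), qnorm = nrm\<rparr>"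
  have B[simp]: "carrier B = Cr" "smul B = (\<lambda>c \<Psi> f. c * \<Psi> f)" "qnorm B = nrm" by (auto simp: B_def)
  have vs: "vector_space (smul B)"
    using vector_space.vector_space_fun[OF vector_space_mult] by simp
  interpret V: vector_space "smul B" by fact
  have nrm_le: "nrm \<Psi> \<le> m" if "\<And>f. f \<in> U \<Longrightarrow> norm (\<Psi> f) \<le> m" for \<Psi> m
    unfolding nrm_def using that by (intro cSUP_least[OF U_ne])
  have le_nrm: "norm (\<Psi> f) \<le> nrm \<Psi>" if \<Psi>: "\<Psi> \<in> Cr" and f: "f \<in> U" for \<Psi> f
  proof -
    obtain x where x: "\<forall>f\<in>U. norm (f x - \<Psi> f) \<le> 1"
      using approx[OF \<Psi>, of 1] by auto
    have "bdd_above ((\<lambda>f. norm (\<Psi> f)) ` U)"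
    proof (rule bdd_aboveI2)
      fix f assume "f \<in> U"
      then have "norm (f x - \<Psi> f) \<le> 1" "norm (f x) \<le> N x" using x by (auto simp: U_def)
      then show "norm (\<Psi> f) \<le> N x + 1"
        using norm_triangle_ineq4[of "f x" "f x - \<Psi> f"] by simp
    qed
    then show ?thesis unfolding nrm_def using f by (rule cSUP_upper[rotated])
  qed
  have nrm_nonneg: "0 \<le> nrm \<Psi>" if "\<Psi> \<in> Cr" for \<Psi>
    using le_nrm[OF that zeroU] norm_ge_zero order_trans by blast
  have add: "\<Psi> + \<Phi> \<in> Cr" if "\<Psi> \<in> Cr" "\<Phi> \<in> Cr" for \<Psi> \<Phi>
  proof -
    have "\<exists>x. \<forall>f\<in>U. norm (f x - (\<Psi> + \<Phi>) f) \<le> \<epsilon>" if "0 < \<epsilon>" for \<epsilon>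
    proof -
      have "0 < \<epsilon> / 2" using that by simp
      from approx[OF \<open>\<Psi> \<in> Cr\<close> this] approx[OF \<open>\<Phi> \<in> Cr\<close> this] obtain x y where xy: "\<forall>f\<in>U. norm (f x - \<Psi> f) \<le> \<epsilon> / 2" "\<forall>f\<in>U. norm (f y - \<Phi> f) \<le> \<epsilon> / 2"
        by blast
      have "norm (f (x + y) - (\<Psi> + \<Phi>) f) \<le> \<epsilon>" if f: "f \<in> U" for f
      proof -
        have "f (x + y) - (\<Psi> + \<Phi>) f = (f x - \<Psi> f) + (f y - \<Phi> f)"
          using f by (simp add: U_def linear_form_def)
        also have "norm \<dots> \<le> norm (f x - \<Psi> f) + norm (f y - \<Phi> f)" by (rule norm_triangle_ineq)
        also have "\<dots> \<le> \<epsilon> / 2 + \<epsilon> / 2" using xy f by (intro add_mono) auto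
        finally show ?thesis by simp
      qed
      then show ?thesis by blast
    qed
    then show ?thesis using that by (simp add: Cr_def)
  qed
  have scl: "(\<lambda>f. c * \<Psi> f) \<in> Cr" if \<Psi>: "\<Psi> \<in> Cr" for c \<Psi>
  proof -
    have "\<exists>x. \<forall>f\<in>U. norm (f x - c * \<Psi> f) \<le> \<epsilon>" if "0 < \<epsilon>" for \<epsilon>
    proof -
      have "0 < \<epsilon> / (norm c + 1)" using that by (simp add: add_nonneg_pos)
      then obtain x where x: "\<forall>f\<in>U. norm (f x - \<Psi> f) \<le> \<epsilon> / (norm c + 1)"
        using approx[OF \<Psi>] by blast
      have "norm (f (sc c x) - c * \<Psi> f) \<le> \<epsilon>" if f: "f \<in> U" for f
      proof -
        have "f (sc c x) - c * \<Psi> f = c * (f x - \<Psi> f)"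
          using f by (simp add: U_def linear_form_def right_diff_distrib)
        then have "norm (f (sc c x) - c * \<Psi> f) = norm c * norm (f x - \<Psi> f)" by (simp add: norm_mult)
        also have "\<dots> \<le> (norm c + 1) * (\<epsilon> / (norm c + 1))"
          using x f by (intro mult_mono) auto
        also have "\<dots> = \<epsilon>" using norm_ge_zero[of c] by (simp add: add_nonneg_eq_0_iff)
        finally show ?thesis .
      qed
      then show ?thesis by blast
    qed
    then show ?thesis using \<Psi> by (simp add: Cr_def)
  qed
  have eC: "e x \<in> Cr" for x
    unfolding Cr_def e_def by (auto intro!: exI[of _ x])
  have e0: "e 0 = 0"
    by (auto simp: e_def fun_eq_iff U_def linear_form_0)
  have sub: "V.subspace Cr"
    using eC[of 0] e0 add scl by (intro V.subspaceI) auto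
  have nrm_add: "nrm (\<Psi> + \<Phi>) \<le> nrm \<Psi> + nrm \<Phi>" if "\<Psi> \<in> Cr" "\<Phi> \<in> Cr" for \<Psi> \<Phi>
  proof (rule nrm_le)
    fix f assume f: "f \<in> U"
    show "norm ((\<Psi> + \<Phi>) f) \<le> nrm \<Psi> + nrm \<Phi>"
      using norm_triangle_ineq[of "\<Psi> f" "\<Phi> f"] le_nrm[OF that(1) f] le_nrm[OF that(2) f] by simp
  qed
  have nrm_scale: "nrm (\<lambda>f. c * \<Psi> f) = norm c * nrm \<Psi>" if \<Psi>: "\<Psi> \<in> Cr" for c \<Psi>
  proof (rule antisym)
    show "nrm (\<lambda>f. c * \<Psi> f) \<le> norm c * nrm \<Psi>"
      by (rule nrm_le) (simp add: norm_mult le_nrm[OF \<Psi>] mult_left_mono)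
    show "norm c * nrm \<Psi> \<le> nrm (\<lambda>f. c * \<Psi> f)"
    proof (cases "c = 0")
      case False
      have "nrm \<Psi> \<le> nrm (\<lambda>f. c * \<Psi> f) / norm c"
        by (rule nrm_le) (use le_nrm[OF scl[OF \<Psi>, of c]] False in \<open>auto simp: norm_mult field_simps\<close>)
      then show ?thesis using False by (simp add: field_simps)
    qed (use nrm_nonneg[OF scl[OF \<Psi>, of c]] in simp)
  qed
  have nrm_0: "nrm \<Psi> = 0 \<longleftrightarrow> \<Psi> = 0" if \<Psi>: "\<Psi> \<in> Cr" for \<Psi>
  proof
    assume "nrm \<Psi> = 0"
    then have "\<Psi> f = 0" if "f \<in> U" for f using le_nrm[OF \<Psi> that] by simp
    then have "\<Psi> f = 0" for f using \<Psi> by (cases "f \<in> U") (auto simp: Cr_def)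
    then show "\<Psi> = 0" by auto
  next
    assume "\<Psi> = 0"
    then show "nrm \<Psi> = 0" using nrm_scale[OF \<Psi>, of 0] by (simp add: zero_fun_def)
  qed
  have qB: "quasi_normed B"
    unfolding quasi_normed_def using vs sub nrm_nonneg nrm_0 nrm_scale nrm_add
    by (auto intro!: exI[of _ 1])
  have cB: "complete_qspace B"
    unfolding complete_qspace_def
  proof (intro allI impI)
    fix s :: "nat \<Rightarrow> ('v \<Rightarrow> 'k) \<Rightarrow> 'k"
    assume "\<forall>n. s n \<in> carrier B" and "\<forall>\<epsilon>>0. \<exists>n0. \<forall>m\<ge>n0. \<forall>n\<ge>n0. qnorm B (s m - s n) < \<epsilon>"
    then have s: "\<And>n. s n \<in> Cr"
      and cau: "\<And>\<epsilon>. 0 < \<epsilon> \<Longrightarrow> \<exists>n0. \<forall>m\<ge>n0. \<forall>n\<ge>n0. nrm (s m - s n) < \<epsilon>" by auto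
    have ptw: "norm (s m f - s n f) \<le> nrm (s m - s n)" if "f \<in> U" for m n f
      using le_nrm[OF V.subspace_diff[OF sub s s] that, of m n] by simp
    have "Cauchy (\<lambda>n. s n f)" for f
    proof (cases "f \<in> U")
      case True
      show ?thesis
      proof (rule metric_CauchyI)
        fix \<epsilon> :: real assume "0 < \<epsilon>"
        from cau[OF this] obtain n0 where "\<forall>m\<ge>n0. \<forall>n\<ge>n0. nrm (s m - s n) < \<epsilon>" ..
        then show "\<exists>n0. \<forall>m\<ge>n0. \<forall>n\<ge>n0. dist (s m f) (s n f) < \<epsilon>"
          using ptw[OF True] unfolding dist_norm by (meson le_less_trans)
      qed
    next
      case False
      then have "s n f = 0" for n using s by (simp add: Cr_def)
      then show ?thesis by (simp add: Cauchy_def)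
    qed
    then have "\<forall>f. \<exists>l. (\<lambda>n. s n f) \<longlonglongrightarrow> l" by (simp add: Cauchy_convergent_iff convergent_def)
    then obtain \<Psi> where \<Psi>: "\<And>f. (\<lambda>n. s n f) \<longlonglongrightarrow> \<Psi> f" by metis
    have unif: "\<exists>n0. \<forall>n\<ge>n0. \<forall>f\<in>U. norm (s n f - \<Psi> f) \<le> \<epsilon>" if \<epsilon>: "0 < \<epsilon>" for \<epsilon>
    proof -
      from cau[OF \<epsilon>] obtain n0 where n0: "\<forall>m\<ge>n0. \<forall>n\<ge>n0. nrm (s m - s n) < \<epsilon>" ..
      have "norm (s n f - \<Psi> f) \<le> \<epsilon>" if "n \<ge> n0" "f \<in> U" for n f
      proof (rule tendsto_upperbound)
        show "(\<lambda>m. norm (s n f - s m f)) \<longlonglongrightarrow> norm (s n f - \<Psi> f)" by (intro tendsto_intros \<Psi>)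
        show "\<forall>\<^sub>F m in sequentially. norm (s n f - s m f) \<le> \<epsilon>"
          unfolding eventually_sequentially
        proof (intro exI allI impI)
          fix m assume "n0 \<le> m"
          then have "nrm (s n - s m) < \<epsilon>" using n0 that by blast
          then show "norm (s n f - s m f) \<le> \<epsilon>" using ptw[OF that(2), of n m] by simp
        qed
      qed simp
      then show ?thesis by blast
    qed
    have \<Psi>C: "\<Psi> \<in> Cr"
    proof -
      have "\<Psi> f = 0" if "f \<notin> U" for f
      proof -
        have "s n f = 0" for n using s that by (simp add: Cr_def)
        then show ?thesis using LIMSEQ_unique[OF \<Psi>[of f]] by simp
      qed
      moreover have "\<exists>x. \<forall>f\<in>U. norm (f x - \<Psi> f) \<le> \<epsilon>" if "0 < \<epsilon>" for \<epsilon>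
      proof -
        have "0 < \<epsilon> / 2" using that by simp
        from unif[OF this] obtain n where n: "\<forall>f\<in>U. norm (s n f - \<Psi> f) \<le> \<epsilon> / 2" by blast
        obtain x where x: "\<forall>f\<in>U. norm (f x - s n f) \<le> \<epsilon> / 2"
          using approx[OF s[of n] \<open>0 < \<epsilon> / 2\<close>] by blast
        have "norm (f x - \<Psi> f) \<le> \<epsilon>" if "f \<in> U" for f
        proof -
          have "norm (f x - \<Psi> f) \<le> norm (f x - s n f) + norm (s n f - \<Psi> f)"
            using norm_triangle_ineq[of "f x - s n f" "s n f - \<Psi> f"] by simp
          also have "\<dots> \<le> \<epsilon> / 2 + \<epsilon> / 2" using x n that by (intro add_mono) auto
          finally show ?thesis by simp
        qed
        then show ?thesis by blast
      qed
      ultimately show ?thesis by (simp add: Cr_def)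
    qed
    have "(\<lambda>n. nrm (s n - \<Psi>)) \<longlonglongrightarrow> 0"
    proof (rule LIMSEQ_I)
      fix \<epsilon> :: real assume "0 < \<epsilon>"
      then have "0 < \<epsilon> / 2" by simp
      from unif[OF this] obtain n0 where n0: "\<forall>n\<ge>n0. \<forall>f\<in>U. norm (s n f - \<Psi> f) \<le> \<epsilon> / 2" ..
      have "norm (nrm (s n - \<Psi>) - 0) < \<epsilon>" if "n \<ge> n0" for n
      proof -
        have "nrm (s n - \<Psi>) \<le> \<epsilon> / 2" by (rule nrm_le) (use n0 that in auto)
        then show ?thesis
          using nrm_nonneg[OF V.subspace_diff[OF sub s \<Psi>C], of n] \<open>0 < \<epsilon>\<close> by simp
      qed
      then show "\<exists>n0. \<forall>n\<ge>n0. norm (nrm (s n - \<Psi>) - 0) < \<epsilon>" by blast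
    qed
    then show "\<exists>l\<in>carrier B. (\<lambda>n. qnorm B (s n - l)) \<longlonglongrightarrow> 0" using \<Psi>C by auto
  qed
  have nrm_e: "nrm (e x) = N x" for x
  proof (rule antisym)
    show "nrm (e x) \<le> N x" by (rule nrm_le) (auto simp: e_def U_def)
    obtain f where "linear_form sc f" "\<And>x. norm (f x) \<le> N x" "norm (f x) = N x"
      using Hahn_Banach by blast
    then have "f \<in> U" "norm (f x) = N x" by (auto simp: U_def)
    then show "N x \<le> nrm (e x)" using le_nrm[OF eC, of f x] by (simp add: e_def)
  qed
  have "completion_map sc N B e"
    unfolding completion_map_def
  proof (intro conjI allI ballI)
    show "banach_space B"
      using qB cB nrm_add by (simp add: banach_space_def quasi_banach_def)
    show "e x \<in> carrier B" "qnorm B (e x) = N x" for x by (simp_all add: eC nrm_e)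
    show "e (x + y) = e x + e y" for x y
      by (auto simp: e_def fun_eq_iff U_def linear_form_def)
    show "e (sc c x) = smul B c (e x)" for c x
      by (auto simp: e_def fun_eq_iff U_def linear_form_def)
    show "\<exists>x. (\<lambda>n. qnorm B (e (x n) - \<Psi>)) \<longlonglongrightarrow> 0" if "\<Psi> \<in> carrier B" for \<Psi>
    proof -
      have \<Psi>: "\<Psi> \<in> Cr" using that by simp
      have "\<forall>n. \<exists>x. \<forall>f\<in>U. norm (f x - \<Psi> f) \<le> inverse (real (Suc n))"
        by (intro allI approx[OF \<Psi>]) simp
      then obtain x where x: "\<And>n. \<forall>f\<in>U. norm (f (x n) - \<Psi> f) \<le> inverse (real (Suc n))" by metis
      have "nrm (e (x n) - \<Psi>) \<le> inverse (real (Suc n))" for n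
        by (rule nrm_le) (use x[of n] in \<open>simp add: e_def\<close>)
      then have "(\<lambda>n. nrm (e (x n) - \<Psi>)) \<longlonglongrightarrow> 0"
        by (intro tendsto_sandwich[OF _ _ tendsto_const LIMSEQ_inverse_real_of_nat] always_eventually)
          (auto intro: nrm_nonneg V.subspace_diff[OF sub eC \<Psi>])
      then show ?thesis by auto
    qed
  qed
  then show ?thesis by (rule that)
qed

text \<open>
  For quasi-normed spaces, too, the supremum over the unit ball is finite and gives the best
  constant.
\<close>

lemma opnorm_bound:
  assumes V: "quasi_normed V" and W: "quasi_normed W" and u: "u \<in> bounded_ops V W"
  shows opnorm_nonneg: "0 \<le> opnorm V W u"
    and le_opnorm: "\<And>x. x \<in> carrier V \<Longrightarrow> qnorm W (u x) \<le> opnorm V W u * qnorm V x"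
proof -
  interpret V: vector_space "smul V" using V by (simp add: quasi_normed_def)
  have sub: "V.subspace (carrier V)" using V by (simp add: quasi_normed_def)
  have nV: "0 \<le> qnorm V x" "qnorm V x = 0 \<longleftrightarrow> x = 0" "qnorm V (smul V c x) = norm c * qnorm V x"
    if "x \<in> carrier V" for x c using V that by (auto simp: quasi_normed_def)
  have uW: "u x \<in> carrier W" and us: "u (smul V c x) = smul W c (u x)" if "x \<in> carrier V" for x c
    using u that by (auto simp: bounded_ops_def)
  have nW: "0 \<le> qnorm W y" "qnorm W (smul W c y) = norm c * qnorm W y" if "y \<in> carrier W" for y c
    using W that by (auto simp: quasi_normed_def)
  have "\<exists>k. \<forall>x\<in>carrier V. qnorm W (u x) \<le> k * qnorm V x"
    using u by (simp add: bounded_ops_def)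
  then obtain k where k: "\<forall>x\<in>carrier V. qnorm W (u x) \<le> k * qnorm V x" ..
  have bdd: "bdd_above ((\<lambda>x. qnorm W (u x)) ` {x \<in> carrier V. qnorm V x \<le> 1})"
  proof (rule bdd_aboveI2)
    fix x assume "x \<in> {x \<in> carrier V. qnorm V x \<le> 1}"
    then have x: "x \<in> carrier V" "qnorm V x \<le> 1" by auto
    have "k * qnorm V x \<le> \<bar>k\<bar> * qnorm V x" using nV(1)[OF x(1)] by (intro mult_right_mono) auto
    also have "\<dots> \<le> \<bar>k\<bar> * 1" using x by (intro mult_left_mono) auto
    finally show "qnorm W (u x) \<le> \<bar>k\<bar>" using k x(1) by fastforce
  qed
  have upper: "qnorm W (u x) \<le> opnorm V W u" if "x \<in> carrier V" "qnorm V x \<le> 1" for x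
    unfolding opnorm_def by (rule cSUP_upper[OF _ bdd]) (use that in simp)
  have "0 \<in> carrier V" by (rule V.subspace_0[OF sub])
  moreover from this have "qnorm V 0 \<le> 1" using nV(2)[of 0] by simp
  ultimately show nonneg: "0 \<le> opnorm V W u"
    using upper[of 0] nW(1)[OF uW[of 0]] by simp
  show "qnorm W (u x) \<le> opnorm V W u * qnorm V x" if x: "x \<in> carrier V" for x
  proof (cases "qnorm V x = 0")
    case True
    have "qnorm W (u x) \<le> k * qnorm V x" using k x by blast
    then show ?thesis using True by simp
  next
    case False
    then have pos: "0 < qnorm V x" using nV(1)[OF x] by simp
    define c :: 'a where "c = of_real (1 / qnorm V x)"
    have c: "norm c = 1 / qnorm V x" using pos by (simp add: c_def norm_divide)
    have "qnorm W (u (smul V c x)) \<le> opnorm V W u"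
      using x pos c by (intro upper V.subspace_scale[OF sub]) (simp_all add: nV(3))
    then have "1 / qnorm V x * qnorm W (u x) \<le> opnorm V W u"
      using us[OF x] nW(2)[OF uW[OF x]] c by simp
    then show ?thesis using pos by (simp add: field_simps)
  qed
qed

lemma opnorm_le:
  assumes V: "quasi_normed V" and k: "0 \<le> k" "\<And>x. x \<in> carrier V \<Longrightarrow> qnorm W (u x) \<le> k * qnorm V x"
  shows "opnorm V W u \<le> k"
  unfolding opnorm_def
proof (rule cSUP_least)
  interpret V: vector_space "smul V" using V by (simp add: quasi_normed_def)
  have "0 \<in> carrier V" using V by (intro V.subspace_0) (simp add: quasi_normed_def)
  moreover from this have "qnorm V 0 = 0" using V by (simp add: quasi_normed_def)
  ultimately show "{x \<in> carrier V. qnorm V x \<le> 1} \<noteq> {}" by auto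
  fix x assume "x \<in> {x \<in> carrier V. qnorm V x \<le> 1}"
  then have "qnorm W (u x) \<le> k * qnorm V x" "k * qnorm V x \<le> k * 1"
    using k by (blast, intro mult_left_mono) auto
  then show "qnorm W (u x) \<le> k" by simp
qed

lemma linear_bounded_op_projection:
  assumes V: "quasi_normed V" and W: "quasi_normed W" and \<pi>: "carrier_projection V \<pi>"
    and u: "u \<in> bounded_ops V W"
  shows "Vector_Spaces.linear (smul V) (smul W) (\<lambda>x. u (\<pi> x))"
proof -
  interpret V: vector_space "smul V" using V by (simp add: quasi_normed_def)
  interpret W: vector_space "smul W" using W by (simp add: quasi_normed_def)
  interpret \<pi>: Vector_Spaces.linear "smul V" "smul V" \<pi> using \<pi> by (simp add: carrier_projection_def)
  have "\<pi> x \<in> carrier V" for x using \<pi> by (simp add: carrier_projection_def)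
  then show ?thesis
    using u by unfold_locales (auto simp: bounded_ops_def \<pi>.add \<pi>.scale)
qed

text \<open>
  The operator extends from the space with the convex gauge to its completion \<open>B\<close>: an element of
  \<open>B\<close> is a limit of elements \<open>e (x n)\<close>, and \<open>v\<close> maps it to the limit of \<open>u (x n)\<close>, which exists
  because \<open>Y\<close> is complete. The relation \<open>R\<close> expresses this without a choice of the sequence. The
  constant \<open>K\<close> enters because a quasi-norm need not be continuous along the limit.
\<close>

lemma delta_le_conv_bound:
  fixes X :: "('k::{real_normed_field,euclidean_space}, 'x::ab_group_add) qspace"
    and Y :: "('k, 'y::ab_group_add) qspace"
  assumes X: "quasi_normed X" and Y: "quasi_banach Y"
    and \<pi>: "carrier_projection X \<pi>" and \<sigma>: "carrier_projection Y \<sigma>"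
    and K: "quasi_seminorm (smul Y) (\<lambda>y. qnorm Y (\<sigma> y)) K"
    and u: "u \<in> bounded_ops X Y" and D: "0 \<le> D"
    and uD: "\<And>x. qnorm Y (u (\<pi> x)) \<le> D * conv_norm (\<lambda>x. qnorm X (\<pi> x)) x"
  shows "delta X Y u \<le> ennreal (K * D)"
proof -
  define N where "N x = qnorm X (\<pi> x)" for x
  define NY where "NY y = qnorm Y (\<sigma> y)" for y
  have qY: "quasi_normed Y" and cY: "complete_qspace Y" using Y by (auto simp: quasi_banach_def)
  obtain KX where KX: "quasi_seminorm (smul X) N KX"
    using quasi_seminorm_projection[OF X \<pi>] by (auto simp: N_def[abs_def])
  interpret X: quasi_seminorm "smul X" N KX by fact
  interpret Y: quasi_seminorm "smul Y" NY K using K by (simp add: NY_def[abs_def])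
  interpret p: seminorm "smul X" "conv_norm N" by (rule X.seminorm_conv_norm)
  have \<pi>c: "\<pi> x \<in> carrier X" and \<pi>id: "x \<in> carrier X \<Longrightarrow> \<pi> x = x" for x
    using \<pi> by (auto simp: carrier_projection_def)
  have \<sigma>id: "y \<in> carrier Y \<Longrightarrow> \<sigma> y = y" for y
    using \<sigma> by (auto simp: carrier_projection_def)
  have NY: "NY y = qnorm Y y" if "y \<in> carrier Y" for y using \<sigma>id[OF that] by (simp add: NY_def)
  have subY: "Y.subspace (carrier Y)" using qY by (simp add: quasi_normed_def)
  note diffY = Y.subspace_diff[OF subY] and addY = Y.subspace_add[OF subY] and scaleY = Y.subspace_scale[OF subY]
  define t where "t x = u (\<pi> x)" for x
  interpret t: Vector_Spaces.linear "smul X" "smul Y" t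
    unfolding t_def[abs_def] by (rule linear_bounded_op_projection[OF X qY \<pi> u])
  have tY: "t x \<in> carrier Y" for x using u \<pi>c by (simp add: t_def bounded_ops_def)
  have tD: "NY (t x) \<le> D * conv_norm N x" for x
    using uD[of x] NY[OF tY] by (simp add: t_def N_def[abs_def])
  obtain B :: "('k, ('x \<Rightarrow> 'k) \<Rightarrow> 'k) qspace" and e where
    compl: "completion_map (smul X) (conv_norm N) B e" by (rule p.exists_completion)
  have B: "banach_space B" and eB: "e x \<in> carrier B" and e_add: "e (x + y) = e x + e y"
    and e_scale: "e (smul X c x) = smul B c (e x)" and e_norm: "qnorm B (e x) = conv_norm N x"
    and dense: "\<Psi> \<in> carrier B \<Longrightarrow> \<exists>x. (\<lambda>n. qnorm B (e (x n) - \<Psi>)) \<longlonglongrightarrow> 0" for x y c \<Psi>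
    using compl by (simp_all add: completion_map_def)
  have qB: "quasi_normed B" using B by (simp add: banach_space_def quasi_banach_def)
  interpret B: vector_space "smul B" using qB by (simp add: quasi_normed_def)
  have subB: "B.subspace (carrier B)" using qB by (simp add: quasi_normed_def)
  note diffB = B.subspace_diff[OF subB] and addB = B.subspace_add[OF subB] and scaleB = B.subspace_scale[OF subB]
  have B_tri: "qnorm B (\<Psi> + \<Phi>) \<le> qnorm B \<Psi> + qnorm B \<Phi>" if "\<Psi> \<in> carrier B" "\<Phi> \<in> carrier B" for \<Psi> \<Phi>
    using B that by (simp add: banach_space_def)
  have B_scale: "qnorm B (smul B c \<Psi>) = norm c * qnorm B \<Psi>" and B_nonneg: "0 \<le> qnorm B \<Psi>"
    if "\<Psi> \<in> carrier B" for c \<Psi> using qB that by (auto simp: quasi_normed_def)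
  have B_0: "qnorm B 0 = 0" using qB B.subspace_0[OF subB] by (auto simp: quasi_normed_def)
  have B_minus: "qnorm B (\<Psi> - \<Phi>) = qnorm B (\<Phi> - \<Psi>)" if "\<Psi> \<in> carrier B" "\<Phi> \<in> carrier B" for \<Psi> \<Phi>
    using B_scale[OF diffB[OF that], of "-1"] by simp
  have e_diff: "e (x - y) = e x - e y" for x y using e_add[of "x - y" y] by simp

  define R where "R \<Psi> y \<longleftrightarrow> \<Psi> \<in> carrier B \<and> y \<in> carrier Y \<and>
      (\<exists>x. (\<lambda>n. qnorm B (e (x n) - \<Psi>)) \<longlonglongrightarrow> 0 \<and> (\<lambda>n. NY (t (x n) - y)) \<longlonglongrightarrow> 0)" for \<Psi> y
  have R_exists: "\<exists>y. R \<Psi> y" if \<Psi>: "\<Psi> \<in> carrier B" for \<Psi>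
  proof -
    obtain x where x: "(\<lambda>n. qnorm B (e (x n) - \<Psi>)) \<longlonglongrightarrow> 0" using dense[OF \<Psi>] by blast
    have "\<exists>n0. \<forall>m\<ge>n0. \<forall>n\<ge>n0. qnorm Y (t (x m) - t (x n)) < \<epsilon>" if \<epsilon>: "0 < \<epsilon>" for \<epsilon>
    proof -
      define r where "r = \<epsilon> / (D + 1) / 2"
      have "0 < D + 1" using D by simp
      moreover have "r + r = \<epsilon> / (D + 1)" unfolding r_def by (rule field_sum_of_halves)
      ultimately have r: "0 < r" "(D + 1) * (r + r) = \<epsilon>"
        using \<epsilon> by (simp_all add: r_def)
      obtain n0 where n0: "\<And>n. n \<ge> n0 \<Longrightarrow> qnorm B (e (x n) - \<Psi>) < r"
        using order_tendstoD(2)[OF x r(1)] by (auto simp: eventually_sequentially)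
      have "qnorm Y (t (x m) - t (x n)) < \<epsilon>" if "m \<ge> n0" "n \<ge> n0" for m n
      proof -
        have "e (x m - x n) = (e (x m) - \<Psi>) + (\<Psi> - e (x n))" by (simp add: e_diff)
        then have "conv_norm N (x m - x n) \<le> qnorm B (e (x m) - \<Psi>) + qnorm B (\<Psi> - e (x n))"
          using B_tri[OF diffB[OF eB \<Psi>] diffB[OF \<Psi> eB], of "x m" "x n"] e_norm[of "x m - x n"] by simp
        also have "\<dots> < r + r"
          using n0[OF that(1)] n0[OF that(2)] B_minus[OF \<Psi> eB, of "x n"] by simp
        finally have less: "conv_norm N (x m - x n) < r + r" .
        have "qnorm Y (t (x m) - t (x n)) \<le> D * conv_norm N (x m - x n)"
          using tD[of "x m - x n"] NY[OF tY] by (simp add: t.diff[symmetric])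
        also have "\<dots> \<le> (D + 1) * conv_norm N (x m - x n)"
          by (intro mult_right_mono) simp_all
        also have "\<dots> < (D + 1) * (r + r)" using less D by (intro mult_strict_left_mono) auto
        finally show ?thesis using r(2) by simp
      qed
      then show ?thesis by blast
    qed
    moreover have "\<forall>n. t (x n) \<in> carrier Y" using tY by simp
    ultimately obtain y where y: "y \<in> carrier Y" "(\<lambda>n. qnorm Y (t (x n) - y)) \<longlonglongrightarrow> 0"
      using cY[unfolded complete_qspace_def, rule_format, of "\<lambda>n. t (x n)"] by blast
    have "NY (t (x n) - y) = qnorm Y (t (x n) - y)" for n by (rule NY[OF diffY[OF tY y(1)]])
    then have "(\<lambda>n. NY (t (x n) - y)) \<longlonglongrightarrow> 0" using y(2) by simp
    then show ?thesis unfolding R_def using \<Psi> y(1) x by blast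
  qed
  have R_bound: "qnorm Y y \<le> K * D * qnorm B \<Psi>" if R: "R \<Psi> y" for \<Psi> y
  proof -
    obtain x where x: "(\<lambda>n. qnorm B (e (x n) - \<Psi>)) \<longlonglongrightarrow> 0" "(\<lambda>n. NY (t (x n) - y)) \<longlonglongrightarrow> 0"
      and \<Psi>: "\<Psi> \<in> carrier B" and y: "y \<in> carrier Y" using R by (auto simp: R_def)
    have "NY y \<le> K * (NY (t (x n) - y) + D * (qnorm B (e (x n) - \<Psi>) + qnorm B \<Psi>))" for n
    proof -
      have "NY y \<le> K * (NY (t (x n)) + NY (t (x n) - y))"
        using Y.diff_triangle[of "t (x n)" "t (x n) - y"] by simp
      moreover have "NY (t (x n)) \<le> D * (qnorm B (e (x n) - \<Psi>) + qnorm B \<Psi>)"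
      proof -
        have "conv_norm N (x n) \<le> qnorm B (e (x n) - \<Psi>) + qnorm B \<Psi>"
          using B_tri[OF diffB[OF eB \<Psi>] \<Psi>, of "x n"] e_norm[of "x n"] by simp
        then show ?thesis using tD[of "x n"] mult_left_mono[OF _ D] order_trans by blast
      qed
      then have "K * (NY (t (x n)) + NY (t (x n) - y))
          \<le> K * (NY (t (x n) - y) + D * (qnorm B (e (x n) - \<Psi>) + qnorm B \<Psi>))"
        using Y.K_ge_1 by (intro mult_left_mono) auto
      ultimately show ?thesis by linarith
    qed
    moreover have "(\<lambda>n. K * (NY (t (x n) - y) + D * (qnorm B (e (x n) - \<Psi>) + qnorm B \<Psi>)))
        \<longlonglongrightarrow> K * (0 + D * (0 + qnorm B \<Psi>))"
      by (intro tendsto_intros x)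
    ultimately have "NY y \<le> K * (0 + D * (0 + qnorm B \<Psi>))"
      by (intro LIMSEQ_le_const) auto
    then show ?thesis using NY[OF y] by (simp add: mult.assoc)
  qed
  have R_add: "R (\<Psi> + \<Phi>) (y + z)" if yz: "R \<Psi> y" "R \<Phi> z" for \<Psi> \<Phi> y z
  proof -
    obtain x x' where x: "(\<lambda>n. qnorm B (e (x n) - \<Psi>)) \<longlonglongrightarrow> 0" "(\<lambda>n. NY (t (x n) - y)) \<longlonglongrightarrow> 0"
      and x': "(\<lambda>n. qnorm B (e (x' n) - \<Phi>)) \<longlonglongrightarrow> 0" "(\<lambda>n. NY (t (x' n) - z)) \<longlonglongrightarrow> 0"
      using yz unfolding R_def by blast
    have c: "\<Psi> \<in> carrier B" "\<Phi> \<in> carrier B" "y \<in> carrier Y" "z \<in> carrier Y"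
      using yz by (auto simp: R_def)
    have "(\<lambda>n. qnorm B (e (x n + x' n) - (\<Psi> + \<Phi>))) \<longlonglongrightarrow> 0"
    proof (rule tendsto_sandwich[OF _ _ tendsto_const])
      show "(\<lambda>n. qnorm B (e (x n) - \<Psi>) + qnorm B (e (x' n) - \<Phi>)) \<longlonglongrightarrow> 0"
        using tendsto_add[OF x(1) x'(1)] by simp
      show "\<forall>\<^sub>F n in sequentially. 0 \<le> qnorm B (e (x n + x' n) - (\<Psi> + \<Phi>))"
        using B_nonneg[OF diffB[OF eB addB[OF c(1,2)]]] by simp
      have eq: "e (x n + x' n) - (\<Psi> + \<Phi>) = (e (x n) - \<Psi>) + (e (x' n) - \<Phi>)" for n by (simp add: e_add)
      show "\<forall>\<^sub>F n in sequentially. qnorm B (e (x n + x' n) - (\<Psi> + \<Phi>))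
          \<le> qnorm B (e (x n) - \<Psi>) + qnorm B (e (x' n) - \<Phi>)"
        unfolding eq by (intro always_eventually allI B_tri diffB eB c)
    qed
    moreover have "(\<lambda>n. NY (t (x n + x' n) - (y + z))) \<longlonglongrightarrow> 0"
    proof (rule tendsto_sandwich[OF _ _ tendsto_const])
      show "(\<lambda>n. K * (NY (t (x n) - y) + NY (t (x' n) - z))) \<longlonglongrightarrow> 0"
        using tendsto_mult_left[OF tendsto_add[OF x(2) x'(2)], of K] by simp
      have eq: "t (x n + x' n) - (y + z) = (t (x n) - y) + (t (x' n) - z)" for n by (simp add: t.add)
      show "\<forall>\<^sub>F n in sequentially. NY (t (x n + x' n) - (y + z)) \<le> K * (NY (t (x n) - y) + NY (t (x' n) - z))"
        unfolding eq by (intro always_eventually allI Y.quasi_triangle)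
    qed simp
    ultimately show ?thesis
      unfolding R_def by (intro conjI exI[of _ "\<lambda>n. x n + x' n"] addB addY c)
  qed
  have R_scale: "R (smul B c \<Psi>) (smul Y c y)" if y: "R \<Psi> y" for c \<Psi> y
  proof -
    obtain x where x: "(\<lambda>n. qnorm B (e (x n) - \<Psi>)) \<longlonglongrightarrow> 0" "(\<lambda>n. NY (t (x n) - y)) \<longlonglongrightarrow> 0"
      and c: "\<Psi> \<in> carrier B" "y \<in> carrier Y" using y by (auto simp: R_def)
    have "e (smul X c (x n)) - smul B c \<Psi> = smul B c (e (x n) - \<Psi>)"
      "t (smul X c (x n)) - smul Y c y = smul Y c (t (x n) - y)" for n
      by (simp_all add: e_scale B.scale_right_diff_distrib t.scale Y.scale_right_diff_distrib)
    then have "(\<lambda>n. qnorm B (e (smul X c (x n)) - smul B c \<Psi>)) \<longlonglongrightarrow> 0"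
      "(\<lambda>n. NY (t (smul X c (x n)) - smul Y c y)) \<longlonglongrightarrow> 0"
      using tendsto_mult_left[OF x(1), of "norm c"] tendsto_mult_left[OF x(2), of "norm c"]
      by (simp_all add: B_scale[OF diffB[OF eB c(1)]] Y.scaled)
    then show ?thesis
      unfolding R_def using c by (intro conjI exI[of _ "\<lambda>n. smul X c (x n)"] scaleB scaleY)
  qed
  have R_e: "R (e x) (t x)" for x
    unfolding R_def using eB tY B_0 by (auto intro!: exI[of _ "\<lambda>_. x"])
  have R_unique: "y = z" if yz: "R \<Psi> y" "R \<Psi> z" for \<Psi> y z
  proof -
    have c: "y \<in> carrier Y" "z \<in> carrier Y" using yz by (auto simp: R_def)
    have "R (\<Psi> + smul B (-1) \<Psi>) (y + smul Y (-1) z)" by (intro R_add R_scale yz)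
    then have "qnorm Y (y - z) \<le> 0" using R_bound[of 0 "y - z"] B_0 by simp
    then have "qnorm Y (y - z) = 0" "y - z \<in> carrier Y"
      using diffY[OF c] qY by (auto simp: quasi_normed_def intro: antisym)
    then show "y = z" using qY by (auto simp: quasi_normed_def)
  qed
  define v where "v \<Psi> = (if \<Psi> \<in> carrier B then (THE y. R \<Psi> y) else 0)" for \<Psi>
  have v: "v \<Psi> = y" if y: "R \<Psi> y" for \<Psi> y
  proof -
    have "(THE y. R \<Psi> y) = y" using y R_unique[OF _ y] by (rule the_equality)
    moreover have "\<Psi> \<in> carrier B" using y by (simp add: R_def)
    ultimately show ?thesis by (simp add: v_def)
  qed
  have Rv: "R \<Psi> (v \<Psi>)" if "\<Psi> \<in> carrier B" for \<Psi>
    using R_exists[OF that] v by metis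
  have v_op: "v \<in> bounded_ops B Y"
    unfolding bounded_ops_def
  proof (intro CollectI conjI allI ballI impI)
    show "v \<Psi> = 0" if "\<Psi> \<notin> carrier B" for \<Psi> using that by (simp add: v_def)
    show "v \<Psi> \<in> carrier Y" if "\<Psi> \<in> carrier B" for \<Psi> using Rv[OF that] by (simp add: R_def)
    show "v (\<Psi> + \<Phi>) = v \<Psi> + v \<Phi>" if "\<Psi> \<in> carrier B" "\<Phi> \<in> carrier B" for \<Psi> \<Phi>
      by (rule v[OF R_add[OF Rv[OF that(1)] Rv[OF that(2)]]])
    show "v (smul B c \<Psi>) = smul Y c (v \<Psi>)" if "\<Psi> \<in> carrier B" for c \<Psi>
      by (rule v[OF R_scale[OF Rv[OF that]]])
    show "\<exists>k. \<forall>\<Psi>\<in>carrier B. qnorm Y (v \<Psi>) \<le> k * qnorm B \<Psi>"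
      by (intro exI[of _ "K * D"] ballI R_bound Rv)
  qed
  have v_norm: "opnorm B Y v \<le> K * D"
  proof (rule opnorm_le[OF qB _ R_bound[OF Rv]])
    show "0 \<le> K * D" using D Y.K_ge_1 by simp
  qed
  define w where "w x = (if x \<in> carrier X then e x else 0)" for x
  have subX: "X.subspace (carrier X)" using X by (simp add: quasi_normed_def)
  have w_le: "qnorm B (w x) \<le> 1 * qnorm X x" if "x \<in> carrier X" for x
    using X.conv_norm_le[of x] that \<pi>id[OF that] by (simp add: w_def e_norm N_def)
  have w_op: "w \<in> bounded_ops X B"
    unfolding bounded_ops_def
  proof (intro CollectI conjI allI ballI impI)
    show "\<exists>k. \<forall>x\<in>carrier X. qnorm B (w x) \<le> k * qnorm X x" using w_le by blast
  qed (use eB X.subspace_add[OF subX] X.subspace_scale[OF subX] in \<open>auto simp: w_def e_add e_scale\<close>)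
  have w_norm: "opnorm X B w \<le> 1" by (rule opnorm_le[OF X _ w_le]) simp
  have "u = v \<circ> w"
  proof
    fix x
    show "u x = (v \<circ> w) x"
    proof (cases "x \<in> carrier X")
      case True
      then show ?thesis using v[OF R_e, of x] \<pi>id by (simp add: w_def t_def)
    next
      case False
      have "e 0 = 0" using e_scale[of 0 0] by simp
      then have "v 0 = 0" using v[OF R_e, of 0] t.zero by simp
      then show ?thesis using False u by (simp add: w_def bounded_ops_def)
    qed
  qed
  then have "delta X Y u \<le> ennreal (opnorm B Y v * opnorm X B w)"
    using delta_le[OF X qY B w_op v_op] by simp
  also have "\<dots> \<le> ennreal (K * D)"
  proof (rule ennreal_leI)
    have "opnorm B Y v * opnorm X B w \<le> (K * D) * 1"
      using v_norm w_norm opnorm_nonneg[OF X qB w_op] opnorm_nonneg[OF qB qY v_op]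
      by (intro mult_mono) auto
    then show "opnorm B Y v * opnorm X B w \<le> K * D" by simp
  qed
  finally show ?thesis .
qed

section \<open>Strongly approximable operators\<close>

lemma bounded_ops_subspace:
  assumes V: "quasi_normed V" and W: "quasi_normed W"
  shows "module.subspace (\<lambda>c u x. smul W c (u x)) (bounded_ops V W)"
proof -
  interpret W: vector_space "smul W" using W by (simp add: quasi_normed_def)
  interpret F: vector_space "\<lambda>c u x. smul W c (u x)" by (rule W.vector_space_fun)
  have subW: "W.subspace (carrier W)" using W by (simp add: quasi_normed_def)
  have W0: "qnorm W 0 = 0" using W W.subspace_0[OF subW] by (auto simp: quasi_normed_def)
  obtain \<sigma> where \<sigma>: "carrier_projection W \<sigma>" using exists_carrier_projection[OF W] .
  obtain K where "quasi_seminorm (smul W) (\<lambda>x. qnorm W (\<sigma> x)) K"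
    using quasi_seminorm_projection[OF W \<sigma>] .
  then interpret N: quasi_seminorm "smul W" "\<lambda>x. qnorm W (\<sigma> x)" K .
  have \<sigma>id: "\<sigma> y = y" if "y \<in> carrier W" for y using \<sigma> that by (simp add: carrier_projection_def)
  show ?thesis
  proof (rule F.subspaceI)
    show "0 \<in> bounded_ops V W"
      using W.subspace_0[OF subW] W0 by (auto simp: bounded_ops_def intro!: exI[of _ 0])
  next
    fix u v assume uv: "u \<in> bounded_ops V W" "v \<in> bounded_ops V W"
    have c: "u x \<in> carrier W" "v x \<in> carrier W" "u x + v x \<in> carrier W" if "x \<in> carrier V" for x
      using uv that W.subspace_add[OF subW] by (auto simp: bounded_ops_def)
    have "qnorm W (u x + v x) \<le> K * (opnorm V W u + opnorm V W v) * qnorm V x" if x: "x \<in> carrier V" for x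
    proof -
      have "qnorm W (u x + v x) \<le> K * (qnorm W (u x) + qnorm W (v x))"
        using N.quasi_triangle[of "u x" "v x"] by (simp add: \<sigma>id c[OF x])
      also have "\<dots> \<le> K * (opnorm V W u * qnorm V x + opnorm V W v * qnorm V x)"
        using N.K_ge_1 by (intro mult_left_mono add_mono le_opnorm[OF V W] uv x) auto
      finally show ?thesis by (simp add: algebra_simps)
    qed
    then have "\<exists>k. \<forall>x\<in>carrier V. qnorm W (u x + v x) \<le> k * qnorm V x" by blast
    then show "u + v \<in> bounded_ops V W"
      using uv c by (simp add: bounded_ops_def W.scale_right_distrib)
  next
    fix a u assume u: "u \<in> bounded_ops V W"
    have c: "u x \<in> carrier W" if "x \<in> carrier V" for x using u that by (simp add: bounded_ops_def)
    have "qnorm W (smul W a (u x)) \<le> norm a * opnorm V W u * qnorm V x" if x: "x \<in> carrier V" for x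
    proof -
      have "qnorm W (smul W a (u x)) = norm a * qnorm W (u x)"
        using W c[OF x] by (simp add: quasi_normed_def)
      then show ?thesis
        using mult_left_mono[OF le_opnorm[OF V W u x] norm_ge_zero[of a]] by (simp add: mult.assoc)
    qed
    then have "\<exists>k. \<forall>x\<in>carrier V. qnorm W (smul W a (u x)) \<le> k * qnorm V x" by blast
    then show "(\<lambda>x. smul W a (u x)) \<in> bounded_ops V W"
      using u c W.subspace_scale[OF subW]
      by (simp add: bounded_ops_def W.scale_right_distrib W.scale_left_commute)
  qed
qed

text \<open>
  The set \<open>S\<close> of operators with some bound by the convex gauge is one of the sets in the
  intersection that defines \<open>strongly_approximable\<close>. Its closedness under bounded pointwise
  limits rests on \<open>SB\<close>, the a priori bound in terms of the operator norm, as the constants \<open>D\<close>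
  along a net could otherwise be unbounded.
\<close>

theorem theorem8:
  fixes X :: "('k::{real_normed_field,euclidean_space}, 'x::ab_group_add) qspace"
    and Y :: "('k, 'y::ab_group_add) qspace"
    and M :: "'m measure"
    and q :: real
  assumes "quasi_banach X"
    and "embeds_in_L1 (dual X) M"
    and "quasi_banach Y"
    and "2 \<le> q"
    and "cotype q Y"
  shows "\<exists>C\<ge>0. \<forall>u\<in>strongly_approximable X Y. delta X Y u \<le> ennreal (C * opnorm X Y u)"
proof -
  have qX: "quasi_normed X" and qY: "quasi_normed Y"
    using assms by (auto simp: quasi_banach_def)
  obtain \<pi> where \<pi>: "carrier_projection X \<pi>" using exists_carrier_projection[OF qX] .
  obtain \<sigma> where \<sigma>: "carrier_projection Y \<sigma>" using exists_carrier_projection[OF qY] .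
  let ?N = "\<lambda>x. qnorm X (\<pi> x)" and ?NY = "\<lambda>y. qnorm Y (\<sigma> y)"
  obtain KX where KX: "quasi_seminorm (smul X) ?N KX" using quasi_seminorm_projection[OF qX \<pi>] .
  obtain K where K: "quasi_seminorm (smul Y) ?NY K" using quasi_seminorm_projection[OF qY \<sigma>] .
  interpret X: quasi_seminorm "smul X" ?N KX by fact
  interpret Y: quasi_seminorm "smul Y" ?NY K by fact
  obtain c where c: "0 \<le> c" "dual_Hadamard_inequality (smul X) ?N c"
    using dual_Hadamard_inequality_if_embeds_in_L1[OF qX \<pi> assms(2)] .
  obtain C where C: "0 \<le> C" "cotype_const q (smul Y) ?NY C"
    using cotype_const_projection[OF \<sigma> assms(5)] .
  interpret P: cotype_pair "smul X" ?N KX "smul Y" ?NY K c q C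
    by unfold_locales (use c C assms(4) in auto)
  obtain B where B: "0 \<le> B"
    "\<And>u U D x. Vector_Spaces.linear (smul X) (smul Y) u \<Longrightarrow> (\<And>x. ?NY (u x) \<le> U * ?N x) \<Longrightarrow> 0 \<le> U \<Longrightarrow>
       (\<And>x. ?NY (u x) \<le> D * conv_norm ?N x) \<Longrightarrow> ?NY (u x) \<le> B * U * conv_norm ?N x"
    using P.convex_bound by blast
  have \<pi>c: "\<pi> x \<in> carrier X" and \<pi>id: "x \<in> carrier X \<Longrightarrow> \<pi> x = x" for x
    using \<pi> by (auto simp: carrier_projection_def)
  have \<sigma>id: "y \<in> carrier Y \<Longrightarrow> \<sigma> y = y" for y using \<sigma> by (simp add: carrier_projection_def)
  have uY: "u x \<in> carrier Y" if "u \<in> bounded_ops X Y" "x \<in> carrier X" for u x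
    using that by (simp add: bounded_ops_def)
  have NY_u: "?NY (u (\<pi> x)) = qnorm Y (u (\<pi> x))" if "u \<in> bounded_ops X Y" for u x
    using \<sigma>id[OF uY[OF that \<pi>c]] by simp
  have lin: "Vector_Spaces.linear (smul X) (smul Y) (\<lambda>x. u (\<pi> x))" if "u \<in> bounded_ops X Y" for u
    by (rule linear_bounded_op_projection[OF qX qY \<pi> that])
  have bound: "?NY (u (\<pi> x)) \<le> opnorm X Y u * ?N x" if "u \<in> bounded_ops X Y" for u x
    using le_opnorm[OF qX qY that \<pi>c] NY_u[OF that] by simp

  define S where "S = {u \<in> bounded_ops X Y. \<exists>D. \<forall>x. ?NY (u (\<pi> x)) \<le> D * conv_norm ?N x}"
  have SB: "?NY (u (\<pi> x)) \<le> B * opnorm X Y u * conv_norm ?N x" if "u \<in> S" for u x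
  proof -
    from that obtain D where u: "u \<in> bounded_ops X Y" and D: "\<And>x. ?NY (u (\<pi> x)) \<le> D * conv_norm ?N x"
      by (auto simp: S_def)
    show ?thesis by (rule B(2)[OF lin[OF u] bound[OF u] opnorm_nonneg[OF qX qY u] D])
  qed
  interpret F: vector_space "\<lambda>c u x. smul Y c (u x)" by (rule Y.vector_space_fun)
  have sub: "F.subspace (bounded_ops X Y)" by (rule bounded_ops_subspace[OF qX qY])
  have "F.subspace S"
  proof (rule F.subspaceI)
    show "0 \<in> S"
      using F.subspace_0[OF sub] by (auto simp: S_def intro!: exI[of _ 0])
  next
    fix u v assume uv: "u \<in> S" "v \<in> S"
    have ops: "u + v \<in> bounded_ops X Y" using uv by (intro F.subspace_add[OF sub]) (auto simp: S_def)
    have "?NY ((u + v) (\<pi> x)) \<le> K * (B * opnorm X Y u + B * opnorm X Y v) * conv_norm ?N x" for x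
    proof -
      have "?NY ((u + v) (\<pi> x)) \<le> K * (?NY (u (\<pi> x)) + ?NY (v (\<pi> x)))"
        using Y.quasi_triangle[of "u (\<pi> x)" "v (\<pi> x)"] by simp
      also have "\<dots> \<le> K * (B * opnorm X Y u * conv_norm ?N x + B * opnorm X Y v * conv_norm ?N x)"
        using Y.K_ge_1 by (intro mult_left_mono add_mono SB uv) auto
      finally show ?thesis by (simp add: algebra_simps)
    qed
    then show "u + v \<in> S" using ops unfolding S_def by blast
  next
    fix a u assume u: "u \<in> S"
    have ops: "(\<lambda>x. smul Y a (u x)) \<in> bounded_ops X Y"
      using u by (intro F.subspace_scale[OF sub]) (auto simp: S_def)
    have "?NY (smul Y a (u (\<pi> x))) \<le> norm a * (B * opnorm X Y u) * conv_norm ?N x" for x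
      using mult_left_mono[OF SB[OF u, of x] norm_ge_zero[of a]] by (simp add: Y.scaled mult.assoc)
    then show "(\<lambda>x. smul Y a (u x)) \<in> S" using ops unfolding S_def by blast
  qed
  moreover have "finite_rank_ops X Y \<subseteq> S"
  proof
    fix u assume "u \<in> finite_rank_ops X Y"
    then obtain G where u: "u \<in> bounded_ops X Y" and G: "finite G" "u ` carrier X \<subseteq> Y.span G"
      by (auto simp: finite_rank_ops_def)
    have "u (\<pi> x) = 0" if "?NY (u (\<pi> x)) = 0" for x
      using that qY uY[OF u \<pi>c] NY_u[OF u] by (auto simp: quasi_normed_def)
    moreover have "range (\<lambda>x. u (\<pi> x)) \<subseteq> Y.span G" using G(2) \<pi>c by auto
    ultimately obtain D where "\<And>x. ?NY (u (\<pi> x)) \<le> D * conv_norm ?N x"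
      using X.finite_rank_conv_bound[OF K lin[OF u] bound[OF u] opnorm_nonneg[OF qX qY u] _ G(1)]
      by blast
    then show "u \<in> S" using u by (auto simp: S_def)
  qed
  moreover have "bounded_pointwise_closed X Y S"
    unfolding bounded_pointwise_closed_def
  proof (intro allI impI)
    fix \<F> :: "('x \<Rightarrow> 'y) filter" and u L
    assume ne: "\<F> \<noteq> bot" and u: "u \<in> bounded_ops X Y"
      and ev: "\<forall>\<^sub>F v in \<F>. v \<in> S \<and> opnorm X Y v \<le> L"
      and lim: "\<forall>x\<in>carrier X. ((\<lambda>v. qnorm Y (v x - u x)) \<longlongrightarrow> 0) \<F>"
    have "?NY (u (\<pi> x)) \<le> K * B * L * conv_norm ?N x" for x
    proof -
      have subY: "Y.subspace (carrier Y)" using qY by (simp add: quasi_normed_def)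
      have "((\<lambda>v. K * (B * L * conv_norm ?N x + qnorm Y (v (\<pi> x) - u (\<pi> x))))
          \<longlongrightarrow> K * (B * L * conv_norm ?N x + 0)) \<F>"
        using lim \<pi>c by (intro tendsto_intros) auto
      moreover have "\<forall>\<^sub>F v in \<F>. ?NY (u (\<pi> x)) \<le> K * (B * L * conv_norm ?N x + qnorm Y (v (\<pi> x) - u (\<pi> x)))"
        using ev
      proof eventually_elim
        case (elim v)
        then have v: "v \<in> S" "v \<in> bounded_ops X Y" "opnorm X Y v \<le> L" by (auto simp: S_def)
        have "v (\<pi> x) - u (\<pi> x) \<in> carrier Y"
          using uY[OF v(2) \<pi>c] uY[OF u \<pi>c] by (intro Y.subspace_diff[OF subY])
        then have "?NY (u (\<pi> x)) \<le> K * (?NY (v (\<pi> x)) + qnorm Y (v (\<pi> x) - u (\<pi> x)))"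
          using Y.diff_triangle[of "v (\<pi> x)" "v (\<pi> x) - u (\<pi> x)"] by (simp add: \<sigma>id)
        moreover have "?NY (v (\<pi> x)) \<le> B * L * conv_norm ?N x"
          using SB[OF v(1), of x] v(3) B(1) X.conv_norm_nonneg[of x]
          by (meson mult_left_mono mult_right_mono order_trans)
        then have "K * (?NY (v (\<pi> x)) + qnorm Y (v (\<pi> x) - u (\<pi> x)))
            \<le> K * (B * L * conv_norm ?N x + qnorm Y (v (\<pi> x) - u (\<pi> x)))"
          using Y.K_ge_1 by (intro mult_left_mono add_right_mono) auto
        ultimately show ?case by linarith
      qed
      ultimately have "?NY (u (\<pi> x)) \<le> K * (B * L * conv_norm ?N x + 0)"
        by (rule tendsto_lowerbound[OF _ _ ne])
      then show ?thesis by (simp add: mult.assoc)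
    qed
    then show "u \<in> S" using u unfolding S_def by blast
  qed
  ultimately have SA: "strongly_approximable X Y \<subseteq> S"
    unfolding strongly_approximable_def by (intro Inter_lower) (auto simp: S_def)
  have "delta X Y u \<le> ennreal (K * B * opnorm X Y u)" if "u \<in> strongly_approximable X Y" for u
  proof -
    have u: "u \<in> S" "u \<in> bounded_ops X Y" using that SA by (auto simp: S_def)
    have "delta X Y u \<le> ennreal (K * (B * opnorm X Y u))"
    proof (rule delta_le_conv_bound[OF qX assms(3) \<pi> \<sigma> K u(2)])
      show "0 \<le> B * opnorm X Y u" using B(1) opnorm_nonneg[OF qX qY u(2)] by simp
      show "qnorm Y (u (\<pi> x)) \<le> B * opnorm X Y u * conv_norm ?N x" for x
        using SB[OF u(1), of x] NY_u[OF u(2)] by simp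
    qed
    then show ?thesis by (simp add: mult.assoc)
  qed
  moreover have "0 \<le> K * B" using B(1) Y.K_ge_1 by simp
  ultimately show ?thesis by blast
qed

end
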